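(* For every nondiscrete locally compact field $\mathbf{K}$ and every nonprincipal ultrafilter $\omega$ on the set of positive integers, the asymptotic cone $\mathrm{Cone}_\omega(A_4(\mathbf{K}))$ is simply connected.
   Context: For a commutative ring $R$, $A_4(R)$ denotes the group of upper triangular $4\times 4$ matrices over $R$ with diagonal $(1,t_{22},t_{33},1)$, where $t_{22},t_{33}\in R^\times$, and with arbitrary entries $x_{ij}\in R$ for $i<j$. The locally compact group $A_4(\mathbf{K})$ is compactly generated and is endowed with the word metric associated to a compact generating subset. Asymptotic cone: for a metric space $(X,d)$ with base-point $x_0$ and a nonprincipal ultrafilter $\omega$ on the set $\mathbf{N}$ of positive integers, let $\mathrm{Precone}(X)$ be the set of sequences $(x_n)$ in $X$ with $\limsup_n d(x_n,x_0)/n<\infty$, with pseudo-distance $d_\omega(x,y)=\lim_\omega \frac1n d(x_n,y_n)$. Then $\mathrm{Cone}_\omega(X)$ is the metric space obtained by identifying points at pseudo-distance $0$. Its bilipschitz type is a quasi-isometry invariant of $X$. *)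

theory Defs
  imports "HOL-Analysis.Analysis" "HOL-Algebra.Generated_Groups"
begin

section \<open>Topological fields\<close>

class topological_field = field + topological_ab_group_add + topological_semigroup_mult +
  assumes tendsto_inverse_nhds: "a \<noteq> 0 \<Longrightarrow> (inverse \<longlongrightarrow> inverse a) (nhds a)"

instance real_normed_field \<subseteq> topological_field
proof
  fix a :: 'a
  assume "a \<noteq> 0"
  then show "(inverse \<longlongrightarrow> inverse a) (nhds a)"
    by (intro tendsto_inverse filterlim_ident)
qed


section \<open>Simply connected spaces\<close>

text \<open>The library notion \<^const>\<open>simply_connected\<close> is for subsets of a type with a fixed topology;
  this is the version for abstract topologies: path connected, and every loop is
  homotopic to a constant loop relative to its endpoints.\<close>

definition simply_connected_space :: "'a topology \<Rightarrow> bool" where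
  "simply_connected_space X \<longleftrightarrow>
     path_connected_space X \<and>
     (\<forall>g. pathin X g \<and> g 0 = g 1 \<longrightarrow>
        homotopic_with (\<lambda>h. h 0 = g 0 \<and> h 1 = g 0) (top_of_set {0..1}) X g (\<lambda>_. g 0))"


section \<open>Asymptotic cones\<close>

text \<open>Ultrafilters are represented by the library's filters. A nonprincipal
  ultrafilter on \<^typ>\<open>nat\<close> gives no weight to \<open>{0}\<close>, so it is the same thing as a nonprincipal
  ultrafilter on the positive integers, and the terms of index \<open>0\<close> of the sequences
  below are irrelevant.\<close>

definition nonprincipal_ultrafilter :: "'a filter \<Rightarrow> bool" where
  "nonprincipal_ultrafilter F \<longleftrightarrow>
     F \<noteq> bot \<and>
     (\<forall>P. eventually P F \<or> eventually (\<lambda>x. \<not> P x) F) \<and>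
     (\<forall>a. \<not> eventually (\<lambda>x. x = a) F)"

definition precone :: "'a set \<Rightarrow> ('a \<Rightarrow> 'a \<Rightarrow> real) \<Rightarrow> 'a \<Rightarrow> (nat \<Rightarrow> 'a) set" where
  "precone X d x0 =
     {x. (\<forall>n. x n \<in> X) \<and> limsup (\<lambda>n. ereal (d (x n) x0 / real n)) < \<infinity>}"

definition precone_dist ::
    "('a \<Rightarrow> 'a \<Rightarrow> real) \<Rightarrow> nat filter \<Rightarrow> (nat \<Rightarrow> 'a) \<Rightarrow> (nat \<Rightarrow> 'a) \<Rightarrow> real" where
  "precone_dist d \<omega> x y = Lim \<omega> (\<lambda>n. d (x n) (y n) / real n)"

definition cone :: "'a set \<Rightarrow> ('a \<Rightarrow> 'a \<Rightarrow> real) \<Rightarrow> 'a \<Rightarrow> nat filter \<Rightarrow> (nat \<Rightarrow> 'a) set set" where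
  "cone X d x0 \<omega> = precone X d x0 //
     {(x, y). x \<in> precone X d x0 \<and> y \<in> precone X d x0 \<and> precone_dist d \<omega> x y = 0}"

text \<open>The value \<open>0\<close> outside the cone is only there because \<^locale>\<open>Metric_space\<close> wants the distance
  to be nonnegative and symmetric on the whole type; similarly for \<open>word_dist\<close> below.\<close>

definition cone_dist ::
    "'a set \<Rightarrow> ('a \<Rightarrow> 'a \<Rightarrow> real) \<Rightarrow> 'a \<Rightarrow> nat filter \<Rightarrow> (nat \<Rightarrow> 'a) set \<Rightarrow> (nat \<Rightarrow> 'a) set \<Rightarrow> real" where
  "cone_dist X d x0 \<omega> A B =
     (if A \<in> cone X d x0 \<omega> \<and> B \<in> cone X d x0 \<omega>
      then (THE r. \<forall>x\<in>A. \<forall>y\<in>B. r = precone_dist d \<omega> x y) else 0)"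

definition cone_topology :: "'a set \<Rightarrow> ('a \<Rightarrow> 'a \<Rightarrow> real) \<Rightarrow> 'a \<Rightarrow> nat filter \<Rightarrow> (nat \<Rightarrow> 'a) set topology" where
  "cone_topology X d x0 \<omega> = Metric_space.mtopology (cone X d x0 \<omega>) (cone_dist X d x0 \<omega>)"

context Metric_space
begin

lemma precone_tendsto:
  assumes \<omega>: "nonprincipal_ultrafilter \<omega>"
    and x: "x \<in> precone M d x0" and y: "y \<in> precone M d x0" and x0: "x0 \<in> M"
  shows "((\<lambda>n. d (x n) (y n) / real n) \<longlongrightarrow> precone_dist d \<omega> x y) \<omega>"
proof -
  have ultra: "eventually P \<omega> \<or> eventually (\<lambda>x. \<not> P x) \<omega>" for P
    using \<omega> by (auto simp: nonprincipal_ultrafilter_def)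
  have nb: "\<omega> \<noteq> bot" using \<omega> by (auto simp: nonprincipal_ultrafilter_def)
  have le: "\<omega> \<le> sequentially"
    unfolding le_filter_def
  proof (intro allI impI)
    fix P :: "nat \<Rightarrow> bool"
    assume "eventually P sequentially"
    then obtain N where N: "\<And>n. n \<ge> N \<Longrightarrow> P n" by (auto simp: eventually_sequentially)
    have "eventually (\<lambda>n. n \<noteq> a) \<omega>" for a
      using ultra[of "\<lambda>n. n = a"] \<omega> by (auto simp: nonprincipal_ultrafilter_def)
    then have "eventually (\<lambda>n. \<forall>a\<in>{..<N}. n \<noteq> a) \<omega>"
      by (subst eventually_ball_finite_distrib) auto
    then show "eventually P \<omega>"
    proof eventually_elim
      case (elim n)
      then have "n \<ge> N" by (metis lessThan_iff not_le)
      then show "P n" by (rule N)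
    qed
  qed
  have bd: "\<exists>C. eventually (\<lambda>n. d (z n) x0 / real n \<le> C) sequentially"
    if "z \<in> precone M d x0" for z
  proof -
    have "limsup (\<lambda>n. ereal (d (z n) x0 / real n)) < \<infinity>"
      using that by (auto simp: precone_def)
    then obtain C :: real where "limsup (\<lambda>n. ereal (d (z n) x0 / real n)) < ereal C"
      using ereal_dense2 by blast
    then have "eventually (\<lambda>n. ereal (d (z n) x0 / real n) < ereal C) sequentially"
      by (rule Limsup_lessD)
    then show ?thesis by (intro exI[of _ C]) (auto elim!: eventually_mono)
  qed
  obtain C1 where C1: "eventually (\<lambda>n. d (x n) x0 / real n \<le> C1) sequentially" using bd x by blast
  obtain C2 where C2: "eventually (\<lambda>n. d (y n) x0 / real n \<le> C2) sequentially" using bd y by blast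
  let ?f = "\<lambda>n. d (x n) (y n) / real n"
  have "eventually (\<lambda>n. ?f n \<in> {0..C1 + C2}) sequentially"
    using C1 C2
  proof eventually_elim
    case (elim n)
    have "d (x n) (y n) \<le> d (x n) x0 + d (y n) x0"
      using triangle[of "x n" x0 "y n"] x y x0 commute[of x0 "y n"] by (auto simp: precone_def)
    then have "?f n \<le> (d (x n) x0 + d (y n) x0) / real n"
      by (intro divide_right_mono) auto
    then show ?case using elim by (auto simp: add_divide_distrib)
  qed
  then have "eventually (\<lambda>n. ?f n \<in> {0..C1 + C2}) \<omega>"
    using le by (rule filter_leD[rotated])
  then have "eventually (\<lambda>r. r \<in> {0..C1 + C2}) (filtermap ?f \<omega>)"
    by (simp add: eventually_filtermap)
  moreover have "filtermap ?f \<omega> \<noteq> bot" using nb by (simp add: filtermap_bot_iff)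
  ultimately obtain l where l: "inf (nhds l) (filtermap ?f \<omega>) \<noteq> bot"
    using compact_Icc[of 0 "C1 + C2"] unfolding compact_filter by blast
  have "(?f \<longlongrightarrow> l) \<omega>"
    unfolding filterlim_iff
  proof (intro allI impI)
    fix P assume P: "eventually P (nhds l)"
    show "eventually (\<lambda>n. P (?f n)) \<omega>"
    proof (rule ccontr)
      assume "\<not> ?thesis"
      then have "eventually (\<lambda>r. \<not> P r) (filtermap ?f \<omega>)"
        using ultra[of "\<lambda>n. P (?f n)"] by (auto simp: eventually_filtermap)
      then have "eventually (\<lambda>_. False) (inf (nhds l) (filtermap ?f \<omega>))"
        using P unfolding eventually_inf by blast
      then show False using l by (simp add: trivial_limit_def)
    qed
  qed
  then show ?thesis using tendsto_Lim[OF nb] by (auto simp: precone_dist_def)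
qed

lemma Metric_space_cone:
  assumes \<omega>: "nonprincipal_ultrafilter \<omega>" and x0: "x0 \<in> M"
  shows "Metric_space (cone M d x0 \<omega>) (cone_dist M d x0 \<omega>)"
proof -
  let ?P = "precone M d x0" and ?D = "precone_dist d \<omega>"
  let ?R = "{(x, y). x \<in> ?P \<and> y \<in> ?P \<and> ?D x y = 0}"
  have nb: "\<omega> \<noteq> bot" using \<omega> by (auto simp: nonprincipal_ultrafilter_def)
  note T = precone_tendsto[OF \<omega> _ _ x0]
  have nn: "0 \<le> ?D x y" if "x \<in> ?P" "y \<in> ?P" for x y
    by (rule tendsto_lowerbound[OF T[OF that]]) (auto simp: nb)
  have sym: "?D x y = ?D y x" for x y
    by (simp add: precone_dist_def commute)
  have tri: "?D x z \<le> ?D x y + ?D y z" if "x \<in> ?P" "y \<in> ?P" "z \<in> ?P" for x y z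
  proof (rule tendsto_le[OF nb tendsto_add[OF T[OF that(1,2)] T[OF that(2,3)]] T[OF that(1,3)]])
    have "d (x n) (z n) / real n \<le> d (x n) (y n) / real n + d (y n) (z n) / real n" for n
      unfolding add_divide_distrib[symmetric]
      by (intro divide_right_mono triangle) (use that in \<open>auto simp: precone_def\<close>)
    then show "\<forall>\<^sub>F n in \<omega>. d (x n) (z n) / real n \<le> d (x n) (y n) / real n + d (y n) (z n) / real n"
      by simp
  qed
  have refl: "?D x x = 0" if "x \<in> ?P" for x
  proof -
    have "d (x n) (x n) = 0" for n using that by (auto simp: precone_def)
    then show ?thesis using T[OF that that] nb by (simp add: tendsto_const_iff)
  qed
  have eq: "equiv ?P ?R"
  proof (rule equivI)
    show "?R \<subseteq> ?P \<times> ?P" by auto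
    show "refl_on ?P ?R" by (auto simp: refl_on_def refl)
    show "Relation.sym ?R" by (auto simp: sym_def sym)
    show "Relation.trans ?R"
      by (auto simp: trans_def) (metis add.right_neutral antisym nn tri)
  qed
  have cls: "\<exists>x\<in>?P. A = ?R `` {x}" if "A \<in> cone M d x0 \<omega>" for A
    using that by (auto simp: cone_def quotient_def)
  have incone: "?R `` {x} \<in> cone M d x0 \<omega>" if "x \<in> ?P" for x
    using that unfolding cone_def by (rule quotientI)
  have D: "cone_dist M d x0 \<omega> (?R `` {x}) (?R `` {y}) = ?D x y" if "x \<in> ?P" "y \<in> ?P" for x y
  proof -
    have *: "?D x' y' = ?D x y" if "x' \<in> ?R `` {x}" "y' \<in> ?R `` {y}" for x' y'
    proof -
      have a: "x' \<in> ?P" "y' \<in> ?P" "?D x x' = 0" "?D y y' = 0" using that by auto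
      have "?D x' y' \<le> ?D x' x + (?D x y + ?D y y')"
        using tri[of x' x y'] tri[of x y y'] a \<open>x \<in> ?P\<close> \<open>y \<in> ?P\<close> by auto
      moreover have "?D x y \<le> ?D x x' + (?D x' y' + ?D y' y)"
        using tri[of x x' y] tri[of x' y' y] a \<open>x \<in> ?P\<close> \<open>y \<in> ?P\<close> by auto
      ultimately show ?thesis using a sym[of x' x] sym[of y' y] by auto
    qed
    have m: "x \<in> ?R `` {x}" "y \<in> ?R `` {y}" using that refl by auto
    have "(THE r. \<forall>x'\<in>?R `` {x}. \<forall>y'\<in>?R `` {y}. r = ?D x' y') = ?D x y"
    proof (rule the_equality)
      show "\<forall>x'\<in>?R `` {x}. \<forall>y'\<in>?R `` {y}. ?D x y = ?D x' y'" using *[symmetric] by blast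
      show "r = ?D x y" if "\<forall>x'\<in>?R `` {x}. \<forall>y'\<in>?R `` {y}. r = ?D x' y'" for r
        using bspec[OF bspec[OF that m(1)] m(2)] .
    qed
    then show ?thesis unfolding cone_dist_def using incone that by simp
  qed
  show ?thesis
  proof
    fix A B
    show "0 \<le> cone_dist M d x0 \<omega> A B"
    proof (cases "A \<in> cone M d x0 \<omega> \<and> B \<in> cone M d x0 \<omega>")
      case True
      then obtain x y where "x \<in> ?P" "y \<in> ?P" "A = ?R `` {x}" "B = ?R `` {y}" using cls by meson
      then show ?thesis using D nn by simp
    qed (auto simp: cone_dist_def)
    show "cone_dist M d x0 \<omega> A B = cone_dist M d x0 \<omega> B A"
    proof (cases "A \<in> cone M d x0 \<omega> \<and> B \<in> cone M d x0 \<omega>")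
      case True
      then obtain x y where "x \<in> ?P" "y \<in> ?P" "A = ?R `` {x}" "B = ?R `` {y}" using cls by meson
      then show ?thesis using D[of x y] D[of y x] sym[of x y] by (simp only:)
    qed (auto simp: cone_dist_def)
  next
    fix A B assume "A \<in> cone M d x0 \<omega>" "B \<in> cone M d x0 \<omega>"
    then obtain x y where xy: "x \<in> ?P" "y \<in> ?P" "A = ?R `` {x}" "B = ?R `` {y}" using cls by meson
    then show "cone_dist M d x0 \<omega> A B = 0 \<longleftrightarrow> A = B"
      using D eq_equiv_class_iff[OF eq xy(1,2)] by simp
  next
    fix A B C assume "A \<in> cone M d x0 \<omega>" "B \<in> cone M d x0 \<omega>" "C \<in> cone M d x0 \<omega>"
    then obtain x y z where "x \<in> ?P" "y \<in> ?P" "z \<in> ?P"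
        "A = ?R `` {x}" "B = ?R `` {y}" "C = ?R `` {z}" using cls by meson
    then show "cone_dist M d x0 \<omega> A C \<le> cone_dist M d x0 \<omega> A B + cone_dist M d x0 \<omega> B C"
      using D tri by simp
  qed
qed

end


section \<open>Word metrics\<close>

definition word_length :: "('a, 'b) monoid_scheme \<Rightarrow> 'a set \<Rightarrow> 'a \<Rightarrow> nat" where
  "word_length G S g =
     (LEAST n. \<exists>xs. length xs = n \<and> set xs \<subseteq> S \<union> m_inv G ` S \<and> g = foldr (mult G) xs \<one>\<^bsub>G\<^esub>)"

definition word_dist :: "('a, 'b) monoid_scheme \<Rightarrow> 'a set \<Rightarrow> 'a \<Rightarrow> 'a \<Rightarrow> real" where
  "word_dist G S g h =
     (if g \<in> carrier G \<and> h \<in> carrier G then real (word_length G S (inv\<^bsub>G\<^esub> g \<otimes>\<^bsub>G\<^esub> h)) else 0)"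

lemma (in group) Metric_space_word_dist:
  assumes S: "S \<subseteq> carrier G" and gen: "generate G S = carrier G"
  shows "Metric_space (carrier G) (word_dist G S)"
proof -
  define T where "T = S \<union> m_inv G ` S"
  let ?w = "\<lambda>xs. foldr (mult G) xs \<one>"
  have T: "T \<subseteq> carrier G" "\<And>x. x \<in> T \<Longrightarrow> inv x \<in> T" using S by (auto simp: T_def)
  have wc: "?w xs \<in> carrier G" if "set xs \<subseteq> T" for xs
    using that T by (induction xs) auto
  have app: "?w (xs @ ys) = ?w xs \<otimes> ?w ys" if "set xs \<subseteq> T" "set ys \<subseteq> T" for xs ys
    using that T wc by (induction xs) (auto simp: m_assoc subset_iff)
  have invw: "\<exists>ys. length ys = length xs \<and> set ys \<subseteq> T \<and> inv (?w xs) = ?w ys" if "set xs \<subseteq> T" for xs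
    using that
  proof (induction xs)
    case (Cons a xs)
    then obtain ys where ys: "length ys = length xs" "set ys \<subseteq> T" "inv (?w xs) = ?w ys" by auto
    have a: "a \<in> T" "a \<in> carrier G" "?w xs \<in> carrier G" using Cons T wc by auto
    have "inv (?w (a # xs)) = ?w ys \<otimes> inv a" using a ys(3) by (simp add: inv_mult_group)
    also have "\<dots> = ?w (ys @ [inv a])" using app[of ys "[inv a]"] ys a T by auto
    finally show ?case using ys a T by (intro exI[of _ "ys @ [inv a]"]) auto
  qed auto
  have ex: "\<exists>xs. set xs \<subseteq> T \<and> g = ?w xs" if "g \<in> generate G S" for g
    using that
  proof induction
    case one then show ?case by (intro exI[of _ "[]"]) auto
  next
    case (incl h) then show ?case using S by (intro exI[of _ "[h]"]) (auto simp: T_def)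
  next
    case (inv h) then show ?case using S by (intro exI[of _ "[inv h]"]) (auto simp: T_def)
  next
    case (eng h1 h2)
    then obtain xs ys where "set xs \<subseteq> T" "h1 = ?w xs" "set ys \<subseteq> T" "h2 = ?w ys" by auto
    then show ?case using app by (intro exI[of _ "xs @ ys"]) auto
  qed
  let ?l = "word_length G S"
  have att: "\<exists>xs. length xs = ?l g \<and> set xs \<subseteq> T \<and> g = ?w xs" if g: "g \<in> carrier G" for g
    unfolding word_length_def T_def[symmetric]
    by (rule LeastI_ex) (use ex[of g] g gen in auto)
  have le: "?l (?w xs) \<le> length xs" if "set xs \<subseteq> T" for xs
    unfolding word_length_def T_def[symmetric] by (rule Least_le) (use that in auto)
  have linv: "?l (inv g) \<le> ?l g" if "g \<in> carrier G" for g
    using att[OF that] invw le by metis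
  have lmult: "?l (g \<otimes> h) \<le> ?l g + ?l h" if gh: "g \<in> carrier G" "h \<in> carrier G" for g h
  proof -
    obtain xs ys where 1: "length xs = ?l g" "set xs \<subseteq> T" "g = ?w xs"
        "length ys = ?l h" "set ys \<subseteq> T" "h = ?w ys"
      using att[OF gh(1)] att[OF gh(2)] by blast
    then have "?l (g \<otimes> h) \<le> length (xs @ ys)" using le[of "xs @ ys"] app by simp
    then show ?thesis using 1 by simp
  qed
  show ?thesis
  proof
    fix g h
    show "0 \<le> word_dist G S g h" by (simp add: word_dist_def)
    have "?l (inv g \<otimes> h) \<le> ?l (inv h \<otimes> g)" if "g \<in> carrier G" "h \<in> carrier G" for g h
      using linv[of "inv h \<otimes> g"] that by (simp add: inv_mult_group)
    then show "word_dist G S g h = word_dist G S h g"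
      by (auto simp: word_dist_def intro: antisym)
  next
    fix g h assume gh: "g \<in> carrier G" "h \<in> carrier G"
    have "?l (inv g \<otimes> h) = 0 \<longleftrightarrow> inv g \<otimes> h = \<one>"
      using att[of "inv g \<otimes> h"] le[of "[]"] gh by auto
    also have "\<dots> \<longleftrightarrow> g = h"
    proof
      assume "inv g \<otimes> h = \<one>"
      then have "inv h = inv g" using gh by (intro inv_equality) auto
      then have "inv (inv h) = inv (inv g)" by (rule arg_cong)
      then show "g = h" using gh by simp
    qed (use gh in auto)
    finally show "word_dist G S g h = 0 \<longleftrightarrow> g = h" using gh by (simp add: word_dist_def)
  next
    fix a b c assume abc: "a \<in> carrier G" "b \<in> carrier G" "c \<in> carrier G"
    have "inv a \<otimes> c = (inv a \<otimes> b) \<otimes> (inv b \<otimes> c)"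
      using abc m_assoc[of b "inv b" c] m_assoc[of "inv a" b "inv b \<otimes> c"] by simp
    then show "word_dist G S a c \<le> word_dist G S a b + word_dist G S b c"
      using lmult[of "inv a \<otimes> b" "inv b \<otimes> c"] abc by (simp add: word_dist_def)
  qed
qed


section \<open>The group of matrices\<close>

text \<open>\<open>x $ i $ j\<close> is the entry in row \<open>i\<close> and column \<open>j\<close>; \<open>x dvd 1\<close> says that \<open>x\<close> is a unit.
  In the index type \<open>4\<close> one has \<open>4 = 0\<close>, but \<open>1, 2, 3, 4\<close> are its four distinct elements.\<close>

definition A4_carrier :: "('r::comm_ring_1 ^ 4 ^ 4) set" where
  "A4_carrier = {x.
     x $ 2 $ 1 = 0 \<and> x $ 3 $ 1 = 0 \<and> x $ 3 $ 2 = 0 \<and>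
     x $ 4 $ 1 = 0 \<and> x $ 4 $ 2 = 0 \<and> x $ 4 $ 3 = 0 \<and>
     x $ 1 $ 1 = 1 \<and> x $ 2 $ 2 dvd 1 \<and> x $ 3 $ 3 dvd 1 \<and> x $ 4 $ 4 = 1}"

definition A4 :: "('r::comm_ring_1 ^ 4 ^ 4) monoid" where
  "A4 = \<lparr>carrier = A4_carrier, mult = (**), one = mat 1\<rparr>"

lemma group_A4: "group (A4 :: ('r::comm_ring_1 ^ 4 ^ 4) monoid)"
proof (rule groupI)
  fix x y z :: "'r ^ 4 ^ 4"
  assume x: "x \<in> carrier A4"
  show "\<one>\<^bsub>A4\<^esub> \<otimes>\<^bsub>A4\<^esub> x = x" by (simp add: A4_def)
  show "x \<otimes>\<^bsub>A4\<^esub> y \<otimes>\<^bsub>A4\<^esub> z = x \<otimes>\<^bsub>A4\<^esub> (y \<otimes>\<^bsub>A4\<^esub> z)" by (simp add: A4_def matrix_mul_assoc)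
  show "x \<otimes>\<^bsub>A4\<^esub> y \<in> carrier A4" if "y \<in> carrier A4"
    using x that mult_dvd_mono[of "x $ 2 $ 2" 1 "y $ 2 $ 2" 1] mult_dvd_mono[of "x $ 3 $ 3" 1 "y $ 3 $ 3" 1]
    by (simp add: A4_def A4_carrier_def matrix_matrix_mult_def sum_4)
  show "\<exists>y\<in>carrier A4. y \<otimes>\<^bsub>A4\<^esub> x = \<one>\<^bsub>A4\<^esub>"
  proof -
    obtain a b where ab: "x $ 2 $ 2 * a = 1" "x $ 3 $ 3 * b = 1"
      using x by (auto simp: A4_def A4_carrier_def dvd_def)
    define p where "p = - x$1$2 * a"
    define q where "q = - a * x$2$3 * b"
    define r where "r = - b * x$3$4"
    define s where "s = (- x$1$3 - p * x$2$3) * b"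
    define t where "t = - (a * x$2$4 + q * x$3$4)"
    define u where "u = - (x$1$4 + p * x$2$4 + s * x$3$4)"
    define y :: "'r ^ 4 ^ 4" where
      "y = (\<chi> i j. if i = 1 then if j = 1 then 1 else if j = 2 then p else if j = 3 then s else u
         else if i = 2 then if j = 1 then 0 else if j = 2 then a else if j = 3 then q else t
         else if i = 3 then if j = 3 then b else if j = 4 then r else 0
         else if j = 4 then 1 else 0)"
    have y: "y$1$1 = 1" "y$1$2 = p" "y$1$3 = s" "y$1$4 = u" "y$2$1 = 0" "y$2$2 = a" "y$2$3 = q" "y$2$4 = t"
       "y$3$1 = 0" "y$3$2 = 0" "y$3$3 = b" "y$3$4 = r" "y$4$1 = 0" "y$4$2 = 0" "y$4$3 = 0" "y$4$4 = 1"
      unfolding y_def by simp_all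
    have k12: "a * x$2$2 = 1" "b * x$3$3 = 1"
      using ab by (simp_all add: mult.commute)
    then have k: "a * x$2$2 = 1" "b * x$3$3 = 1" "c * a * x$2$2 = c" "c * b * x$3$3 = c" for c
      by (simp_all add: mult.assoc)
    have "s * x$3$3 = - x$1$3 - p * x$2$3"
      by (simp only: s_def k(4))
    then have e: "x$1$2 + p * x$2$2 = 0" "x$1$3 + p * x$2$3 + s * x$3$3 = 0"
        "x$1$4 + p * x$2$4 + s * x$3$4 + u = 0" "a * x$2$3 + q * x$3$3 = 0"
        "a * x$2$4 + q * x$3$4 + t = 0" "b * x$3$4 + r = 0"
      using k(3)[of "x$1$2"] k(4)[of "a * x$2$3"]
      by (simp_all add: p_def q_def r_def t_def u_def)
    have "y \<in> carrier A4"
      using k(1,2) by (simp add: A4_def A4_carrier_def y) (metis dvd_triv_left)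
    moreover have "y ** x = mat 1"
      using x k(1,2) e
      by (simp add: vec_eq_iff forall_4 matrix_matrix_mult_def sum_4 y A4_def A4_carrier_def mat_def)
    ultimately show ?thesis by (auto simp: A4_def)
  qed
qed (auto simp: A4_def A4_carrier_def mat_def)

end

theory Submission
  imports Defs "HOL-Probability.Discrete_Topology" "HOL-Library.Function_Algebras"
begin

text \<open>
  The group of matrices is \<open>U D\<close>, with \<open>U\<close> unitriangular and \<open>D\<close> diagonal. Choose an element
  \<open>\<beta>\<close> of the field whose negative powers tend to zero and measure every element \<open>x\<close> by the
  exponent \<open>m\<close> at which \<open>x\<close> is comparable to \<open>\<beta>\<close> to the power \<open>m\<close>, its size. Up to multiplicative and
  additive constants the word length of a matrix is the largest size of its coordinates and of the
  inverses of its diagonal entries (\<open>word_length_lower\<close>, \<open>word_length_upper\<close>). After rescaling by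
  \<open>1/n\<close>, the diagonal part of a sequence of matrices becomes a point \<open>p = (p_2, p_3)\<close> of the plane.
  So the cone is a union of flats \<open>\<Phi> u\<close>, each a map defined on the plane, where \<open>u\<close> runs through
  sequences in \<open>U\<close> with entries of at most exponential growth. The points \<open>\<Phi> u p\<close> and \<open>\<Phi> (u w) p\<close>
  agree if and only if every entry of \<open>w\<close> in position \<open>(i, j)\<close> has rescaled size at most \<open>p_i - p_j\<close>, where
  \<open>p_1 = p_4 = 0\<close>. Such \<open>w\<close> form a group, the stabiliser \<open>stab p\<close>.

  The topological half of the proof is \<open>nullhomotopic_if_triangles_fill\<close>: a loop is the limit of
  dyadic polygons made of chosen paths, and two consecutive polygons differ by small triangles.
  If a triangle of chosen paths can be filled within a diameter proportional to its size, the
  homotopies between consecutive polygons converge, and every loop is contractible.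

  The chosen paths run in finitely many flats: for \<open>w\<close> in \<open>stab q\<close>, go from \<open>\<Phi> u p\<close> to \<open>\<Phi> u q\<close>, which is
  \<open>\<Phi> (u w) q\<close>, and return to \<open>\<Phi> (u w) p\<close>. Since flats are contractible and the set of \<open>q\<close> fixed by \<open>w\<close> is convex,
  the homotopy class of this path depends on \<open>w\<close> alone, and for elements of one stabiliser it
  is multiplicative. Filling triangles thus becomes an algebraic question: does every relation
  between elements of the stabilisers of points near \<open>p\<close> follow from the relations inside the
  stabilisers of points that are at most a constant factor further away?

  The answer is yes, by an argument of Abels. The groups of matrices supported at
  \<open>{12, 13, 23}\<close>, at \<open>{23, 24, 34}\<close>, at \<open>{12, 34}\<close> and at \<open>{13, 23, 24}\<close> are each contracted by a diagonal
  matrix, so their elements of bounded size all lie in one stabiliser. This gives every commutation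
  relation of \<open>U\<close> between entries above the diagonal, except those that produce the central entry \<open>14\<close>,
  which no diagonal matrix contracts. But conjugating the relation \<open>[x23, x34] = x24\<close> by \<open>x12\<close> shows
  \<open>[x12(a), x24(b c)] = [x13(a b), x34(c)]\<close> (\<open>commutator_transfer\<close>); hence both depend only on
  \<open>a b c\<close>, and they are central because each generator commutes with the ingredients of one of the
  two, apart from \<open>x23\<close>, for which the same follows from the other relations. So the normal form of
  \<open>U\<close> can be reached using these relations only (\<open>word_eq_normal_form\<close>).
\<close>

section \<open>Loops filled by triangles of controlled size\<close>

text \<open>A homotopy between paths with fixed endpoints that stays within \<open>\<epsilon>\<close> of the path \<open>\<gamma>\<close>, measured at
  equal times. Comparing with \<open>\<gamma>\<close> pointwise is what lets infinitely many homotopies be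
  concatenated.\<close>

definition tracked_homotopy ::
  "'a::real_normed_vector set \<Rightarrow> (real \<Rightarrow> 'a) \<Rightarrow> real \<Rightarrow> (real \<Rightarrow> 'a) \<Rightarrow> (real \<Rightarrow> 'a) \<Rightarrow> (real \<times> real \<Rightarrow> 'a) \<Rightarrow> bool" where
  "tracked_homotopy M \<gamma> \<epsilon> p q h \<longleftrightarrow>
     continuous_on ({0..1} \<times> {0..1}) h \<and> h \<in> {0..1} \<times> {0..1} \<rightarrow> M \<and>
     (\<forall>t\<in>{0..1}. h (0, t) = p t \<and> h (1, t) = q t) \<and>
     (\<forall>s\<in>{0..1}. h (s, 0) = p 0 \<and> h (s, 1) = p 1) \<and>
     (\<forall>s\<in>{0..1}. \<forall>t\<in>{0..1}. dist (h (s, t)) (\<gamma> t) \<le> \<epsilon>)"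

lemma tracked_homotopy_join:
  assumes 1: "tracked_homotopy M (subpath 0 (1/2) \<gamma>) \<epsilon> p1 q1 h1"
    and 2: "tracked_homotopy M (subpath (1/2) 1 \<gamma>) \<epsilon> p2 q2 h2"
    and j: "p1 1 = p2 0"
  shows "tracked_homotopy M \<gamma> \<epsilon> (p1 +++ p2) (q1 +++ q2)
           (\<lambda>y. ((\<lambda>t. h1 (fst y, t)) +++ (\<lambda>t. h2 (fst y, t))) (snd y))"
proof -
  let ?h = "\<lambda>y. ((\<lambda>t. h1 (fst y, t)) +++ (\<lambda>t. h2 (fst y, t))) (snd y)"
  have c: "continuous_on ({0..1} \<times> {0..1}) ?h"
    by (rule continuous_on_homotopic_join_lemma)
      (use 1 2 j in \<open>auto simp: tracked_homotopy_def pathstart_def pathfinish_def\<close>)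
  have v: "?h (s, t) = (if t \<le> 1/2 then h1 (s, 2 * t) else h2 (s, 2 * t - 1))" for s t
    by (simp add: joinpaths_def)
  have sub: "subpath 0 (1/2) \<gamma> (2 * t) = \<gamma> t" "subpath (1/2) 1 \<gamma> (2 * t - 1) = \<gamma> t" for t
    by (simp_all add: subpath_def field_simps)
  show ?thesis
    unfolding tracked_homotopy_def
  proof (intro conjI ballI c)
    have "h1 (s, t) \<in> M" "h2 (s, t) \<in> M" if "s \<in> {0..1}" "t \<in> {0..1}" for s t
      using 1 2 that unfolding tracked_homotopy_def by blast+
    then show "?h \<in> {0..1} \<times> {0..1} \<rightarrow> M"
      by (auto simp: joinpaths_def)
    fix s t :: real assume s: "s \<in> {0..1}" and t: "t \<in> {0..1}"
    show "dist (?h (s, t)) (\<gamma> t) \<le> \<epsilon>"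
    proof (cases "t \<le> 1/2")
      case True
      then have "dist (h1 (s, 2 * t)) (subpath 0 (1/2) \<gamma> (2 * t)) \<le> \<epsilon>"
        using 1 s t by (auto simp: tracked_homotopy_def)
      then show ?thesis using True unfolding v sub by simp
    next
      case False
      then have "dist (h2 (s, 2 * t - 1)) (subpath (1/2) 1 \<gamma> (2 * t - 1)) \<le> \<epsilon>"
        using 2 s t by (auto simp: tracked_homotopy_def)
      then show ?thesis using False unfolding v sub by simp
    qed
  qed (use 1 2 in \<open>auto simp: tracked_homotopy_def joinpaths_def\<close>)
qed

text \<open>The homotopies are put on consecutive unit intervals, giving a map on a half-line times the unit
  interval. Compactifying the half-line by the path \<open>\<gamma>\<close> keeps it continuous because the
  homotopies converge uniformly to \<open>\<gamma>\<close>.\<close>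

lemma concat_homotopies_converging:
  fixes M :: "'a::real_normed_vector set"
  assumes h: "\<And>k. tracked_homotopy M \<gamma> (\<epsilon> k) (f k) (f (Suc k)) (h k)"
    and \<epsilon>: "\<epsilon> \<longlonglongrightarrow> 0"
    and \<gamma>: "path \<gamma>" "path_image \<gamma> \<subseteq> M"
    and ends: "\<And>k. f k 0 = \<gamma> 0" "\<And>k. f k 1 = \<gamma> 1"
  shows "homotopic_paths M (f 0) \<gamma>"
proof -
  define G where "G = (\<lambda>(s, t). h (nat \<lfloor>s\<rfloor>) (frac s, t))"
  let ?I = "{0..1::real}"
  have hM: "h k (s, t) \<in> M" and he: "dist (h k (s, t)) (\<gamma> t) \<le> \<epsilon> k"
    if "s \<in> ?I" "t \<in> ?I" for k s t
    using h[of k] that unfolding tracked_homotopy_def by auto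
  have h01: "h k (0, t) = f k t" "h k (1, t) = f (Suc k) t" if "t \<in> ?I" for k t
    using h[of k] that unfolding tracked_homotopy_def by auto
  have hends: "h k (s, 0) = \<gamma> 0" "h k (s, 1) = \<gamma> 1" if "s \<in> ?I" for k s
    using h[of k] that ends unfolding tracked_homotopy_def by auto
  have fr: "frac s \<in> ?I" for s :: real by (simp add: frac_ge_0 less_imp_le frac_lt_1)
  have Gc: "continuous_on ({0..real n} \<times> ?I) G" for n
  proof (induction n)
    case 0
    have "continuous_on ({0..1} \<times> ?I) (h 0)" using h[of 0] by (simp add: tracked_homotopy_def)
    then have "continuous_on ({0} \<times> ?I) (h 0)" by (rule continuous_on_subset) auto
    then have "continuous_on ({0} \<times> ?I) G"
      by (rule continuous_on_eq) (auto simp: G_def)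
    then show ?case by simp
  next
    case (Suc n)
    have "continuous_on ({real n..real (Suc n)} \<times> ?I) (\<lambda>y. h n (fst y - real n, snd y))"
    proof (rule continuous_on_compose2[of "?I \<times> ?I" "h n"])
      show "continuous_on (?I \<times> ?I) (h n)" using h[of n] by (simp add: tracked_homotopy_def)
    qed (auto intro!: continuous_intros)
    then have step: "continuous_on ({real n..real (Suc n)} \<times> ?I) G"
    proof (rule continuous_on_eq)
      fix y assume y: "y \<in> {real n..real (Suc n)} \<times> ?I"
      obtain s t where st: "y = (s, t)" by (cases y)
      show "h n (fst y - real n, snd y) = G y"
      proof (cases "s = real (Suc n)")
        case True
        then have "\<lfloor>s\<rfloor> = 1 + int n" "frac s = 0" "s - real n = 1" by (auto simp: frac_def)
        then show ?thesis using y by (simp add: st G_def nat_add_distrib h01 del: frac_eq_0_iff)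
      next
        case False
        then have "\<lfloor>s\<rfloor> = int n" using y st by (intro floor_unique) auto
        then show ?thesis by (simp add: st G_def frac_def)
      qed
    qed
    have "{0..real (Suc n)} \<times> ?I = {0..real n} \<times> ?I \<union> {real n..real (Suc n)} \<times> ?I" by auto
    then show ?case
      using continuous_on_closed_Un[OF _ _ Suc.IH step] by (simp add: closed_Times)
  qed
  define H where "H = (\<lambda>(s, t). if s = 1 then \<gamma> t else G (s / (1 - s), t))"
  have HM: "H (s, t) \<in> M" if "s \<in> ?I" "t \<in> ?I" for s t
    using that \<gamma>(2) fr hM by (auto simp: H_def G_def path_image_def)
  \<comment> \<open>Away from the end, the half-line is seen through \<open>s \<mapsto> s / (1 - s)\<close>, which takes it only up to some \<open>n\<close>.\<close>
  have low: "continuous_on ({0..s'} \<times> ?I) H" if s': "0 \<le> s'" "s' < 1" for s'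
  proof -
    obtain n where n: "s' / (1 - s') \<le> real n" using real_arch_simple by blast
    have "s / (1 - s) \<in> {0..real n}" if "s \<in> {0..s'}" for s
    proof -
      have "s / (1 - s) \<le> s' / (1 - s')"
        using that s' by (intro frac_le) auto
      then show ?thesis using that s' n by auto
    qed
    then have "continuous_on ({0..s'} \<times> ?I) (\<lambda>y. G (fst y / (1 - fst y), snd y))"
      using s' by (intro continuous_on_compose2[OF Gc[of n]] continuous_intros) auto
    then show ?thesis
      by (rule continuous_on_eq) (use s' in \<open>auto simp: H_def\<close>)
  qed
  have Hc: "continuous_on (?I \<times> ?I) H"
    unfolding continuous_on_eq_continuous_within
  proof
    fix y assume y: "y \<in> ?I \<times> ?I"
    obtain s t where st: "y = (s, t)" by (cases y)
    have s: "0 \<le> s" "s \<le> 1" and t: "t \<in> ?I" using y st by auto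
    show "continuous (at y within ?I \<times> ?I) H"
    proof (cases "s < 1")
      case True
      define s' where "s' = (s + 1) / 2"
      have s': "s < s'" "s' < 1" using True by (auto simp: s'_def)
      have "at y within ?I \<times> ?I = at y within {0..s'} \<times> ?I"
        by (rule at_within_nhd[of _ "{..<s'} \<times> UNIV"])
          (use s' st in \<open>auto intro: open_Times\<close>)
      moreover have "continuous (at y within {0..s'} \<times> ?I) H"
        using low[of s'] s s' t st by (auto simp: continuous_on_eq_continuous_within)
      ultimately show ?thesis by simp
    next
      case False
      then have s1: "s = 1" using s by simp
      show ?thesis
        unfolding continuous_within_eps_delta
      proof (intro allI impI)
        fix e :: real assume e: "0 < e"
        obtain K where K: "\<And>k. k \<ge> K \<Longrightarrow> \<epsilon> k < e / 2"
          using order_tendstoD(2)[OF \<epsilon>, of "e / 2"] e by (auto simp: eventually_sequentially)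
        have "continuous_on ?I \<gamma>" using \<gamma> by (simp add: path_def)
        then obtain d where d: "d > 0" "\<And>t'. t' \<in> ?I \<Longrightarrow> dist t' t < d \<Longrightarrow> dist (\<gamma> t') (\<gamma> t) < e / 2"
          using t e unfolding continuous_on_iff by (meson half_gt_zero)
        let ?d = "min d (1 / (real K + 1))"
        have "dist (H y') (H y) < e" if y': "y' \<in> ?I \<times> ?I" "dist y' y < ?d" for y'
        proof -
          obtain s' t' where st': "y' = (s', t')" by (cases y')
          have "dist t' t \<le> dist y' y" "dist s' s \<le> dist y' y"
            using dist_snd_le[of y' y] dist_fst_le[of y' y] by (auto simp: st st')
          then have near: "dist t' t < d" "1 - s' < 1 / (real K + 1)"
            using y' s1 by (auto simp: dist_real_def)
          have t': "t' \<in> ?I" and s': "s' \<in> ?I" using y' st' by auto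
          have \<gamma>t: "dist (\<gamma> t') (\<gamma> t) < e / 2" using d near t' by auto
          show ?thesis
          proof (cases "s' = 1")
            case True
            then show ?thesis using \<gamma>t e by (simp add: H_def st st' s1)
          next
            case False
            then have "1 - s' > 0" using s' by auto
            then have "real K \<le> s' / (1 - s')"
              using near(2) by (simp add: field_simps)
            then have "K \<le> nat \<lfloor>s' / (1 - s')\<rfloor>" by linarith
            then have "\<epsilon> (nat \<lfloor>s' / (1 - s')\<rfloor>) < e / 2" by (rule K)
            then have "dist (H y') (\<gamma> t') < e / 2"
              using he[OF fr t', of "nat \<lfloor>s' / (1 - s')\<rfloor>" "s' / (1 - s')"] False
              by (auto simp: H_def G_def st')
            moreover have "H y = \<gamma> t" by (simp add: H_def st s1)
            ultimately show ?thesis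
              using \<gamma>t dist_triangle[of "H y'" "\<gamma> t" "\<gamma> t'"] by simp
          qed
        qed
        then show "\<exists>d>0. \<forall>x'\<in>?I \<times> ?I. dist x' y < d \<longrightarrow> dist (H x') (H y) < e"
          using d(1) by (intro exI[of _ ?d]) auto
      qed
    qed
  qed
  have "H (0, t) = f 0 t" if "t \<in> ?I" for t using h01 that by (simp add: H_def G_def)
  moreover have "H (1, t) = \<gamma> t" for t by (simp add: H_def)
  moreover have "H (s, 0) = \<gamma> 0 \<and> H (s, 1) = \<gamma> 1" for s
    using hends fr by (simp add: H_def G_def)
  ultimately show ?thesis
    unfolding homotopic_paths using Hc HM ends
    by (intro exI[of _ H]) (auto simp: pathstart_def pathfinish_def)
qed

text \<open>The polygon of order \<open>k\<close> replaces \<open>\<gamma>\<close> on each dyadic interval of length \<open>1/2^k\<close> by the chosen path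
  between the endpoints. Passing to order \<open>k + 1\<close> fills one triangle per interval, of size at most
  the oscillation of \<open>\<gamma>\<close> at that scale, which tends to zero. The polygon of order \<open>0\<close> is constant:
  the hypothesis with \<open>x = y = z\<close> and \<open>r = 0\<close> confines \<open>\<sigma> x x\<close> to the point \<open>x\<close>.\<close>

theorem nullhomotopic_if_triangles_fill:
  fixes M :: "'a::real_normed_vector set" and \<sigma> :: "'a \<Rightarrow> 'a \<Rightarrow> real \<Rightarrow> 'a"
  assumes ends: "\<And>x y. x \<in> M \<Longrightarrow> y \<in> M \<Longrightarrow> pathstart (\<sigma> x y) = x \<and> pathfinish (\<sigma> x y) = y"
    and fill: "\<And>x y z r. \<lbrakk>x \<in> M; y \<in> M; z \<in> M; dist x y \<le> r; dist y z \<le> r; dist x z \<le> r\<rbrakk> \<Longrightarrow>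
       homotopic_paths (M \<inter> cball x (C * r)) (\<sigma> x z) (\<sigma> x y +++ \<sigma> y z)"
    and \<gamma>: "path \<gamma>" "path_image \<gamma> \<subseteq> M" "pathfinish \<gamma> = pathstart \<gamma>"
  shows "homotopic_paths M (\<lambda>_. pathstart \<gamma>) \<gamma>"
proof -
  define poly where "poly = rec_nat (\<lambda>\<gamma>. \<sigma> (\<gamma> (0::real)) (\<gamma> (1::real)))
     (\<lambda>_ P \<gamma>. P (subpath 0 (1/2) \<gamma>) +++ P (subpath (1/2) 1 \<gamma>))"
  have p0: "poly 0 \<gamma> = \<sigma> (\<gamma> 0) (\<gamma> 1)"
    and pS: "poly (Suc k) \<gamma> = poly k (subpath 0 (1/2) \<gamma>) +++ poly k (subpath (1/2) 1 \<gamma>)" for k \<gamma>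
    by (simp_all add: poly_def)
  have half: "path (subpath 0 (1/2) \<gamma>)" "path_image (subpath 0 (1/2) \<gamma>) \<subseteq> M"
     "path (subpath (1/2) 1 \<gamma>)" "path_image (subpath (1/2) 1 \<gamma>) \<subseteq> M"
    if "path \<gamma>" "path_image \<gamma> \<subseteq> M" for \<gamma> :: "real \<Rightarrow> 'a"
    using that path_image_subpath_subset[of 0 "1/2" \<gamma>] path_image_subpath_subset[of "1/2" 1 \<gamma>]
    by (auto intro!: path_subpath)
  have pe: "poly k \<gamma> 0 = \<gamma> 0 \<and> poly k \<gamma> 1 = \<gamma> 1"
    if "path \<gamma>" "path_image \<gamma> \<subseteq> M" for k \<gamma>
    using that
  proof (induction k arbitrary: \<gamma>)
    case 0
    then have "\<gamma> 0 \<in> M" "\<gamma> 1 \<in> M" by (auto simp: path_image_def)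
    then show ?case using ends by (simp add: p0 pathstart_def pathfinish_def)
  next
    case (Suc k)
    show ?case
      using Suc.IH[OF half(1,2)[OF Suc.prems]] Suc.IH[OF half(3,4)[OF Suc.prems]]
      by (simp add: pS joinpaths_def subpath_def)
  qed
  have track: "\<exists>h. tracked_homotopy M \<gamma> ((C + 1) * r) (poly k \<gamma>) (poly (Suc k) \<gamma>) h"
    if "path \<gamma>" "path_image \<gamma> \<subseteq> M"
      "\<And>s t. s \<in> {0..1} \<Longrightarrow> t \<in> {0..1} \<Longrightarrow> \<bar>s - t\<bar> \<le> 1 / 2 ^ k \<Longrightarrow> dist (\<gamma> s) (\<gamma> t) \<le> r" for k \<gamma> r
    using that
  proof (induction k arbitrary: \<gamma>)
    case 0
    have m: "\<gamma> t \<in> M" if "t \<in> {0..1}" for t using 0 that by (auto simp: path_image_def)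
    have d: "dist (\<gamma> s) (\<gamma> t) \<le> r" if "s \<in> {0..1}" "t \<in> {0..1}" for s t
      by (rule 0(3)) (use that in auto)
    have "homotopic_paths (M \<inter> cball (\<gamma> 0) (C * r)) (poly 0 \<gamma>) (poly (Suc 0) \<gamma>)"
      unfolding p0 pS by (simp add: subpath_def, rule fill) (auto intro!: m d)
    then obtain h :: "real \<times> real \<Rightarrow> 'a" where h: "continuous_on ({0..1} \<times> {0..1}) h"
       "h \<in> {0..1} \<times> {0..1} \<rightarrow> M \<inter> cball (\<gamma> 0) (C * r)"
       "\<forall>x\<in>{0..1}. h (0, x) = poly 0 \<gamma> x" "\<forall>x\<in>{0..1}. h (1, x) = poly (Suc 0) \<gamma> x"
       "\<forall>t\<in>{0..1}. pathstart (h \<circ> Pair t) = pathstart (poly 0 \<gamma>) \<and> pathfinish (h \<circ> Pair t) = pathfinish (poly 0 \<gamma>)"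
      unfolding homotopic_paths by blast
    have "dist (h (s, t)) (\<gamma> t) \<le> (C + 1) * r" if "s \<in> {0..1}" "t \<in> {0..1}" for s t
    proof -
      have "h (s, t) \<in> cball (\<gamma> 0) (C * r)" using h(2) that by auto
      then have "dist (\<gamma> 0) (h (s, t)) \<le> C * r" by simp
      moreover have "dist (\<gamma> 0) (\<gamma> t) \<le> r" using d that by auto
      ultimately show ?thesis
        using dist_triangle3[of "h (s, t)" "\<gamma> t" "\<gamma> 0"] by (simp add: algebra_simps)
    qed
    then show ?case
      using h unfolding tracked_homotopy_def
      by (intro exI[of _ h]) (auto simp: pathstart_def pathfinish_def)
  next
    case (Suc k)
    have *: "dist (subpath u (u + 1/2) \<gamma> s) (subpath u (u + 1/2) \<gamma> t) \<le> r"
      if "s \<in> {0..1}" "t \<in> {0..1}" "\<bar>s - t\<bar> \<le> 1 / 2 ^ k" "u \<in> {0, 1/2}" for s t u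
    proof -
      have "\<bar>(s/2 + u) - (t/2 + u)\<bar> = \<bar>s - t\<bar> / 2"
        by (simp add: diff_divide_distrib[symmetric] abs_divide del: divide_diff_eq_iff)
      also have "\<dots> \<le> 1 / 2 ^ Suc k" using that(3) by (simp add: field_simps)
      finally have "\<bar>(s/2 + u) - (t/2 + u)\<bar> \<le> 1 / 2 ^ Suc k" .
      then have "dist (\<gamma> (s/2 + u)) (\<gamma> (t/2 + u)) \<le> r" by (intro Suc(4)) (use that in auto)
      then show ?thesis by (simp add: subpath_def)
    qed
    obtain h1 where h1: "tracked_homotopy M (subpath 0 (1/2) \<gamma>) ((C + 1) * r)
        (poly k (subpath 0 (1/2) \<gamma>)) (poly (Suc k) (subpath 0 (1/2) \<gamma>)) h1"
      using Suc.IH[OF half(1,2)[OF Suc.prems(1,2)]] *[of _ _ 0] by auto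
    obtain h2 where h2: "tracked_homotopy M (subpath (1/2) 1 \<gamma>) ((C + 1) * r)
        (poly k (subpath (1/2) 1 \<gamma>)) (poly (Suc k) (subpath (1/2) 1 \<gamma>)) h2"
      using Suc.IH[OF half(3,4)[OF Suc.prems(1,2)]] *[of _ _ "1/2"] by auto
    have "poly k (subpath 0 (1/2) \<gamma>) 1 = poly k (subpath (1/2) 1 \<gamma>) 0"
      using pe[OF half(1,2)[OF Suc.prems(1,2)]] pe[OF half(3,4)[OF Suc.prems(1,2)]]
      by (simp add: subpath_def)
    from tracked_homotopy_join[OF h1 h2 this] show ?case
      unfolding pS[of "Suc k" \<gamma>] pS[of k \<gamma>] by blast
  qed
  define osc where "osc k = (SUP (s, t)\<in>{(s, t). s \<in> {0..1} \<and> t \<in> {0..1} \<and> \<bar>s - t\<bar> \<le> 1 / 2 ^ k}. dist (\<gamma> s) (\<gamma> t))" for k :: nat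
  have cont: "continuous_on {0..1} \<gamma>" using \<gamma> by (simp add: path_def)
  have bdd: "bounded (\<gamma> ` {0..1})"
    using compact_continuous_image[OF cont] by (simp add: compact_imp_bounded)
  have osc_le: "dist (\<gamma> s) (\<gamma> t) \<le> osc k"
    if "s \<in> {0..1}" "t \<in> {0..1}" "\<bar>s - t\<bar> \<le> 1 / 2 ^ k" for s t k
  proof -
    obtain B where "\<And>x y. x \<in> \<gamma> ` {0..1} \<Longrightarrow> y \<in> \<gamma> ` {0..1} \<Longrightarrow> dist x y \<le> B"
      using bdd unfolding bounded_two_points by blast
    then show ?thesis
      unfolding osc_def by (intro cSUP_upper2[of _ _ "(s, t)"] bdd_aboveI2[of _ _ B]) (use that in auto)
  qed
  have "osc \<longlonglongrightarrow> 0"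
  proof (rule LIMSEQ_I)
    fix e :: real assume e: "e > 0"
    have "uniformly_continuous_on {0..1} \<gamma>"
      using cont by (rule compact_uniformly_continuous) auto
    then obtain d where d: "d > 0"
        "\<And>s t. s \<in> {0..1} \<Longrightarrow> t \<in> {0..1} \<Longrightarrow> dist t s < d \<Longrightarrow> dist (\<gamma> t) (\<gamma> s) < e / 2"
      using uniformly_continuous_onE[of "{0..1}" \<gamma> "e / 2"] e by (metis half_gt_zero)
    obtain K where K: "(1/2) ^ K < d" using real_arch_pow_inv[OF d(1), of "1/2"] by auto
    have "norm (osc k - 0) < e" if "k \<ge> K" for k
    proof -
      have "(1/2::real) ^ k \<le> (1/2) ^ K" using that by (intro power_decreasing) auto
      then have small: "1 / 2 ^ k < d" using K by (simp add: power_one_over)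
      have "osc k \<le> e / 2"
        unfolding osc_def
      proof (rule cSUP_least)
        show "{(s::real, t). s \<in> {0..1} \<and> t \<in> {0..1} \<and> \<bar>s - t\<bar> \<le> 1 / 2 ^ k} \<noteq> {}"
          by (rule ex_in_conv[THEN iffD1, OF exI[of _ "(0, 0)"]]) simp
      next
        fix y :: "real \<times> real" assume "y \<in> {(s, t). s \<in> {0..1} \<and> t \<in> {0..1} \<and> \<bar>s - t\<bar> \<le> 1 / 2 ^ k}"
        then obtain s t where y: "y = (s, t)" "s \<in> {0..1}" "t \<in> {0..1}" "\<bar>s - t\<bar> \<le> 1 / 2 ^ k" by blast
        then have "dist (\<gamma> s) (\<gamma> t) < e / 2"
          using small by (intro d(2)) (auto simp: dist_real_def)
        then show "(case y of (s, t) \<Rightarrow> dist (\<gamma> s) (\<gamma> t)) \<le> e / 2"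
          by (simp add: y(1))
      qed
      moreover have "0 \<le> osc k" using osc_le[of 0 0 k] by simp
      ultimately show ?thesis using e by simp
    qed
    then show "\<exists>K. \<forall>k\<ge>K. norm (osc k - 0) < e" by (intro exI[of _ K]) blast
  qed
  then have lim: "(\<lambda>k. (C + 1) * osc k) \<longlonglongrightarrow> 0" by (rule tendsto_mult_right_zero)
  have "\<exists>h. tracked_homotopy M \<gamma> ((C + 1) * osc k) (poly k \<gamma>) (poly (Suc k) \<gamma>) h" for k
    by (rule track[OF \<gamma>(1,2) osc_le])
  then obtain h where h: "\<And>k. tracked_homotopy M \<gamma> ((C + 1) * osc k) (poly k \<gamma>) (poly (Suc k) \<gamma>) (h k)"
    by metis
  have "homotopic_paths M (poly 0 \<gamma>) \<gamma>"
    by (rule concat_homotopies_converging[where f = "\<lambda>k. poly k \<gamma>", OF h lim \<gamma>(1,2)])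
      (use pe[OF \<gamma>(1,2)] in blast)+
  moreover have "homotopic_paths M (\<lambda>_. pathstart \<gamma>) (poly 0 \<gamma>)"
  proof -
    let ?a = "pathstart \<gamma>"
    have a: "?a \<in> M" using \<gamma> by auto
    have p: "poly 0 \<gamma> = \<sigma> ?a ?a" using \<gamma>(3) by (simp add: p0 pathstart_def pathfinish_def)
    have f: "homotopic_paths (M \<inter> cball ?a (C * 0)) (\<sigma> ?a ?a) (\<sigma> ?a ?a +++ \<sigma> ?a ?a)"
      by (rule fill) (use a in simp_all)
    have "path (\<sigma> ?a ?a)" "path_image (\<sigma> ?a ?a) \<subseteq> {?a}"
      using homotopic_paths_imp_path[OF f] homotopic_paths_imp_subset[OF f] by auto
    then show ?thesis
      unfolding p using a
      by (intro homotopic_paths_sym[OF homotopic_paths_eq]) (auto simp: path_image_def image_subset_iff)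
  qed
  ultimately show ?thesis using homotopic_paths_trans by blast
qed

section \<open>Unitriangular matrices over a ring with sizes\<close>

text \<open>The unitriangular matrix of degree four given by its six entries above the diagonal. The entries
  will be sequences of field elements, so the ring is arbitrary.\<close>

datatype 'r uni = Uni (e12: 'r) (e13: 'r) (e14: 'r) (e23: 'r) (e24: 'r) (e34: 'r)

instantiation uni :: (comm_ring_1) monoid_mult
begin

definition one_uni :: "'a uni" where "1 = Uni 0 0 0 0 0 0"

definition times_uni :: "'a uni \<Rightarrow> 'a uni \<Rightarrow> 'a uni" where
  "u * v = Uni (e12 u + e12 v) (e13 u + e13 v + e12 u * e23 v)
     (e14 u + e14 v + e12 u * e24 v + e13 u * e34 v)
     (e23 u + e23 v) (e24 u + e24 v + e23 u * e34 v) (e34 u + e34 v)"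

instance
  by standard (auto simp: one_uni_def times_uni_def algebra_simps)

end

definition uinv :: "'r::comm_ring_1 uni \<Rightarrow> 'r uni" where
  "uinv u = Uni (- e12 u) (e12 u * e23 u - e13 u)
     (e12 u * e24 u + e13 u * e34 u - e14 u - e12 u * e23 u * e34 u)
     (- e23 u) (e23 u * e34 u - e24 u) (- e34 u)"

lemma uinv_left [simp]: "uinv u * u = 1" and uinv_right [simp]: "u * uinv u = 1"
  by (auto simp: uinv_def times_uni_def one_uni_def algebra_simps)

lemma uinv_left_assoc [simp]: "uinv u * (u * v) = v" and uinv_right_assoc [simp]: "u * (uinv u * v) = v"
  by (simp_all add: mult.assoc[symmetric])

text \<open>An abstract logarithmic size: \<open>sz x a\<close> means that the size of \<open>x\<close> is at most \<open>a\<close>. The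
  ultrametric form of \<open>sz_add\<close> holds even over archimedean fields, since rescaling removes additive
  constants.\<close>

locale sized_ring =
  fixes sz :: "'r::comm_ring_1 \<Rightarrow> real \<Rightarrow> bool"
  assumes sz_mono: "sz x a \<Longrightarrow> a \<le> b \<Longrightarrow> sz x b"
    and sz_0: "sz 0 a"
    and sz_add: "sz x a \<Longrightarrow> sz y a \<Longrightarrow> sz (x + y) a"
    and sz_minus: "sz x a \<Longrightarrow> sz (- x) a"
    and sz_mult: "sz x a \<Longrightarrow> sz y b \<Longrightarrow> sz (x * y) (a + b)"
    and sz_unit: "\<exists>x y. sz x a \<and> sz y (- a) \<and> x * y = 1"
begin

lemma sz_mult': "sz x a \<Longrightarrow> sz y b \<Longrightarrow> a + b \<le> c \<Longrightarrow> sz (x * y) c"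
  using sz_mono sz_mult by blast

text \<open>\<open>box p 0\<close> is the stabiliser of the point \<open>p\<close>, and \<open>box p r\<close> bounds how far \<open>p\<close> is moved. The
  multiples of \<open>r\<close> are proportional to the distance \<open>j - i\<close> from the diagonal, so \<open>box p r\<close> is the
  conjugate of a stabiliser by a diagonal matrix, and hence a group for every \<open>r\<close>.\<close>

definition box :: "real \<times> real \<Rightarrow> real \<Rightarrow> 'r uni set" where
  "box p r = {w. sz (e12 w) (r - fst p) \<and> sz (e23 w) (r + fst p - snd p) \<and> sz (e34 w) (r + snd p) \<and>
     sz (e13 w) (2 * r - snd p) \<and> sz (e24 w) (2 * r + fst p) \<and> sz (e14 w) (3 * r)}"

abbreviation stab :: "real \<times> real \<Rightarrow> 'r uni set" where "stab p \<equiv> box p 0"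

lemma box_mult: "u \<in> box p r \<Longrightarrow> v \<in> box p r \<Longrightarrow> u * v \<in> box p r"
  unfolding box_def mem_Collect_eq times_uni_def uni.sel
  by (elim conjE, intro conjI sz_add) (assumption | erule (1) sz_mult', simp)+

lemma box_one [simp]: "1 \<in> box p r"
  by (simp add: box_def one_uni_def sz_0)

lemma box_uinv: "u \<in> box p r \<Longrightarrow> uinv u \<in> box p r"
proof -
  assume u: "u \<in> box p r"
  have "uinv u = Uni (- e12 u) (e12 u * e23 u + - e13 u)
     (e12 u * e24 u + e13 u * e34 u + - e14 u + - (e12 u * e23 u * e34 u))
     (- e23 u) (e23 u * e34 u + - e24 u) (- e34 u)"
    by (simp add: uinv_def)
  moreover have "sz (e12 u * e23 u * e34 u) (3 * r)"
    using u by (intro sz_mult'[of _ "2 * r - snd p" _ "r + snd p"] sz_mult'[of _ "r - fst p" _ "r + fst p - snd p"])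
      (auto simp: box_def)
  ultimately show ?thesis
    using u unfolding box_def mem_Collect_eq
    by (simp only: uni.sel, elim conjE, intro conjI sz_add sz_minus)
      (assumption | erule (1) sz_mult', simp)+
qed

lemma box_mono: "u \<in> box p r \<Longrightarrow> r + 2 * dist p q \<le> r' \<Longrightarrow> u \<in> box q r'"
proof -
  assume u: "u \<in> box p r" and d: "r + 2 * dist p q \<le> r'"
  have "\<bar>fst p - fst q\<bar> \<le> dist p q" "\<bar>snd p - snd q\<bar> \<le> dist p q"
    using dist_fst_le[of p q] dist_snd_le[of p q] by (auto simp: dist_real_def)
  then show ?thesis
    using u d unfolding box_def by (auto elim!: sz_mono)
qed

definition finite_size :: "'r uni set" where "finite_size = (\<Union>r\<in>{0..}. box (0, 0) r)"

lemma box_finite_size: assumes "w \<in> box p r" shows "w \<in> finite_size"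
proof -
  define r' where "r' = max 0 (r + 2 * dist p (0, 0))"
  have "w \<in> box (0, 0) r'" by (rule box_mono[OF assms]) (simp add: r'_def)
  then show ?thesis unfolding finite_size_def by (intro UN_I[of r']) (simp_all add: r'_def)
qed

lemma finite_size_mult: assumes "u \<in> finite_size" "v \<in> finite_size" shows "u * v \<in> finite_size"
proof -
  obtain r s where rs: "0 \<le> r" "u \<in> box (0, 0) r" "0 \<le> s" "v \<in> box (0, 0) s"
    using assms by (auto simp: finite_size_def)
  then have "u \<in> box (0, 0) (max r s)" "v \<in> box (0, 0) (max r s)"
    by (auto intro: box_mono[of _ "(0, 0)"])
  then show ?thesis by (intro box_finite_size[OF box_mult])
qed

text \<open>Each condition that defines \<open>stab p\<close> bounds a size by a linear function of \<open>p\<close>.\<close>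

lemma stab_convex:
  assumes "u \<in> stab p" "u \<in> stab q" "s \<in> closed_segment p q"
  shows "u \<in> stab s"
proof -
  obtain t where t: "s = (1 - t) *\<^sub>R p + t *\<^sub>R q" "0 \<le> t" "t \<le> 1"
    using assms(3) by (auto simp: closed_segment_def)
  have *: "sz x ((1 - t) * a + t * b)" if "sz x a" "sz x b" for x a b
  proof (cases "a \<le> b")
    case True
    then have "t * a \<le> t * b" using t by (intro mult_left_mono)
    then show ?thesis by (intro sz_mono[OF that(1)]) (simp add: algebra_simps)
  next
    case False
    then have "(1 - t) * b \<le> (1 - t) * a" using t by (intro mult_left_mono) auto
    then show ?thesis by (intro sz_mono[OF that(2)]) (simp add: algebra_simps)
  qed
  show ?thesis
    using assms(1,2) *[of _ "- fst p" "- fst q"] *[of _ "fst p - snd p" "fst q - snd q"]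
      *[of _ "snd p" "snd q"] *[of _ "- snd p" "- snd q"] *[of _ "fst p" "fst q"]
    by (auto simp: box_def t(1) algebra_simps)
qed

end

text \<open>Abels' relation. With \<open>D = [A, B]\<close> and \<open>E = [B, C]\<close>, the two ways of moving \<open>A\<close> to the right in
  \<open>A B C\<close> give \<open>[A, E] = [D, C]\<close>. Commutators are expressed by the equations \<open>x y = Z y x\<close> throughout,
  which keeps the calculation free of inverses.\<close>

lemma (in group) commutator_transfer:
  assumes c: "A \<in> carrier G" "B \<in> carrier G" "C \<in> carrier G" "D \<in> carrier G" "E \<in> carrier G" "Z \<in> carrier G"
    and AB: "A \<otimes> B = D \<otimes> (B \<otimes> A)" and BC: "B \<otimes> C = E \<otimes> (C \<otimes> B)"
    and AC: "A \<otimes> C = C \<otimes> A" and DE: "D \<otimes> E = E \<otimes> D" and EC: "E \<otimes> C = C \<otimes> E"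
    and Z: "D \<otimes> C = Z \<otimes> (C \<otimes> D)"
  shows "A \<otimes> E = Z \<otimes> (E \<otimes> A)"
proof -
  have ext: "x \<otimes> (y \<otimes> g) = w \<otimes> g"
    if "x \<otimes> y = w" "x \<in> carrier G" "y \<in> carrier G" "g \<in> carrier G" for x y w g
    using that by (simp flip: m_assoc)
  note ext' = ext[OF AB] ext[OF BC] ext[OF AC] ext[OF DE] ext[OF EC] ext[OF Z]
  have "(A \<otimes> E) \<otimes> (C \<otimes> B) = A \<otimes> (B \<otimes> C)" using c by (simp add: m_assoc BC)
  also have "\<dots> = D \<otimes> (B \<otimes> (A \<otimes> C))" using c by (simp add: ext' m_assoc)
  also have "\<dots> = D \<otimes> (B \<otimes> (C \<otimes> A))" by (simp add: AC)
  also have "\<dots> = D \<otimes> (E \<otimes> (C \<otimes> (B \<otimes> A)))" using c by (simp add: ext'(2) m_assoc)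
  also have "\<dots> = D \<otimes> (C \<otimes> (E \<otimes> (B \<otimes> A)))" using c by (simp add: ext'(5) m_assoc)
  also have "\<dots> = Z \<otimes> (C \<otimes> (D \<otimes> (E \<otimes> (B \<otimes> A))))" using c by (simp add: ext'(6) m_assoc)
  also have "\<dots> = Z \<otimes> (C \<otimes> (E \<otimes> (D \<otimes> (B \<otimes> A))))" using c by (simp add: ext'(4) m_assoc)
  also have "\<dots> = Z \<otimes> (E \<otimes> (C \<otimes> (A \<otimes> B)))" using c by (simp add: ext'(5) m_assoc AB)
  also have "\<dots> = Z \<otimes> (E \<otimes> (A \<otimes> (C \<otimes> B)))" using c by (simp add: ext'(3) m_assoc)
  also have "\<dots> = (Z \<otimes> (E \<otimes> A)) \<otimes> (C \<otimes> B)" using c by (simp add: m_assoc)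
  finally show ?thesis using c by (simp add: right_cancel)
qed

lemma (in group) commute_commutator:
  assumes c: "g \<in> carrier G" "C \<in> carrier G" "D \<in> carrier G" "Z \<in> carrier G"
    and Z: "D \<otimes> C = Z \<otimes> (C \<otimes> D)"
    and g: "g \<otimes> C = C \<otimes> g" "g \<otimes> D = D \<otimes> g"
  shows "g \<otimes> Z = Z \<otimes> g"
proof -
  have "(g \<otimes> Z) \<otimes> (C \<otimes> D) = g \<otimes> (D \<otimes> C)" using c by (simp add: m_assoc Z)
  also have "\<dots> = (D \<otimes> g) \<otimes> C" using c by (simp flip: m_assoc add: g)
  also have "\<dots> = (D \<otimes> C) \<otimes> g" using c by (simp add: m_assoc g)
  also have "\<dots> = Z \<otimes> (C \<otimes> (D \<otimes> g))" using c by (simp add: Z m_assoc)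
  also have "\<dots> = Z \<otimes> ((C \<otimes> g) \<otimes> D)" using c by (simp add: g(2)[symmetric] m_assoc)
  also have "\<dots> = (Z \<otimes> g) \<otimes> (C \<otimes> D)" using c by (simp add: g(1)[symmetric] m_assoc)
  finally show ?thesis using c by (simp add: right_cancel)
qed

lemma (in group) commutator_unique:
  assumes "x \<in> carrier G" "y \<in> carrier G" "Z \<in> carrier G" "Z' \<in> carrier G"
    "x \<otimes> y = Z \<otimes> (y \<otimes> x)" "x \<otimes> y = Z' \<otimes> (y \<otimes> x)"
  shows "Z = Z'"
  using assms by (metis m_closed right_cancel)

lemma (in group) commutator_exists:
  assumes "x \<in> carrier G" "y \<in> carrier G"
  shows "\<exists>Z\<in>carrier G. x \<otimes> y = Z \<otimes> (y \<otimes> x)"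
  using assms by (intro bexI[of _ "(x \<otimes> y) \<otimes> inv (y \<otimes> x)"]) (simp_all add: m_assoc del: inv_mult_group)

section \<open>Amalgams of point stabilisers\<close>

text \<open>The base point \<open>p\<close> and the scale \<open>R\<close>: the words of interest have entries of size at most \<open>R\<close>
  (for \<open>12\<close>, \<open>23\<close>, \<open>34\<close>), \<open>2 R\<close> (for \<open>13\<close>, \<open>24\<close>) and \<open>3 R\<close> (for \<open>14\<close>) relative to \<open>p\<close>.
  Writing an entry \<open>14\<close> as a commutator puts all of its size into one other entry, so that the five
  other kinds of entries are allowed sizes up to \<open>3 R\<close>.\<close>

locale sized_ring_at = sized_ring sz
  for sz :: "'r::comm_ring_1 \<Rightarrow> real \<Rightarrow> bool" +
  fixes p :: "real \<times> real" and R :: real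
  assumes R: "0 \<le> R"
begin

abbreviation "small12 a \<equiv> sz a (3 * R - fst p)"
abbreviation "small13 a \<equiv> sz a (3 * R - snd p)"
abbreviation "small23 a \<equiv> sz a (3 * R + fst p - snd p)"
abbreviation "small24 a \<equiv> sz a (3 * R + fst p)"
abbreviation "small34 a \<equiv> sz a (3 * R + snd p)"

lemma near:
  assumes "\<bar>a\<bar> \<le> 2" "\<bar>b\<bar> \<le> 2"
  shows "dist p (fst p + a * (3 * R), snd p + b * (3 * R)) \<le> 9 * R"
proof -
  have "dist p (fst p + a * (3 * R), snd p + b * (3 * R)) = norm (a, b) * (3 * R)"
  proof -
    have "p - (fst p + a * (3 * R), snd p + b * (3 * R)) = (- (3 * R)) *\<^sub>R (a, b)"
      by (simp add: prod_eq_iff)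
    then show ?thesis unfolding dist_norm using R by (metis norm_scaleR abs_minus_cancel abs_of_nonneg mult.commute mult_nonneg_nonneg zero_le_numeral)
  qed
  moreover have "norm (a, b) \<le> 3"
  proof -
    have "a\<^sup>2 \<le> 4" "b\<^sup>2 \<le> 4" using assms power_mono[of "\<bar>a\<bar>" 2 2] power_mono[of "\<bar>b\<bar>" 2 2] by auto
    then show ?thesis by (auto simp: norm_Pair intro: real_le_lsqrt)
  qed
  ultimately show ?thesis using mult_right_mono[of "norm (a, b)" 3 "3 * R"] R by simp
qed

text \<open>The four contracted subgroups. The entries \<open>13\<close> and \<open>24\<close> have the larger bound \<open>6 R\<close> where they
  occur as commutators of two entries of size \<open>3 R\<close>.\<close>

definition "block1 = {Uni a d 0 b 0 0 | a d b. small12 a \<and> sz d (6 * R - snd p) \<and> small23 b}"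
definition "block2 = {Uni 0 0 0 b e c | b e c. small23 b \<and> sz e (6 * R + fst p) \<and> small34 c}"
definition "block3 = {Uni a 0 0 0 0 c | a c. small12 a \<and> small34 c}"
definition "block4 = {Uni 0 d 0 b e 0 | d b e. small13 d \<and> small23 b \<and> small24 e}"

text \<open>Each block is contracted in one direction of the plane; moving from \<open>p\<close> a distance proportional
  to \<open>R\<close> in that direction reaches a point fixed by the whole block. The factor \<open>9\<close> is \<open>3\<close> (the
  bound on the norms of the four directions) times \<open>3\<close> (the scale \<open>3 R\<close>).\<close>

lemma block_stab:
  assumes "B \<in> {block1, block2, block3, block4}"
  shows "\<exists>q. dist p q \<le> 9 * R \<and> B \<subseteq> stab q"
proof -
  have R3: "sz x (3 * R + a) \<Longrightarrow> sz x (6 * R + a)" for x a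
    using R by (auto elim: sz_mono)
  have "block1 \<subseteq> stab (fst p + (-1) * (3 * R), snd p + (-2) * (3 * R))"
    by (auto simp: block1_def box_def sz_0 algebra_simps)
  moreover have "block2 \<subseteq> stab (fst p + 2 * (3 * R), snd p + 1 * (3 * R))"
    by (auto simp: block2_def box_def sz_0 algebra_simps)
  moreover have "block3 \<subseteq> stab (fst p + (-1) * (3 * R), snd p + 1 * (3 * R))"
    by (auto simp: block3_def box_def sz_0 algebra_simps)
  moreover have "block4 \<subseteq> stab (fst p + 1 * (3 * R), snd p + (-1) * (3 * R))"
    using R3[of _ "fst p - snd p"] by (auto simp: block4_def box_def sz_0 algebra_simps)
  ultimately show ?thesis
    using assms near[of "-1" "-2"] near[of 2 1] near[of "-1" 1] near[of 1 "-1"] by auto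
qed

lemma in_block [simp]:
  "Uni a d 0 b 0 0 \<in> block1 \<longleftrightarrow> small12 a \<and> sz d (6 * R - snd p) \<and> small23 b"
  "Uni 0 0 0 b e c \<in> block2 \<longleftrightarrow> small23 b \<and> sz e (6 * R + fst p) \<and> small34 c"
  "Uni a 0 0 0 0 c \<in> block3 \<longleftrightarrow> small12 a \<and> small34 c"
  "Uni 0 d 0 b e 0 \<in> block4 \<longleftrightarrow> small13 d \<and> small23 b \<and> small24 e"
  by (auto simp: block1_def block2_def block3_def block4_def)

lemma small_large [intro]: "small13 d \<Longrightarrow> sz d (6 * R - snd p)" "small24 e \<Longrightarrow> sz e (6 * R + fst p)"
  using R by (auto elim: sz_mono)

text \<open>A unit whose size is exactly \<open>p_3\<close>, that of the entry \<open>34\<close> at scale \<open>0\<close>; multiplication by its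
  inverse \<open>s'\<close> turns an entry \<open>14\<close> into an entry \<open>13\<close>.\<close>

definition "s = (SOME s. sz s (snd p) \<and> (\<exists>s'. sz s' (- snd p) \<and> s * s' = 1))"
definition "s' = (SOME s'. sz s' (- snd p) \<and> s * s' = 1)"

lemma s: "sz s (snd p)" "sz s' (- snd p)" "s * s' = 1"
proof -
  have "\<exists>s. sz s (snd p) \<and> (\<exists>s'. sz s' (- snd p) \<and> s * s' = 1)"
    using sz_unit[of "snd p"] by blast
  from someI_ex[OF this] have *: "sz s (snd p)" "\<exists>s'. sz s' (- snd p) \<and> s * s' = 1"
    unfolding s_def[symmetric] by auto
  from someI_ex[OF *(2)] * show "sz s (snd p)" "sz s' (- snd p)" "s * s' = 1"
    unfolding s'_def[symmetric] by auto
qed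

lemma ss' [simp]: "x * s' * s = x" "x * s * s' = x"
  using s(3) by (simp_all add: mult.assoc mult.commute[of s' s])

lemma small_s [simp]: "small34 s" "sz t (3 * R) \<Longrightarrow> small13 (t * s')"
  using s sz_mono[OF s(1)] R sz_mult'[OF _ s(2)] by auto

lemma uni_factorization:
  "v = Uni 0 0 0 0 0 (e34 v) * (Uni 0 0 0 0 (e24 v) 0 * (Uni 0 0 0 (e23 v) 0 0 *
     (Uni 0 (e13 v) 0 0 0 0 * (Uni (e12 v) 0 0 0 0 0 * Uni 0 0 (e14 v) 0 0 0))))"
  by (cases v) (simp add: times_uni_def)

lemma box_small:
  assumes "u \<in> box p R"
  shows "small12 (e12 u)" "small13 (e13 u)" "small23 (e23 u)" "small24 (e24 u)" "small34 (e34 u)"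
    "sz (e14 u) (3 * R)" "sz (e12 u) (R - fst p)" "sz (e23 u) (R + fst p - snd p)" "sz (e34 u) (R + snd p)"
    "sz (e13 u) (2 * R - snd p)" "sz (e24 u) (2 * R + fst p)"
  using assms R by (auto simp: box_def elim: sz_mono)

text \<open>The entry \<open>14\<close>, which no point stabiliser contains unless its size is at most zero, is spelled as
  the commutator of an entry \<open>13\<close> and the entry \<open>s\<close> at \<open>34\<close>.\<close>

lemma box_word:
  assumes u: "u \<in> box p R"
  shows "\<exists>W. prod_list W = u \<and> (\<forall>w\<in>set W. \<exists>q. w \<in> stab q \<and> dist p q \<le> 9 * R)"
proof -
  \<comment> \<open>The word spells the factorisation of \<open>u\<close>, with the last factor replaced by a commutator.\<close>
  define x where "x = e14 u * s'"
  have xs: "x * s = e14 u" by (simp add: x_def)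
  have x: "small13 x" "small13 (- x)" "small34 s" "small34 (- s)"
    using box_small(6)[OF u] by (auto simp: x_def intro: sz_minus)
  let ?W = "[Uni 0 0 0 0 0 (e34 u), Uni 0 0 0 0 (e24 u) 0, Uni 0 0 0 (e23 u) 0 0, Uni 0 (e13 u) 0 0 0 0,
    Uni (e12 u) 0 0 0 0 0, Uni 0 x 0 0 0 0, Uni 0 0 0 0 0 s, Uni 0 (- x) 0 0 0 0, Uni 0 0 0 0 0 (- s)]"
  have "set ?W \<subseteq> block1 \<union> block2 \<union> block4"
    using box_small[OF u] x by (auto simp: sz_0)
  then have "\<exists>q. w \<in> stab q \<and> dist p q \<le> 9 * R" if "w \<in> set ?W" for w
    using that block_stab[of block1] block_stab[of block2] block_stab[of block4] by blast
  moreover have "Uni 0 x 0 0 0 0 * (Uni 0 0 0 0 0 s * (Uni 0 (- x) 0 0 0 0 * Uni 0 0 0 0 0 (- s))) = Uni 0 0 (e14 u) 0 0 0"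
    by (simp add: times_uni_def xs)
  then have "prod_list ?W = u"
    using uni_factorization[of u] by simp
  ultimately show ?thesis by (intro exI[of _ ?W]) simp
qed

end

text \<open>A map that is multiplicative on the stabiliser of every point near \<open>p\<close>. Such maps are the
  homomorphisms from the amalgam of these stabilisers to \<open>H\<close>, so an equation proved here
  for all \<open>H\<close> is an equation in the amalgam.\<close>

locale stab_rep = sized_ring_at sz p R + group H
  for sz :: "'r::comm_ring_1 \<Rightarrow> real \<Rightarrow> bool" and p R and H :: "('h, 'm) monoid_scheme" (structure) +
  fixes j :: "'r uni \<Rightarrow> 'h"
  assumes j_closed: "\<And>q w. dist p q \<le> 9 * R \<Longrightarrow> w \<in> stab q \<Longrightarrow> j w \<in> carrier H"
    and j_mult: "\<And>q w w'. dist p q \<le> 9 * R \<Longrightarrow> w \<in> stab q \<Longrightarrow> w' \<in> stab q \<Longrightarrow> j w \<otimes> j w' = j (w * w')"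
begin

abbreviation "x12 a \<equiv> j (Uni a 0 0 0 0 0)"
abbreviation "x13 a \<equiv> j (Uni 0 a 0 0 0 0)"
abbreviation "x23 a \<equiv> j (Uni 0 0 0 a 0 0)"
abbreviation "x24 a \<equiv> j (Uni 0 0 0 0 a 0)"
abbreviation "x34 a \<equiv> j (Uni 0 0 0 0 0 a)"

lemma block_closed: "B \<in> {block1, block2, block3, block4} \<Longrightarrow> w \<in> B \<Longrightarrow> j w \<in> carrier H"
  using block_stab[of B] j_closed by blast

lemma block_hom:
  assumes "B \<in> {block1, block2, block3, block4}" "w \<in> B" "w' \<in> B"
  shows "j w \<otimes> j w' = j (w * w')"
proof -
  obtain q where "dist p q \<le> 9 * R" "B \<subseteq> stab q" using block_stab[OF assms(1)] by blast
  then show ?thesis using assms(2,3) by (auto intro!: j_mult[of q])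
qed

lemma block_mult:
  "w \<in> block1 \<Longrightarrow> w' \<in> block1 \<Longrightarrow> j w \<otimes> j w' = j (w * w')"
  "w \<in> block2 \<Longrightarrow> w' \<in> block2 \<Longrightarrow> j w \<otimes> j w' = j (w * w')"
  "w \<in> block3 \<Longrightarrow> w' \<in> block3 \<Longrightarrow> j w \<otimes> j w' = j (w * w')"
  "w \<in> block4 \<Longrightarrow> w' \<in> block4 \<Longrightarrow> j w \<otimes> j w' = j (w * w')"
  by (erule (1) block_hom[rotated], simp)+

lemma x_closed [simp]:
  "small12 a \<Longrightarrow> x12 a \<in> carrier H" "small13 a \<Longrightarrow> x13 a \<in> carrier H"
  "small23 a \<Longrightarrow> x23 a \<in> carrier H" "small24 a \<Longrightarrow> x24 a \<in> carrier H"
  "small34 a \<Longrightarrow> x34 a \<in> carrier H"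
  using block_closed[of block1 "Uni a 0 0 0 0 0"] block_closed[of block4 "Uni 0 a 0 0 0 0"]
    block_closed[of block1 "Uni 0 0 0 a 0 0"] block_closed[of block4 "Uni 0 0 0 0 a 0"]
    block_closed[of block2 "Uni 0 0 0 0 0 a"]
  by (simp_all add: sz_0)

lemma x_add:
  "small12 a \<Longrightarrow> small12 b \<Longrightarrow> x12 a \<otimes> x12 b = x12 (a + b)"
  "small13 a \<Longrightarrow> small13 b \<Longrightarrow> x13 a \<otimes> x13 b = x13 (a + b)"
  "small23 a \<Longrightarrow> small23 b \<Longrightarrow> x23 a \<otimes> x23 b = x23 (a + b)"
  "small24 a \<Longrightarrow> small24 b \<Longrightarrow> x24 a \<otimes> x24 b = x24 (a + b)"
  "small34 a \<Longrightarrow> small34 b \<Longrightarrow> x34 a \<otimes> x34 b = x34 (a + b)"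
  by (simp_all add: block_mult(1) block_mult(2) block_mult(4) sz_0 times_uni_def)

lemma x_commute:
  "small12 a \<Longrightarrow> small13 b \<Longrightarrow> x12 a \<otimes> x13 b = x13 b \<otimes> x12 a"
  "small13 a \<Longrightarrow> small23 b \<Longrightarrow> x13 a \<otimes> x23 b = x23 b \<otimes> x13 a"
  "small23 a \<Longrightarrow> small24 b \<Longrightarrow> x23 a \<otimes> x24 b = x24 b \<otimes> x23 a"
  "small24 a \<Longrightarrow> small34 b \<Longrightarrow> x24 a \<otimes> x34 b = x34 b \<otimes> x24 a"
  "small12 a \<Longrightarrow> small34 b \<Longrightarrow> x12 a \<otimes> x34 b = x34 b \<otimes> x12 a"
  "small13 a \<Longrightarrow> small24 b \<Longrightarrow> x13 a \<otimes> x24 b = x24 b \<otimes> x13 a"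
  by (simp_all add: block_mult sz_0 small_large times_uni_def)

lemma x_commutator:
  "small12 a \<Longrightarrow> small23 b \<Longrightarrow> small13 (a * b) \<Longrightarrow> x12 a \<otimes> x23 b = x13 (a * b) \<otimes> (x23 b \<otimes> x12 a)"
  "small23 b \<Longrightarrow> small34 c \<Longrightarrow> small24 (b * c) \<Longrightarrow> x23 b \<otimes> x34 c = x24 (b * c) \<otimes> (x34 c \<otimes> x23 b)"
  by (simp_all add: block_mult(1) block_mult(2) sz_0 small_large times_uni_def)

lemma commutator_transfer_x:
  assumes "small12 a" "small23 b" "small34 c" "small13 (a * b)" "small24 (b * c)" "z \<in> carrier H"
    and "x13 (a * b) \<otimes> x34 c = z \<otimes> (x34 c \<otimes> x13 (a * b))"
  shows "x12 a \<otimes> x24 (b * c) = z \<otimes> (x24 (b * c) \<otimes> x12 a)"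
  by (rule commutator_transfer[of _ "x23 b" "x34 c" "x13 (a * b)"])
    (use assms in \<open>simp_all add: x_commute x_commutator\<close>)

text \<open>The image of the central entry \<open>14\<close>, defined as a commutator because for large \<open>t\<close> the matrix with
  this single entry is not in the domain on which \<open>j\<close> is controlled.\<close>

definition "z t = (x13 (t * s') \<otimes> x34 s) \<otimes> inv (x34 s \<otimes> x13 (t * s'))"

lemma z_closed [simp]: "sz t (3 * R) \<Longrightarrow> z t \<in> carrier H"
  by (simp add: z_def)

lemma z: "sz t (3 * R) \<Longrightarrow> x13 (t * s') \<otimes> x34 s = z t \<otimes> (x34 s \<otimes> x13 (t * s'))"
  by (simp add: z_def m_assoc del: inv_mult_group)

text \<open>\<open>commutator_transfer_x\<close> with \<open>b = y s'\<close> and \<open>c = s\<close>.\<close>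

lemma commutator_12_24:
  assumes "small12 a" "sz y (2 * R + fst p)" "sz (a * y) (3 * R)"
  shows "x12 a \<otimes> x24 y = z (a * y) \<otimes> (x24 y \<otimes> x12 a)"
proof -
  have "small23 (y * s')"
    by (rule sz_mult'[OF assms(2) s(2)]) (use R in simp)
  moreover have "small13 (a * (y * s'))"
    using small_s(2)[OF assms(3)] by (simp add: mult.assoc)
  moreover have "small24 y" using sz_mono[OF assms(2)] R by simp
  ultimately show ?thesis
    using commutator_transfer_x[of a "y * s'" s "z (a * y)"] z[OF assms(3)] assms
    by (simp add: mult.assoc[symmetric])
qed

text \<open>Two applications of \<open>commutator_transfer_x\<close>: splitting off a unit of the size of the entry \<open>23\<close>
  turns this commutator into one of entries \<open>12\<close> and \<open>24\<close>, which is known by \<open>commutator_12_24\<close>.\<close>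

lemma commutator_13_34:
  assumes x: "sz x (2 * R - snd p)" and c: "sz c (R + snd p)"
  shows "x13 x \<otimes> x34 c = z (x * c) \<otimes> (x34 c \<otimes> x13 x)"
proof -
  obtain b b' where b: "sz b (fst p - snd p)" "sz b' (- (fst p - snd p))" "b * b' = 1"
    using sz_unit by blast
  have [simp]: "y * b' * b = y" "y * b * b' = y" for y
    using b(3) by (simp_all add: mult.assoc mult.commute[of b' b])
  have sx: "small13 x" and sc: "small34 c" using sz_mono[OF x] sz_mono[OF c] R by auto
  have sb: "small23 b" using sz_mono[OF b(1)] R by auto
  have sa: "small12 (x * b')" by (rule sz_mult'[OF x b(2)]) (use R in simp)
  have bc: "sz (b * c) (R + fst p)" by (rule sz_mult'[OF b(1) c]) simp
  have bc': "sz (b * c) (2 * R + fst p)" "small24 (b * c)" using sz_mono[OF bc] R by auto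
  have xc: "sz (x * c) (3 * R)" by (rule sz_mult'[OF x c]) simp
  have eq: "x * b' * (b * c) = x * c" by (simp add: mult.assoc[symmetric])
  obtain w where w: "w \<in> carrier H" "x13 x \<otimes> x34 c = w \<otimes> (x34 c \<otimes> x13 x)"
    using commutator_exists[of "x13 x" "x34 c"] sx sc by auto
  have "x12 (x * b') \<otimes> x24 (b * c) = w \<otimes> (x24 (b * c) \<otimes> x12 (x * b'))"
    by (rule commutator_transfer_x) (use sa sb sc bc' sx w in auto)
  moreover have "x12 (x * b') \<otimes> x24 (b * c) = z (x * c) \<otimes> (x24 (b * c) \<otimes> x12 (x * b'))"
    by (rule commutator_12_24[of "x * b'" "b * c", unfolded eq, OF sa bc'(1) xc])
  ultimately have "w = z (x * c)"
    by (rule commutator_unique[OF x_closed(1)[OF sa] x_closed(4)[OF bc'(2)] w(1) z_closed[OF xc]])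
  then show ?thesis using w by simp
qed

lemma z_as_12_24:
  assumes t: "sz t (3 * R)"
  obtains a y where "small12 a" "small24 y" "x12 a \<otimes> x24 y = z t \<otimes> (x24 y \<otimes> x12 a)"
proof -
  obtain y y' where y: "sz y (fst p)" "sz y' (- fst p)" "y * y' = 1" using sz_unit by blast
  have "t * y' * y = t" using y(3) by (simp add: mult.assoc mult.commute[of y' y])
  moreover have "small12 (t * y')" by (rule sz_mult'[OF t y(2)]) simp
  moreover have "sz y (2 * R + fst p)" "small24 y" using sz_mono[OF y(1)] R by auto
  ultimately show ?thesis
    using that commutator_12_24[of "t * y'" y] t by simp
qed

text \<open>\<open>z t\<close> is a commutator of entries \<open>13\<close> and \<open>34\<close>, and also one of entries \<open>12\<close> and \<open>24\<close>. Each of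
  \<open>x12\<close> and \<open>x24\<close> commutes with both ingredients of the first, each of \<open>x13\<close> and \<open>x34\<close> with both
  ingredients of the second.\<close>

lemma z_commute:
  assumes t: "sz t (3 * R)"
  shows "small12 a \<Longrightarrow> x12 a \<otimes> z t = z t \<otimes> x12 a"
    and "small13 a \<Longrightarrow> x13 a \<otimes> z t = z t \<otimes> x13 a"
    and "small24 a \<Longrightarrow> x24 a \<otimes> z t = z t \<otimes> x24 a"
    and "small34 a \<Longrightarrow> x34 a \<otimes> z t = z t \<otimes> x34 a"
proof -
  obtain b y where yb: "small12 b" "small24 y" "x12 b \<otimes> x24 y = z t \<otimes> (x24 y \<otimes> x12 b)"
    using z_as_12_24[OF t] by blast
  note c = commute_commutator[OF _ _ _ z_closed[OF t] z[OF t]]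
    commute_commutator[OF _ _ _ z_closed[OF t] yb(3)]
  have c12: "x12 a \<otimes> x12 b = x12 b \<otimes> x12 a" if "small12 a" "small12 b" for a b
    using that by (simp add: x_add add.commute)
  have c13: "x13 a \<otimes> x13 b = x13 b \<otimes> x13 a" if "small13 a" "small13 b" for a b
    using that by (simp add: x_add add.commute)
  have c24: "x24 a \<otimes> x24 b = x24 b \<otimes> x24 a" if "small24 a" "small24 b" for a b
    using that by (simp add: x_add add.commute)
  have c34: "x34 a \<otimes> x34 b = x34 b \<otimes> x34 a" if "small34 a" "small34 b" for a b
    using that by (simp add: x_add add.commute)
  show "x12 a \<otimes> z t = z t \<otimes> x12 a" if "small12 a"
    by (rule c(1)) (use that t in \<open>simp_all add: x_commute(5) x_commute(1)\<close>)
  show "x13 a \<otimes> z t = z t \<otimes> x13 a" if "small13 a"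
    by (rule c(2)) (use that yb(1,2) in \<open>simp_all add: x_commute(6) x_commute(1)[symmetric]\<close>)
  show "x24 a \<otimes> z t = z t \<otimes> x24 a" if "small24 a"
    by (rule c(1)) (use that t in \<open>simp_all add: x_commute(4) x_commute(6)[symmetric]\<close>)
  show "x34 a \<otimes> z t = z t \<otimes> x34 a" if "small34 a"
    by (rule c(2)) (use that yb(1,2) in \<open>simp_all add: x_commute(4,5)[symmetric]\<close>)
qed

lemma z_add:
  assumes t: "sz t (3 * R)" and t': "sz t' (3 * R)"
  shows "z t \<otimes> z t' = z (t + t')"
proof (rule commutator_unique[of "x13 ((t + t') * s')" "x34 s"])
  have tt: "sz (t + t') (3 * R)" by (rule sz_add[OF t t'])
  then show "x13 ((t + t') * s') \<in> carrier H" "x34 s \<in> carrier H" "z (t + t') \<in> carrier H"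
    "z t \<otimes> z t' \<in> carrier H" using t t' by simp_all
  show "x13 ((t + t') * s') \<otimes> x34 s = z (t + t') \<otimes> (x34 s \<otimes> x13 ((t + t') * s'))"
    by (rule z[OF tt])
  have split: "x13 ((t + t') * s') = x13 (t * s') \<otimes> x13 (t' * s')"
    using t t' by (simp add: x_add(2) distrib_right)
  have "x13 ((t + t') * s') \<otimes> x34 s = x13 (t * s') \<otimes> (x13 (t' * s') \<otimes> x34 s)"
    using t t' by (simp add: split m_assoc)
  also have "\<dots> = (x13 (t * s') \<otimes> z t') \<otimes> (x34 s \<otimes> x13 (t' * s'))"
    using t t' by (simp add: z[OF t'] m_assoc)
  also have "\<dots> = z t' \<otimes> ((x13 (t * s') \<otimes> x34 s) \<otimes> x13 (t' * s'))"
    using t t' by (simp add: z_commute(2)[OF t'] m_assoc)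
  also have "\<dots> = (z t' \<otimes> z t) \<otimes> (x34 s \<otimes> (x13 (t * s') \<otimes> x13 (t' * s')))"
    using t t' by (simp add: z[OF t] m_assoc)
  also have "z t' \<otimes> z t = z t \<otimes> z t'"
    by (rule commute_commutator[of _ "x34 s" "x13 (t * s')"])
      (use t t' in \<open>simp_all add: z z_commute(2,4)[symmetric]\<close>)
  finally show "x13 ((t + t') * s') \<otimes> x34 s = (z t \<otimes> z t') \<otimes> (x34 s \<otimes> x13 ((t + t') * s'))"
    by (simp only: split)
qed

text \<open>Conjugation by \<open>x23\<close> fixes the ingredient \<open>13\<close> of \<open>z t\<close> and multiplies the ingredient \<open>34\<close> by an
  entry \<open>24\<close>, which commutes with everything in sight.\<close>

lemma z_commute_23:
  assumes t: "sz t (3 * R)" and b: "sz b (R + fst p - snd p)"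
  shows "x23 b \<otimes> z t = z t \<otimes> x23 b"
proof -
  have small: "small23 b" "small24 (b * s)"
    using sz_mono[OF b] R sz_mult'[OF b s(1), of "3 * R + fst p"] by auto
  have ext: "x23 b \<otimes> (x34 s \<otimes> g) = x24 (b * s) \<otimes> (x34 s \<otimes> (x23 b \<otimes> g))"
    "x23 b \<otimes> (x13 (t * s') \<otimes> g) = x13 (t * s') \<otimes> (x23 b \<otimes> g)"
    if "g \<in> carrier H" for g
    using small that t by (simp_all flip: m_assoc add: x_commutator x_commute)
  have "(x23 b \<otimes> z t) \<otimes> (x34 s \<otimes> x13 (t * s')) = x23 b \<otimes> (x13 (t * s') \<otimes> x34 s)"
    using small t by (simp add: z m_assoc)
  also have "\<dots> = (x13 (t * s') \<otimes> x24 (b * s)) \<otimes> (x34 s \<otimes> x23 b)"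
    using small t by (simp add: ext(2) x_commutator m_assoc)
  also have "\<dots> = x24 (b * s) \<otimes> ((x13 (t * s') \<otimes> x34 s) \<otimes> x23 b)"
    using small t by (simp add: x_commute(6) m_assoc flip: m_assoc)
  also have "\<dots> = (x24 (b * s) \<otimes> z t) \<otimes> (x34 s \<otimes> (x13 (t * s') \<otimes> x23 b))"
    using small t by (simp add: z m_assoc)
  also have "\<dots> = z t \<otimes> (x24 (b * s) \<otimes> (x34 s \<otimes> (x23 b \<otimes> x13 (t * s'))))"
    using small t by (simp add: z_commute x_commute m_assoc)
  also have "\<dots> = (z t \<otimes> x23 b) \<otimes> (x34 s \<otimes> x13 (t * s'))"
    using small t by (simp add: ext(1) m_assoc)
  finally show ?thesis using small t by (simp add: right_cancel)
qed

text \<open>Entries \<open>14\<close> of size at most zero lie in \<open>stab p\<close>, as do the two ingredients of \<open>z t\<close>; so the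
  commutator can be computed there.\<close>

lemma z_eq:
  assumes t: "sz t 0"
  shows "Uni 0 0 t 0 0 0 \<in> stab p" "z t = j (Uni 0 0 t 0 0 0)"
proof -
  have st: "Uni 0 0 t 0 0 0 \<in> stab p" "Uni 0 (t * s') 0 0 0 0 \<in> stab p" "Uni 0 0 0 0 0 s \<in> stab p"
    using s sz_mult'[OF t s(2), of "- snd p"] t by (auto simp: box_def sz_0)
  then show "Uni 0 0 t 0 0 0 \<in> stab p" by simp
  have m: "j w \<otimes> j w' = j (w * w')" if "w \<in> stab p" "w' \<in> stab p" for w w'
    using j_mult[of p] R that by simp
  have c: "j w \<in> carrier H" if "w \<in> stab p" for w using j_closed[of p] R that by simp
  have t3: "sz t (3 * R)" using sz_mono[OF t] R by simp
  show "z t = j (Uni 0 0 t 0 0 0)"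
  proof (rule commutator_unique[of "x13 (t * s')" "x34 s"])
    show "x13 (t * s') \<otimes> x34 s = z t \<otimes> (x34 s \<otimes> x13 (t * s'))" by (rule z[OF t3])
    show "x13 (t * s') \<otimes> x34 s = j (Uni 0 0 t 0 0 0) \<otimes> (x34 s \<otimes> x13 (t * s'))"
      by (simp add: m st box_mult) (simp add: times_uni_def)
  qed (use t3 c st in auto)
qed

lemma x_zero: "x12 0 = \<one>" "x13 0 = \<one>" "x23 0 = \<one>" "x24 0 = \<one>" "x34 0 = \<one>" "z 0 = \<one>"
proof -
  have *: "j 1 = \<one>"
  proof -
    have "j 1 \<otimes> j 1 = j 1" "j 1 \<in> carrier H" using j_mult[of p 1 1] j_closed[of p 1] R by simp_all
    then show ?thesis by (simp add: r_cancel_one)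
  qed
  show "x12 0 = \<one>" "x13 0 = \<one>" "x23 0 = \<one>" "x24 0 = \<one>" "x34 0 = \<one>" "z 0 = \<one>"
    using * z_eq(2)[of 0] by (simp_all add: one_uni_def sz_0)
qed

text \<open>In this order of factors no product of two of them has a further entry, so the factors are the
  entries of \<open>u\<close> themselves.\<close>

definition "normal_form u = x34 (e34 u) \<otimes> (x24 (e24 u) \<otimes> (x23 (e23 u) \<otimes> (x13 (e13 u) \<otimes> (x12 (e12 u) \<otimes> z (e14 u)))))"

lemma normal_form_one: "normal_form 1 = \<one>"
  by (simp add: normal_form_def one_uni_def x_zero)

text \<open>Collection: the new factor moves left to its place, and the commutators that arise have sizes
  in the range of the commutation relations because \<open>box p R\<close> is a group.\<close>

lemma normal_form_mult_x:
  assumes u: "u \<in> box p R" and v: "v \<in> box p R"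
  shows "normal_form u \<otimes> x12 (e12 v) = normal_form (u * Uni (e12 v) 0 0 0 0 0)"
    and "normal_form u \<otimes> x13 (e13 v) = normal_form (u * Uni 0 (e13 v) 0 0 0 0)"
    and "normal_form u \<otimes> x23 (e23 v) = normal_form (u * Uni 0 0 0 (e23 v) 0 0)"
    and "normal_form u \<otimes> x24 (e24 v) = normal_form (u * Uni 0 0 0 0 (e24 v) 0)"
    and "normal_form u \<otimes> x34 (e34 v) = normal_form (u * Uni 0 0 0 0 0 (e34 v))"
    and "normal_form u \<otimes> z (e14 v) = normal_form (u * Uni 0 0 (e14 v) 0 0 0)"
proof -
  note bu = box_small[OF u] and bv = box_small[OF v]
  have prods: "small13 (e12 u * e23 v)" "small24 (e23 u * e34 v)" "sz (e12 u * e24 v) (3 * R)" "sz (e13 u * e34 v) (3 * R)"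
    using R sz_mult'[OF bu(7) bv(8)] sz_mult'[OF bu(8) bv(9)] sz_mult'[OF bu(7) bv(11)] sz_mult'[OF bu(10) bv(9)]
    by auto
  have sums: "small12 (e12 u + e12 v)" "small13 (e13 u + e13 v)" "small13 (e13 u + e12 u * e23 v)"
    "small24 (e24 u + e24 v)" "small24 (e24 u + e23 u * e34 v)"
    "sz (e14 u + e12 u * e24 v) (3 * R)" "sz (e14 u + e13 u * e34 v) (3 * R)"
    using bu bv prods by (auto intro: sz_add)
  note prods = prods sums
  have ext: "x \<otimes> (y \<otimes> g) = w \<otimes> g"
    if "x \<otimes> y = w" "x \<in> carrier H" "y \<in> carrier H" "g \<in> carrier H" for x y w g
    using that by (simp flip: m_assoc)
  note x_add_ext = ext[OF x_add(1)] ext[OF x_add(2)] ext[OF x_add(3)] ext[OF x_add(4)] ext[OF x_add(5)]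
  show "normal_form u \<otimes> z (e14 v) = normal_form (u * Uni 0 0 (e14 v) 0 0 0)"
    using bu bv by (simp add: normal_form_def times_uni_def m_assoc z_add)
  show "normal_form u \<otimes> x12 (e12 v) = normal_form (u * Uni (e12 v) 0 0 0 0 0)"
    using bu bv by (simp add: normal_form_def times_uni_def m_assoc z_commute(1)[symmetric] x_add_ext)
  show "normal_form u \<otimes> x13 (e13 v) = normal_form (u * Uni 0 (e13 v) 0 0 0 0)"
    using bu bv
    by (simp add: normal_form_def times_uni_def m_assoc z_commute(2)[symmetric] ext[OF x_commute(1)] x_add_ext)
  show "normal_form u \<otimes> x23 (e23 v) = normal_form (u * Uni 0 0 0 (e23 v) 0 0)"
  proof -
    have "normal_form u \<otimes> x23 (e23 v) = x34 (e34 u) \<otimes> (x24 (e24 u) \<otimes> (x23 (e23 u) \<otimes> (x13 (e13 u) \<otimes>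
        (x13 (e12 u * e23 v) \<otimes> (x23 (e23 v) \<otimes> (x12 (e12 u) \<otimes> z (e14 u)))))))"
      using bu bv prods by (simp add: normal_form_def m_assoc z_commute_23[symmetric] ext[OF x_commutator(1)])
    also have "\<dots> = x34 (e34 u) \<otimes> (x24 (e24 u) \<otimes> (x23 (e23 u) \<otimes> (x23 (e23 v) \<otimes> (x13 (e13 u) \<otimes>
        (x13 (e12 u * e23 v) \<otimes> (x12 (e12 u) \<otimes> z (e14 u)))))))"
      using bu bv prods by (simp add: m_assoc ext[OF x_commute(2)])
    also have "\<dots> = normal_form (u * Uni 0 0 0 (e23 v) 0 0)"
      using bu bv prods by (simp add: normal_form_def times_uni_def x_add_ext)
    finally show ?thesis .
  qed
  show "normal_form u \<otimes> x24 (e24 v) = normal_form (u * Uni 0 0 0 0 (e24 v) 0)"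
  proof -
    have "normal_form u \<otimes> x24 (e24 v) = x34 (e34 u) \<otimes> (x24 (e24 u) \<otimes> (x23 (e23 u) \<otimes> (x13 (e13 u) \<otimes>
        (z (e12 u * e24 v) \<otimes> (x24 (e24 v) \<otimes> (x12 (e12 u) \<otimes> z (e14 u)))))))"
      using bu bv prods by (simp add: normal_form_def m_assoc z_commute(3)[symmetric] ext[OF commutator_12_24])
    also have "\<dots> = x34 (e34 u) \<otimes> (x24 (e24 u) \<otimes> (x24 (e24 v) \<otimes> (x23 (e23 u) \<otimes> (x13 (e13 u) \<otimes>
        (x12 (e12 u) \<otimes> (z (e12 u * e24 v) \<otimes> z (e14 u)))))))"
      using bu bv prods
      by (simp add: m_assoc ext[OF z_commute(3)[symmetric]] ext[OF z_commute(1)[symmetric]]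
          ext[OF x_commute(6)] ext[OF x_commute(3)])
    also have "\<dots> = normal_form (u * Uni 0 0 0 0 (e24 v) 0)"
      using bu bv prods
      by (simp add: normal_form_def times_uni_def x_add_ext z_add add.commute[of "e12 u * e24 v" "e14 u"])
    finally show ?thesis .
  qed
  show "normal_form u \<otimes> x34 (e34 v) = normal_form (u * Uni 0 0 0 0 0 (e34 v))"
  proof -
    have "normal_form u \<otimes> x34 (e34 v) = x34 (e34 u) \<otimes> (x24 (e24 u) \<otimes> (x23 (e23 u) \<otimes> (x13 (e13 u) \<otimes>
        (x34 (e34 v) \<otimes> (x12 (e12 u) \<otimes> z (e14 u))))))"
      using bu bv prods by (simp add: normal_form_def m_assoc z_commute(4)[symmetric] ext[OF x_commute(5)])
    also have "\<dots> = x34 (e34 u) \<otimes> (x24 (e24 u) \<otimes> (x23 (e23 u) \<otimes>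
        (z (e13 u * e34 v) \<otimes> (x34 (e34 v) \<otimes> (x13 (e13 u) \<otimes> (x12 (e12 u) \<otimes> z (e14 u)))))))"
      using bu bv prods by (simp add: m_assoc ext[OF commutator_13_34])
    also have "\<dots> = x34 (e34 u) \<otimes> (x24 (e24 u) \<otimes> (x23 (e23 u) \<otimes> (x34 (e34 v) \<otimes> (x13 (e13 u) \<otimes>
        (x12 (e12 u) \<otimes> (z (e13 u * e34 v) \<otimes> z (e14 u)))))))"
      using bu bv prods
      by (simp add: m_assoc ext[OF z_commute(1)[symmetric]] ext[OF z_commute(2)[symmetric]]
          ext[OF z_commute(4)[symmetric]])
    also have "\<dots> = x34 (e34 u) \<otimes> (x34 (e34 v) \<otimes> (x24 (e24 u) \<otimes> (x24 (e23 u * e34 v) \<otimes> (x23 (e23 u) \<otimes> (x13 (e13 u) \<otimes>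
        (x12 (e12 u) \<otimes> (z (e13 u * e34 v) \<otimes> z (e14 u))))))))"
      using bu bv prods by (simp add: m_assoc ext[OF x_commutator(2)] ext[OF x_commute(4)])
    also have "\<dots> = normal_form (u * Uni 0 0 0 0 0 (e34 v))"
      using bu bv prods
      by (simp add: normal_form_def times_uni_def x_add_ext z_add add.commute[of "e13 u * e34 v" "e14 u"])
    finally show ?thesis .
  qed
qed

lemma normal_form_mult_stab:
  assumes u: "u \<in> box p R" and v: "v \<in> stab q" and q: "2 * dist p q \<le> R"
  shows "normal_form u \<otimes> j v = normal_form (u * v)"
proof -
  have vR: "v \<in> box p R" using box_mono[OF v, of p R] q by (simp add: dist_commute)
  have q9: "dist p q \<le> 9 * R" using q R zero_le_dist[of p q] by linarith
  let ?a = "Uni (e12 v) 0 0 0 0 0" and ?b = "Uni 0 (e13 v) 0 0 0 0" and ?c = "Uni 0 0 (e14 v) 0 0 0"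
    and ?d = "Uni 0 0 0 (e23 v) 0 0" and ?e = "Uni 0 0 0 0 (e24 v) 0" and ?f = "Uni 0 0 0 0 0 (e34 v)"
  have st: "?a \<in> stab q" "?b \<in> stab q" "?c \<in> stab q" "?d \<in> stab q" "?e \<in> stab q" "?f \<in> stab q"
    using v by (auto simp: box_def sz_0)
  have bx: "w \<in> box p R" if "w \<in> stab q" for w
    using box_mono[OF that, of p R] q by (simp add: dist_commute)
  have jm: "j w \<otimes> j w' = j (w * w')" if "w \<in> stab q" "w' \<in> stab q" for w w'
    using j_mult[OF q9] that by blast
  have jc: "j w \<in> carrier H" if "w \<in> stab q" for w using j_closed[OF q9] that by blast
  have nfc: "normal_form w \<in> carrier H" if "w \<in> box p R" for w using box_small[OF that] by (simp add: normal_form_def)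
  note fac = uni_factorization[of v]
  have c0: "sz (e14 v) 0" using v by (simp add: box_def)
  have "j v = x34 (e34 v) \<otimes> (x24 (e24 v) \<otimes> (x23 (e23 v) \<otimes> (x13 (e13 v) \<otimes> (x12 (e12 v) \<otimes> j ?c))))"
    by (subst fac) (simp add: jm st box_mult)
  also have "j ?c = z (e14 v)" using z_eq(2)[OF c0] by simp
  finally have "normal_form u \<otimes> j v = ((((normal_form u \<otimes> x34 (e34 v)) \<otimes> x24 (e24 v)) \<otimes> x23 (e23 v)) \<otimes> x13 (e13 v)) \<otimes> x12 (e12 v) \<otimes> z (e14 v)"
    using nfc[OF u] jc[OF st(1)] jc[OF st(2)] jc[OF st(4)] jc[OF st(5)] jc[OF st(6)] box_small[OF vR]
    by (simp add: m_assoc)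
  also have "\<dots> = normal_form (u * ?f * ?e * ?d * ?b * ?a * ?c)"
    using u bx[OF st(1)] bx[OF st(2)] bx[OF st(4)] bx[OF st(5)] bx[OF st(6)] vR
    by (simp add: normal_form_mult_x box_mult)
  also have "u * ?f * ?e * ?d * ?b * ?a * ?c = u * v"
    by (subst fac) (simp add: mult.assoc)
  finally show ?thesis .
qed

text \<open>The value of a word in the amalgam depends on its product only. The normal form stays bounded
  for words of any length, because all their initial products remain in \<open>box p R\<close>.\<close>

theorem word_eq_normal_form:
  assumes "\<forall>w\<in>set W. \<exists>q. w \<in> stab q \<and> 2 * dist p q \<le> R"
  shows "foldr (\<otimes>) (map j W) \<one> = normal_form (prod_list W)"
proof -
  have *: "normal_form u \<otimes> foldr (\<otimes>) (map j W) \<one> = normal_form (u * prod_list W) \<and> foldr (\<otimes>) (map j W) \<one> \<in> carrier H"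
    if "u \<in> box p R" for u
    using that assms
  proof (induction W arbitrary: u)
    case Nil
    then show ?case using box_small[OF Nil(1)] by (simp add: normal_form_def)
  next
    case (Cons w W)
    then obtain q where q: "w \<in> stab q" "2 * dist p q \<le> R" by auto
    have q9: "dist p q \<le> 9 * R" using q R zero_le_dist[of p q] by linarith
    have w: "w \<in> box p R" using box_mono[OF q(1), of p R] q by (simp add: dist_commute)
    have uw: "u * w \<in> box p R" using box_mult[OF Cons.prems(1) w] .
    have c: "j w \<in> carrier H" "normal_form u \<in> carrier H"
      using j_closed[OF q9 q(1)] box_small[OF Cons.prems(1)] by (simp_all add: normal_form_def)
    have IH: "normal_form (u * w) \<otimes> foldr (\<otimes>) (map j W) \<one> = normal_form (u * w * prod_list W) \<and>
        foldr (\<otimes>) (map j W) \<one> \<in> carrier H"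
      using Cons.IH[OF uw] Cons.prems(2) by auto
    then have "normal_form u \<otimes> (j w \<otimes> foldr (\<otimes>) (map j W) \<one>) = normal_form (u * w * prod_list W)"
      using normal_form_mult_stab[OF Cons.prems(1) q] c by (simp flip: m_assoc)
    then show ?case using IH c by (simp add: mult.assoc)
  qed
  from *[OF box_one] have "foldr (\<otimes>) (map j W) \<one> \<in> carrier H"
    "\<one> \<otimes> foldr (\<otimes>) (map j W) \<one> = normal_form (prod_list W)" by (simp_all add: normal_form_one)
  then show ?thesis by simp
qed

end

section \<open>Paths in flats\<close>

definition path_in :: "'b::topological_space set \<Rightarrow> 'b \<Rightarrow> 'b \<Rightarrow> (real \<Rightarrow> 'b) \<Rightarrow> bool" where
  "path_in S x y g \<longleftrightarrow> path g \<and> path_image g \<subseteq> S \<and> pathstart g = x \<and> pathfinish g = y"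

lemma path_in_join: "path_in S x y f \<Longrightarrow> path_in S y z g \<Longrightarrow> path_in S x z (f +++ g)"
  by (auto simp: path_in_def path_image_join)

lemma homotopic_path_in: "homotopic_paths S f g \<Longrightarrow> path_in S x y f \<longleftrightarrow> path_in S x y g"
  using homotopic_paths_imp_path homotopic_paths_imp_subset homotopic_paths_imp_pathstart homotopic_paths_imp_pathfinish
  by (metis path_in_def)

lemma homotopic_join:
  assumes "homotopic_paths S f f'" "homotopic_paths S g g'" "path_in S x y f" "path_in S y z g"
  shows "homotopic_paths S (f +++ g) (f' +++ g')"
  using assms by (intro homotopic_paths_join) (auto simp: path_in_def)

lemma homotopic_refl: "path_in S x y f \<Longrightarrow> homotopic_paths S f f"
  by (simp add: path_in_def)

lemma homotopic_assoc:
  assumes "path_in S x y f" "path_in S y z g" "path_in S z t h"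
  shows "homotopic_paths S ((f +++ g) +++ h) (f +++ (g +++ h))"
  using assms by (intro homotopic_paths_sym[OF homotopic_paths_assoc]) (auto simp: path_in_def)

lemma homotopic_join_const:
  fixes f :: "real \<Rightarrow> 'b::real_normed_vector"
  assumes "path_in S x y f"
  shows "homotopic_paths S (f +++ linepath y y) f" "homotopic_paths S (linepath x x +++ f) f"
  using assms by (auto simp: path_in_def intro: homotopic_paths_rid' homotopic_paths_lid')

lemma homotopic_cancel_middle:
  fixes a :: "real \<Rightarrow> 'b::real_normed_vector"
  assumes a: "path_in S x y a" and b: "path_in S y z b" and c: "path_in S z y c" and d: "path_in S y t d"
    and bc: "homotopic_paths S (b +++ c) (linepath y y)"
  shows "homotopic_paths S ((a +++ b) +++ (c +++ d)) (a +++ d)"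
proof -
  note cd = path_in_join[OF c d] and bcj = path_in_join[OF b c]
  have "homotopic_paths S ((a +++ b) +++ (c +++ d)) (a +++ (b +++ (c +++ d)))"
    by (rule homotopic_assoc[OF a b cd])
  also have "homotopic_paths S (a +++ (b +++ (c +++ d))) (a +++ ((b +++ c) +++ d))"
    by (rule homotopic_join[OF homotopic_refl[OF a] homotopic_paths_sym[OF homotopic_assoc[OF b c d]] a
          path_in_join[OF b cd]])
  also have "homotopic_paths S (a +++ ((b +++ c) +++ d)) (a +++ (linepath y y +++ d))"
    by (rule homotopic_join[OF homotopic_refl[OF a] homotopic_join[OF bc homotopic_refl[OF d] bcj d] a
          path_in_join[OF bcj d]])
  also have "homotopic_paths S (a +++ (linepath y y +++ d)) (a +++ d)"
    by (rule homotopic_join[OF homotopic_refl[OF a] homotopic_join_const(2)[OF d] a])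
      (use d homotopic_path_in[OF homotopic_join_const(2)[OF d]] in blast)
  finally show ?thesis .
qed

text \<open>What is used of the metric: the maps \<open>\<Phi> u\<close> are Lipschitz, shearing by an element of \<open>box p r\<close>
  moves \<open>\<Phi> u p\<close> by at most a multiple of \<open>r\<close>, and conversely close points have close positions in
  the plane and differ by an element of a small box. With \<open>r = 0\<close> this says that \<open>\<Phi> u p\<close> and
  \<open>\<Phi> (u w) p\<close> coincide exactly for \<open>w\<close> in \<open>stab p\<close>.\<close>

locale flat_complex = sized_ring sz for sz :: "'r::comm_ring_1 \<Rightarrow> real \<Rightarrow> bool" +
  fixes \<Phi> :: "'r uni \<Rightarrow> real \<times> real \<Rightarrow> 'b::real_normed_vector" and C :: real
  assumes C: "0 \<le> C"
    and shear: "\<And>u w p r. u \<in> finite_size \<Longrightarrow> 0 \<le> r \<Longrightarrow> w \<in> box p r \<Longrightarrow> dist (\<Phi> u p) (\<Phi> (u * w) p) \<le> C * r"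
    and lipschitz: "\<And>u p q. u \<in> finite_size \<Longrightarrow> dist (\<Phi> u p) (\<Phi> u q) \<le> C * dist p q"
    and separated: "\<And>u v p q. u \<in> finite_size \<Longrightarrow> v \<in> finite_size \<Longrightarrow>
      dist p q \<le> C * dist (\<Phi> u p) (\<Phi> v q) \<and> uinv u * v \<in> box p (C * dist (\<Phi> u p) (\<Phi> v q))"
begin

lemma glue: "u \<in> finite_size \<Longrightarrow> w \<in> stab p \<Longrightarrow> \<Phi> (u * w) p = \<Phi> u p"
  using shear[of u 0 w p] by simp

lemma continuous_flat: "u \<in> finite_size \<Longrightarrow> continuous_on S (\<Phi> u)"
  by (rule lipschitz_on_continuous_on[of C]) (auto simp: lipschitz_on_def C lipschitz)

text \<open>A substitute for balls around \<open>\<Phi> u p\<close> that is the same for all \<open>u\<close> in a coset of \<open>box p (2 * r)\<close>;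
  so its radius does not grow along a word, however long.\<close>

definition region :: "'r uni \<Rightarrow> real \<times> real \<Rightarrow> real \<Rightarrow> 'b set" where
  "region u p r = {\<Phi> (u * v) q | v q. v \<in> box p (2 * r) \<and> dist p q \<le> r}"

lemma region_I: "v \<in> box p (2 * r) \<Longrightarrow> dist p q \<le> r \<Longrightarrow> \<Phi> (u * v) q \<in> region u p r"
  unfolding region_def by blast

lemma region_mult:
  assumes v: "v \<in> box p (2 * r)"
  shows "region (u * v) p r = region u p r"
proof
  show "region (u * v) p r \<subseteq> region u p r"
    using box_mult[OF v] by (auto simp: region_def mult.assoc)
  show "region u p r \<subseteq> region (u * v) p r"
  proof
    fix x assume "x \<in> region u p r"
    then obtain w q where w: "x = \<Phi> (u * w) q" "w \<in> box p (2 * r)" "dist p q \<le> r" by (auto simp: region_def)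
    then have "x = \<Phi> ((u * v) * (uinv v * w)) q" by (simp add: mult.assoc)
    then show "x \<in> region (u * v) p r"
      unfolding region_def using w(3) box_mult[OF box_uinv[OF v] w(2)] by blast
  qed
qed

lemma region_cball:
  assumes u: "u \<in> finite_size" and r: "0 \<le> r"
  shows "region u p r \<subseteq> cball (\<Phi> u p) (3 * C * r)"
proof
  fix x assume "x \<in> region u p r"
  then obtain w q where w: "x = \<Phi> (u * w) q" "w \<in> box p (2 * r)" "dist p q \<le> r" by (auto simp: region_def)
  have "dist (\<Phi> u p) (\<Phi> (u * w) p) \<le> C * (2 * r)" using shear[OF u _ w(2)] r by simp
  moreover have "dist (\<Phi> (u * w) p) x \<le> C * r"
    using lipschitz[OF finite_size_mult[OF u box_finite_size[OF w(2)]], of p q] w mult_left_mono[OF w(3) C] by simp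
  ultimately show "x \<in> cball (\<Phi> u p) (3 * C * r)"
    using dist_triangle[of "\<Phi> u p" x "\<Phi> (u * w) p"] by (simp add: algebra_simps)
qed

definition flat :: "'r uni \<Rightarrow> real \<times> real \<Rightarrow> real \<times> real \<Rightarrow> real \<Rightarrow> 'b" where
  "flat u p q = \<Phi> u \<circ> linepath p q"

lemma flat_homotopic:
  assumes u: "u \<in> finite_size" and g: "path g" "path g'" "path_image g \<subseteq> cball p r" "path_image g' \<subseteq> cball p r"
    "pathstart g' = pathstart g" "pathfinish g' = pathfinish g"
  shows "homotopic_paths (region u p r) (\<Phi> u \<circ> g) (\<Phi> u \<circ> g')"
proof (rule homotopic_paths_continuous_image)
  show "homotopic_paths (cball p r) g g'"
  proof (rule homotopic_paths_linear[OF g(1,2,5,6)])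
    fix t :: real assume "t \<in> {0..1}"
    then have "g t \<in> cball p r" "g' t \<in> cball p r"
      using g(3,4) unfolding path_image_def by blast+
    then show "closed_segment (g t) (g' t) \<subseteq> cball p r" by (rule closed_segment_subset) simp
  qed
  show "continuous_on (cball p r) (\<Phi> u)" by (rule continuous_flat[OF u])
  show "\<Phi> u \<in> cball p r \<rightarrow> region u p r" using region_I[of 1 p r _ u] by auto
qed

lemma flat_in:
  assumes "u \<in> finite_size" "dist p q \<le> r" "dist p q' \<le> r"
  shows "path_in (region u p r) (\<Phi> u q) (\<Phi> u q') (flat u q q')"
proof -
  have "closed_segment q q' \<subseteq> cball p r" using assms by (intro closed_segment_subset) auto
  then have "homotopic_paths (region u p r) (flat u q q') (flat u q q')"
    unfolding flat_def by (intro flat_homotopic assms) auto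
  then show ?thesis
    by (auto simp: path_in_def flat_def pathstart_compose pathfinish_compose)
qed

lemma flat_triangle:
  assumes u: "u \<in> finite_size" and d: "dist p q \<le> r" "dist p q' \<le> r" "dist p q'' \<le> r"
  shows "homotopic_paths (region u p r) (flat u q q' +++ flat u q' q'') (flat u q q'')"
proof -
  have seg: "closed_segment a b \<subseteq> cball p r" if "dist p a \<le> r" "dist p b \<le> r" for a b
    using that by (intro closed_segment_subset) auto
  have "homotopic_paths (region u p r) (\<Phi> u \<circ> (linepath q q' +++ linepath q' q'')) (\<Phi> u \<circ> linepath q q'')"
    using seg d by (intro flat_homotopic u) (auto simp: path_image_join)
  then show ?thesis by (simp add: flat_def path_compose_join)
qed

lemma flat_refl: "flat u q q = linepath (\<Phi> u q) (\<Phi> u q)"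
  by (auto simp: flat_def linepath_refl)

lemma flat_switch:
  assumes u: "u \<in> finite_size" and w: "w \<in> stab q" "w \<in> stab q'" and d: "dist p q \<le> r" "dist p q' \<le> r"
  shows "homotopic_paths (region u p r) (flat u q q') (flat (u * w) q q')"
proof (rule homotopic_paths_eq)
  show "path (flat u q q')" "path_image (flat u q q') \<subseteq> region u p r"
    using flat_in[OF u d] by (auto simp: path_in_def)
  fix t :: real assume "t \<in> {0..1}"
  then have "linepath q q' t \<in> closed_segment q q'" by (auto simp: linepath_in_path)
  then show "flat u q q' t = flat (u * w) q q' t"
    using glue[OF u] stab_convex[OF w] by (simp add: flat_def)
qed

text \<open>The point \<open>q\<close> records where the path of a letter changes from one flat to the other.\<close>

definition letters :: "real \<times> real \<Rightarrow> real \<Rightarrow> ((real \<times> real) \<times> 'r uni) set" where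
  "letters p r = {(q, w). dist p q \<le> r \<and> w \<in> stab q}"

lemma letters_box: "l \<in> letters p r \<Longrightarrow> snd l \<in> box p (2 * r)"
  by (auto simp: letters_def dist_commute intro: box_mono)

definition lpath :: "'r uni \<Rightarrow> real \<times> real \<Rightarrow> (real \<times> real) \<times> 'r uni \<Rightarrow> real \<Rightarrow> 'b" where
  "lpath u p l = flat u p (fst l) +++ flat (u * snd l) (fst l) p"

fun wpath :: "'r uni \<Rightarrow> real \<times> real \<Rightarrow> ((real \<times> real) \<times> 'r uni) list \<Rightarrow> real \<Rightarrow> 'b" where
  "wpath u p [] = linepath (\<Phi> u p) (\<Phi> u p)"
| "wpath u p (l # W) = lpath u p l +++ wpath (u * snd l) p W"

abbreviation "val W \<equiv> prod_list (map snd W)"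

lemma val_box: "set W \<subseteq> letters p r \<Longrightarrow> val W \<in> box p (2 * r)"
  by (induction W) (auto intro: box_mult letters_box)

lemma radius_nonneg: "l \<in> letters p r \<Longrightarrow> 0 \<le> r"
  by (auto simp: letters_def intro: order_trans[OF zero_le_dist])

lemma flat_in':
  assumes "u \<in> finite_size" "v \<in> box p (2 * r)" "dist p q \<le> r" "dist p q' \<le> r"
  shows "path_in (region u p r) (\<Phi> (u * v) q) (\<Phi> (u * v) q') (flat (u * v) q q')"
  using flat_in[OF finite_size_mult[OF assms(1) box_finite_size[OF assms(2)]] assms(3,4)] by (simp add: region_mult[OF assms(2)])

text \<open>The base point \<open>p'\<close> of the path may differ from the centre \<open>p\<close> of the region, for the sake of
  triangles, whose sides start at different points.\<close>

lemma lpath_in_from: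
  assumes u: "u \<in> finite_size" and l: "l \<in> letters p r" and p': "dist p p' \<le> r"
  shows "path_in (region u p r) (\<Phi> u p') (\<Phi> (u * snd l) p') (lpath u p' l)"
proof -
  obtain q w where l': "l = (q, w)" "dist p q \<le> r" "w \<in> stab q" using l by (auto simp: letters_def)
  show ?thesis
    unfolding lpath_def
    by (rule path_in_join[of _ _ "\<Phi> u q"])
      (use flat_in[OF u p', of q] flat_in'[OF u letters_box[OF l] _ p', of q] glue[OF u l'(3)] l' in auto)
qed

lemma wpath_in_from:
  assumes "u \<in> finite_size" "set W \<subseteq> letters p r" "dist p p' \<le> r"
  shows "path_in (region u p r) (\<Phi> u p') (\<Phi> (u * val W) p') (wpath u p' W)"
  using assms
proof (induction W arbitrary: u)
  case Nil
  from flat_in[OF Nil.prems(1,3,3)] show ?case by (simp add: flat_refl linepath_refl)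
next
  case (Cons l W)
  then have l: "l \<in> letters p r" and W: "set W \<subseteq> letters p r" by auto
  have ul: "u * snd l \<in> finite_size" using finite_size_mult[OF Cons.prems(1) box_finite_size[OF letters_box[OF l]]] .
  from path_in_join[OF lpath_in_from[OF Cons.prems(1) l Cons.prems(3)]] Cons.IH[OF ul W Cons.prems(3)]
  show ?case by (simp add: region_mult[OF letters_box[OF l]] mult.assoc)
qed

lemma lpath_in:
  assumes "u \<in> finite_size" "l \<in> letters p r"
  shows "path_in (region u p r) (\<Phi> u p) (\<Phi> (u * snd l) p) (lpath u p l)"
  by (rule lpath_in_from[OF assms]) (use radius_nonneg[OF assms(2)] in simp)

lemma wpath_in:
  assumes "u \<in> finite_size" "set W \<subseteq> letters p r" "0 \<le> r"
  shows "path_in (region u p r) (\<Phi> u p) (\<Phi> (u * val W) p) (wpath u p W)"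
  by (rule wpath_in_from) (use assms in auto)

text \<open>Between \<open>q\<close> and \<open>q'\<close> the two flats agree by \<open>stab_convex\<close>, so the point at which the path changes
  flats can slide from one to the other.\<close>

lemma lpath_indep:
  assumes u: "u \<in> finite_size" and l: "(q, w) \<in> letters p r" "(q', w) \<in> letters p r"
  shows "homotopic_paths (region u p r) (lpath u p (q, w)) (lpath u p (q', w))"
proof -
  let ?S = "region u p r"
  have d: "dist p q \<le> r" "dist p q' \<le> r" "dist p p \<le> r" and w: "w \<in> stab q" "w \<in> stab q'"
    using l radius_nonneg[OF l(1)] by (auto simp: letters_def)
  have wb: "w \<in> box p (2 * r)" using letters_box[OF l(1)] by simp
  have uw: "u * w \<in> finite_size" using finite_size_mult[OF u box_finite_size[OF wb]] .
  have e: "\<Phi> (u * w) q = \<Phi> u q" "\<Phi> (u * w) q' = \<Phi> u q'" using glue[OF u] w by auto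
  let ?a = "flat u p q" and ?b = "flat (u * w) q p" and ?a' = "flat u p q'" and ?b' = "flat (u * w) q' p"
    and ?m = "flat u q' q"
  note a = flat_in[OF u d(3,1)] and a' = flat_in[OF u d(3,2)] and m = flat_in[OF u d(2,1)]
  note b = flat_in'[OF u wb d(1,3), unfolded e] and b' = flat_in'[OF u wb d(2,3), unfolded e]
  have "homotopic_paths ?S (?a +++ ?b) ((?a' +++ ?m) +++ ?b)"
    by (rule homotopic_join[OF homotopic_paths_sym[OF flat_triangle[OF u d(3,2,1)]] homotopic_refl[OF b] a b])
  also have "homotopic_paths ?S \<dots> (?a' +++ (?m +++ ?b))"
    by (rule homotopic_assoc[OF a' m b])
  also have "homotopic_paths ?S \<dots> (?a' +++ (flat (u * w) q' q +++ ?b))"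
    by (rule homotopic_join[OF homotopic_refl[OF a'] homotopic_join[OF flat_switch[OF u w(2,1) d(2,1)] homotopic_refl[OF b] m b]
        a' path_in_join[OF m b]])
  also have "homotopic_paths ?S \<dots> (?a' +++ ?b')"
  proof (rule homotopic_join[OF homotopic_refl[OF a'] _ a'])
    show "homotopic_paths ?S (flat (u * w) q' q +++ ?b) ?b'"
      using flat_triangle[OF uw d(2,1,3)] by (simp add: region_mult[OF wb])
    then show "path_in ?S (\<Phi> u q') (\<Phi> (u * w) p) (flat (u * w) q' q +++ ?b)"
      using b' homotopic_path_in by blast
  qed
  finally show ?thesis by (simp add: lpath_def)
qed

lemma lpath_one:
  assumes u: "u \<in> finite_size" and q: "dist p q \<le> r"
  shows "homotopic_paths (region u p r) (lpath u p (q, 1)) (linepath (\<Phi> u p) (\<Phi> u p))"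
  using flat_triangle[OF u _ q, of p p] q order_trans[OF zero_le_dist q] by (simp add: lpath_def flat_refl)

text \<open>The way back to \<open>p\<close> of the first letter cancels the way to \<open>q\<close> of the second.\<close>

lemma lpath_mult:
  assumes u: "u \<in> finite_size" and l: "(q, w) \<in> letters p r" "(q, w') \<in> letters p r"
  shows "homotopic_paths (region u p r) (lpath u p (q, w) +++ lpath (u * w) p (q, w')) (lpath u p (q, w * w'))"
proof -
  have d: "dist p q \<le> r" "dist p p \<le> r" and w: "w \<in> stab q" "w' \<in> stab q"
    using l radius_nonneg[OF l(1)] by (auto simp: letters_def)
  have wb: "w \<in> box p (2 * r)" "w' \<in> box p (2 * r)" using letters_box[OF l(1)] letters_box[OF l(2)] by simp_all
  have uw: "u * w \<in> finite_size" using finite_size_mult[OF u box_finite_size[OF wb(1)]] .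
  have e: "\<Phi> (u * w) q = \<Phi> u q" "\<Phi> (u * (w * w')) q = \<Phi> u q"
    using glue[OF u] w box_mult[OF w] by auto
  have "homotopic_paths (region u p r)
      ((flat u p q +++ flat (u * w) q p) +++ (flat (u * w) p q +++ flat (u * (w * w')) q p))
      (flat u p q +++ flat (u * (w * w')) q p)"
  proof (rule homotopic_cancel_middle)
    show "path_in (region u p r) (\<Phi> u p) (\<Phi> u q) (flat u p q)" by (rule flat_in[OF u d(2,1)])
    show "path_in (region u p r) (\<Phi> u q) (\<Phi> (u * w) p) (flat (u * w) q p)"
      using flat_in'[OF u wb(1) d] e by simp
    show "path_in (region u p r) (\<Phi> (u * w) p) (\<Phi> u q) (flat (u * w) p q)"
      using flat_in'[OF u wb(1) d(2,1)] e by simp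
    show "path_in (region u p r) (\<Phi> u q) (\<Phi> (u * (w * w')) p) (flat (u * (w * w')) q p)"
      using flat_in'[OF u box_mult[OF wb] d] e by simp
    show "homotopic_paths (region u p r) (flat (u * w) q p +++ flat (u * w) p q) (linepath (\<Phi> u q) (\<Phi> u q))"
      using flat_triangle[OF uw d(1,2,1)] by (simp add: region_mult[OF wb(1)] flat_refl e)
  qed
  then show ?thesis by (simp add: lpath_def mult.assoc)
qed

lemma wpath_append:
  assumes "u \<in> finite_size" "set V \<subseteq> letters p r" "set W \<subseteq> letters p r" "0 \<le> r"
  shows "homotopic_paths (region u p r) (wpath u p (V @ W)) (wpath u p V +++ wpath (u * val V) p W)"
  using assms(1,2)
proof (induction V arbitrary: u)
  case Nil
  then show ?case
    using homotopic_paths_sym[OF homotopic_join_const(2)[OF wpath_in[OF _ assms(3,4)]]] by (simp add: linepath_refl)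
next
  case (Cons l V)
  then have l: "l \<in> letters p r" and V: "set V \<subseteq> letters p r" by auto
  note lb = letters_box[OF l]
  have ul: "u * snd l \<in> finite_size" using finite_size_mult[OF Cons.prems(1) box_finite_size[OF lb]] .
  have ulV: "u * snd l * val V \<in> finite_size" using finite_size_mult[OF ul box_finite_size[OF val_box[OF V]]] .
  note pl = lpath_in[OF Cons.prems(1) l]
  have pV: "path_in (region u p r) (\<Phi> (u * snd l) p) (\<Phi> (u * snd l * val V) p) (wpath (u * snd l) p V)"
    using wpath_in[OF ul V assms(4)] by (simp add: region_mult[OF lb])
  have pW: "path_in (region u p r) (\<Phi> (u * snd l * val V) p) (\<Phi> (u * snd l * val V * val W) p) (wpath (u * snd l * val V) p W)"
    using wpath_in[OF ulV assms(3,4)] by (simp add: region_mult[OF val_box[OF V]] region_mult[OF lb])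
  have IH: "homotopic_paths (region u p r) (wpath (u * snd l) p (V @ W)) (wpath (u * snd l) p V +++ wpath (u * snd l * val V) p W)"
    using Cons.IH[OF ul V] by (simp add: region_mult[OF lb])
  have "homotopic_paths (region u p r) (lpath u p l +++ wpath (u * snd l) p (V @ W))
      (lpath u p l +++ (wpath (u * snd l) p V +++ wpath (u * snd l * val V) p W))"
    by (rule homotopic_join[OF homotopic_refl[OF pl] IH pl])
      (use IH homotopic_path_in path_in_join[OF pV pW] in blast)
  also have "homotopic_paths (region u p r) \<dots> ((lpath u p l +++ wpath (u * snd l) p V) +++ wpath (u * snd l * val V) p W)"
    by (rule homotopic_paths_sym[OF homotopic_assoc[OF pl pV pW]])
  finally show ?case by (simp add: mult.assoc)
qed

end

section \<open>The homotopy group of words\<close>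

context flat_complex begin

text \<open>Words give paths from every \<open>\<Phi> u p\<close>; they are equivalent if these are homotopic for all \<open>u\<close>.
  Equality of the products is part of the definition so that equivalent prefixes leave
  the rest of a word starting at the same element \<open>u\<close>.\<close>

definition word_equiv :: "real \<times> real \<Rightarrow> real \<Rightarrow> ((real \<times> real) \<times> 'r uni) list \<Rightarrow> ((real \<times> real) \<times> 'r uni) list \<Rightarrow> bool" where
  "word_equiv p r V W \<longleftrightarrow> set V \<subseteq> letters p r \<and> set W \<subseteq> letters p r \<and> val V = val W \<and>
     (\<forall>u\<in>finite_size. homotopic_paths (region u p r) (wpath u p V) (wpath u p W))"

lemma word_equiv_refl: "0 \<le> r \<Longrightarrow> set V \<subseteq> letters p r \<Longrightarrow> word_equiv p r V V"
  unfolding word_equiv_def using homotopic_refl[OF wpath_in] by blast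

lemma word_equiv_sym: "word_equiv p r V W \<Longrightarrow> word_equiv p r W V"
  by (auto simp: word_equiv_def intro: homotopic_paths_sym)

lemma word_equiv_trans [trans]: "word_equiv p r V W \<Longrightarrow> word_equiv p r W X \<Longrightarrow> word_equiv p r V X"
  by (auto simp: word_equiv_def intro: homotopic_paths_trans)

lemma word_equiv_append:
  assumes V: "word_equiv p r V V'" and W: "word_equiv p r W W'" and r: "0 \<le> r"
  shows "word_equiv p r (V @ W) (V' @ W')"
proof -
  have s: "set V \<subseteq> letters p r" "set V' \<subseteq> letters p r" "set W \<subseteq> letters p r" "set W' \<subseteq> letters p r"
    and v: "val V' = val V" "val W' = val W"
    using V W by (auto simp: word_equiv_def)
  have "homotopic_paths (region u p r) (wpath u p (V @ W)) (wpath u p (V' @ W'))" if u: "u \<in> finite_size" for u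
  proof -
    note vb = val_box[OF s(1)]
    have uV: "u * val V \<in> finite_size" using finite_size_mult[OF u box_finite_size[OF vb]] .
    have "homotopic_paths (region u p r) (wpath u p V +++ wpath (u * val V) p W) (wpath u p V' +++ wpath (u * val V') p W')"
    proof (rule homotopic_join)
      show "homotopic_paths (region u p r) (wpath u p V) (wpath u p V')"
        using V u by (simp add: word_equiv_def)
      show "homotopic_paths (region u p r) (wpath (u * val V) p W) (wpath (u * val V') p W')"
        using W uV unfolding word_equiv_def v region_mult[OF vb, of u, symmetric] by blast
      show "path_in (region u p r) (\<Phi> u p) (\<Phi> (u * val V) p) (wpath u p V)"
        by (rule wpath_in[OF u s(1) r])
      show "path_in (region u p r) (\<Phi> (u * val V) p) (\<Phi> (u * val V * val W) p) (wpath (u * val V) p W)"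
        using wpath_in[OF uV s(3) r] by (simp add: region_mult[OF vb])
    qed
    then show ?thesis
      by (rule homotopic_paths_trans[OF wpath_append[OF u s(1,3) r] homotopic_paths_trans[OF _
            homotopic_paths_sym[OF wpath_append[OF u s(2,4) r]]]])
  qed
  then show ?thesis using s v by (simp add: word_equiv_def)
qed

lemma wpath_single:
  assumes u: "u \<in> finite_size" and l: "l \<in> letters p r"
  shows "homotopic_paths (region u p r) (wpath u p [l]) (lpath u p l)"
  using homotopic_join_const(1)[OF lpath_in[OF u l]] by simp

lemma word_equiv_indep:
  assumes "(q, w) \<in> letters p r" "(q', w) \<in> letters p r"
  shows "word_equiv p r [(q, w)] [(q', w)]"
  using assms homotopic_paths_trans[OF wpath_single[OF _ assms(1)] homotopic_paths_trans[OF
      lpath_indep[OF _ assms] homotopic_paths_sym[OF wpath_single[OF _ assms(2)]]]]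
  by (simp add: word_equiv_def)

lemma word_equiv_one:
  assumes q: "dist p q \<le> r"
  shows "word_equiv p r [(q, 1)] []"
proof -
  have l: "(q, 1) \<in> letters p r" using q by (simp add: letters_def)
  show ?thesis
    unfolding word_equiv_def using l homotopic_paths_trans[OF wpath_single[OF _ l] lpath_one[OF _ q]]
    by simp
qed

lemma word_equiv_mult:
  assumes l: "(q, w) \<in> letters p r" "(q, w') \<in> letters p r"
  shows "word_equiv p r [(q, w), (q, w')] [(q, w * w')]"
proof -
  have r: "0 \<le> r" using radius_nonneg[OF l(1)] .
  have l': "(q, w * w') \<in> letters p r" using l box_mult by (auto simp: letters_def)
  note wb = letters_box[OF l(1), unfolded snd_conv]
  have "homotopic_paths (region u p r) (wpath u p [(q, w), (q, w')]) (wpath u p [(q, w * w')])" if u: "u \<in> finite_size" for u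
  proof -
    have uw: "u * w \<in> finite_size" using finite_size_mult[OF u box_finite_size[OF wb]] .
    have "homotopic_paths (region u p r) (lpath u p (q, w) +++ wpath (u * w) p [(q, w')]) (lpath u p (q, w) +++ lpath (u * w) p (q, w'))"
    proof (rule homotopic_join)
      show "homotopic_paths (region u p r) (lpath u p (q, w)) (lpath u p (q, w))"
        by (rule homotopic_refl[OF lpath_in[OF u l(1)]])
      show "homotopic_paths (region u p r) (wpath (u * w) p [(q, w')]) (lpath (u * w) p (q, w'))"
        using wpath_single[OF uw l(2)] by (simp add: region_mult[OF wb])
      show "path_in (region u p r) (\<Phi> u p) (\<Phi> (u * w) p) (lpath u p (q, w))"
        using lpath_in[OF u l(1)] by simp
      show "path_in (region u p r) (\<Phi> (u * w) p) (\<Phi> (u * w * w') p) (wpath (u * w) p [(q, w')])"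
        using wpath_in[OF uw _ r, of "[(q, w')]" p] l(2) by (simp add: region_mult[OF wb])
    qed
    also have "homotopic_paths (region u p r) \<dots> (lpath u p (q, w * w'))" by (rule lpath_mult[OF u l])
    also have "homotopic_paths (region u p r) \<dots> (wpath u p [(q, w * w')])"
      by (rule homotopic_paths_sym[OF wpath_single[OF u l']])
    finally show ?thesis by simp
  qed
  then show ?thesis using l l' by (simp add: word_equiv_def)
qed

definition word_class :: "real \<times> real \<Rightarrow> real \<Rightarrow> ((real \<times> real) \<times> 'r uni) list \<Rightarrow> ((real \<times> real) \<times> 'r uni) list set" where
  "word_class p r V = {W. word_equiv p r V W}"

text \<open>The product of classes is written as a union over representatives; by \<open>word_class_mult\<close> all
  members of the union coincide.\<close>

definition word_group :: "real \<times> real \<Rightarrow> real \<Rightarrow> ((real \<times> real) \<times> 'r uni) list set monoid" where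
  "word_group p r = \<lparr>carrier = word_class p r ` lists (letters p r),
     mult = (\<lambda>A B. \<Union>a\<in>A. \<Union>b\<in>B. word_class p r (a @ b)), one = word_class p r []\<rparr>"

lemma word_class_eq:
  assumes "set V \<subseteq> letters p r" "set W \<subseteq> letters p r" "0 \<le> r"
  shows "word_class p r V = word_class p r W \<longleftrightarrow> word_equiv p r V W"
proof
  assume "word_class p r V = word_class p r W"
  then show "word_equiv p r V W"
    using word_equiv_refl[OF assms(3,2)] by (auto simp: word_class_def)
qed (auto simp: word_class_def intro: word_equiv_trans word_equiv_sym)

lemma word_class_mult:
  assumes "set V \<subseteq> letters p r" "set W \<subseteq> letters p r" "0 \<le> r"
  shows "word_class p r V \<otimes>\<^bsub>word_group p r\<^esub> word_class p r W = word_class p r (V @ W)"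
proof -
  have eq: "word_class p r (a @ b) = word_class p r (V @ W)" if "a \<in> word_class p r V" "b \<in> word_class p r W" for a b
  proof -
    have ab: "word_equiv p r V a" "word_equiv p r W b" using that by (auto simp: word_class_def)
    then have "word_equiv p r (V @ W) (a @ b)" by (rule word_equiv_append[OF _ _ assms(3)])
    moreover have "set a \<subseteq> letters p r" "set b \<subseteq> letters p r" using ab by (auto simp: word_equiv_def)
    ultimately show ?thesis using assms by (subst word_class_eq) (auto intro: word_equiv_sym)
  qed
  have ne: "word_class p r V \<noteq> {}" "word_class p r W \<noteq> {}"
    using word_equiv_refl[OF assms(3)] assms unfolding word_class_def by blast+
  show ?thesis
    unfolding word_group_def monoid.simps
    by (intro SUP_eq_const ne eq)
qed

lemma word_left_inverse:
  assumes r: "0 \<le> r" and W: "set W \<subseteq> letters p r"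
  shows "\<exists>V. set V \<subseteq> letters p r \<and> word_equiv p r (V @ W) []"
  using W
proof (induction W)
  case Nil
  then show ?case using word_equiv_refl[OF r] by (intro exI[of _ "[]"]) simp
next
  case (Cons l W)
  obtain q w where l: "l = (q, w)" by (cases l)
  have lw: "(q, w) \<in> letters p r" "(q, uinv w) \<in> letters p r" "dist p q \<le> r"
    using Cons.prems box_uinv by (auto simp: letters_def l)
  obtain V where V: "set V \<subseteq> letters p r" "word_equiv p r (V @ W) []" using Cons by auto
  have W: "set W \<subseteq> letters p r" using Cons.prems by simp
  have "word_equiv p r [(q, uinv w), (q, w)] [(q, 1)]"
    using word_equiv_mult[OF lw(2,1)] by simp
  also have "word_equiv p r \<dots> []" by (rule word_equiv_one[OF lw(3)])
  finally have "word_equiv p r (V @ ([(q, uinv w), (q, w)] @ W)) (V @ ([] @ W))"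
    using V W by (intro word_equiv_append word_equiv_refl r)
  also have "word_equiv p r (V @ ([] @ W)) []" using V by simp
  finally show ?case
    using V lw by (intro exI[of _ "V @ [(q, uinv w)]"]) (simp add: l)
qed

lemma group_word_group:
  assumes r: "0 \<le> r"
  shows "group (word_group p r)"
proof (rule groupI)
  have c: "x \<in> carrier (word_group p r) \<longleftrightarrow> (\<exists>V. set V \<subseteq> letters p r \<and> x = word_class p r V)" for x
    by (auto simp: word_group_def in_lists_conv_set)
  have one: "\<one>\<^bsub>word_group p r\<^esub> = word_class p r []" by (simp add: word_group_def)
  show "\<one>\<^bsub>word_group p r\<^esub> \<in> carrier (word_group p r)"
    unfolding c one by (intro exI[of _ "[]"]) simp
  fix x assume "x \<in> carrier (word_group p r)"
  then obtain V where V: "set V \<subseteq> letters p r" "x = word_class p r V" using c by blast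
  show "\<one>\<^bsub>word_group p r\<^esub> \<otimes>\<^bsub>word_group p r\<^esub> x = x"
    unfolding one V using word_class_mult[OF _ V(1) r, of "[]"] by simp
  obtain V' where V': "set V' \<subseteq> letters p r" "word_equiv p r (V' @ V) []"
    using word_left_inverse[OF r V(1)] by blast
  then show "\<exists>y\<in>carrier (word_group p r). y \<otimes>\<^bsub>word_group p r\<^esub> x = \<one>\<^bsub>word_group p r\<^esub>"
    using c V r by (intro bexI[of _ "word_class p r V'"]) (auto simp: one word_class_mult word_class_eq)
  fix y assume "y \<in> carrier (word_group p r)"
  then obtain W where W: "set W \<subseteq> letters p r" "y = word_class p r W" using c by blast
  show "x \<otimes>\<^bsub>word_group p r\<^esub> y \<in> carrier (word_group p r)"
    unfolding c V W using V W r word_class_mult by (intro exI[of _ "V @ W"]) simp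
  fix z assume "z \<in> carrier (word_group p r)"
  then obtain X where X: "set X \<subseteq> letters p r" "z = word_class p r X" using c by blast
  show "x \<otimes>\<^bsub>word_group p r\<^esub> y \<otimes>\<^bsub>word_group p r\<^esub> z = x \<otimes>\<^bsub>word_group p r\<^esub> (y \<otimes>\<^bsub>word_group p r\<^esub> z)"
    using V W X r by (simp add: word_class_mult)
qed

text \<open>The class of a letter gives a map from stabilisers to the group of words that is multiplicative on
  each of them, by \<open>word_equiv_indep\<close> and \<open>word_equiv_mult\<close>. So \<open>word_eq_normal_form\<close> applies, and it says
  that the class of a word depends on its product only.\<close>

theorem wpath_homotopic_if_same_product:
  assumes R: "0 \<le> R" and u: "u \<in> finite_size"
    and V: "set V \<subseteq> letters p (R / 2)" and W: "set W \<subseteq> letters p (R / 2)" and eq: "val V = val W"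
  shows "homotopic_paths (region u p (9 * R)) (wpath u p V) (wpath u p W)"
proof -
  let ?r = "9 * R"
  have r: "0 \<le> ?r" using R by simp
  define c where "c w = (SOME q. (q, w) \<in> letters p ?r)" for w
  have c: "(c w, w) \<in> letters p ?r" if "(q, w) \<in> letters p ?r" for q w
    unfolding c_def by (rule someI[of "\<lambda>q. (q, w) \<in> letters p ?r", OF that])
  define j where "j w = word_class p ?r [(c w, w)]" for w
  have jq: "word_class p ?r [(q, w)] = j w" if "(q, w) \<in> letters p ?r" for q w
    unfolding j_def using word_equiv_indep[OF that c[OF that]] that c[OF that] r
    by (subst word_class_eq) auto
  interpret H: group "word_group p ?r" by (rule group_word_group[OF r])
  interpret stab_rep sz p R "word_group p ?r" j
  proof
    show "0 \<le> R" by (rule R)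
    fix q w assume "dist p q \<le> 9 * R" and "w \<in> stab q"
    then have l: "(q, w) \<in> letters p ?r" by (simp add: letters_def)
    show "j w \<in> carrier (word_group p ?r)"
      unfolding jq[OF l, symmetric] using l by (auto simp: word_group_def in_lists_conv_set)
    fix w' assume w': "w' \<in> stab q"
    then have l': "(q, w') \<in> letters p ?r" "(q, w * w') \<in> letters p ?r"
      using l box_mult by (auto simp: letters_def)
    show "j w \<otimes>\<^bsub>word_group p ?r\<^esub> j w' = j (w * w')"
      unfolding jq[OF l, symmetric] jq[OF l'(1), symmetric] jq[OF l'(2), symmetric]
      using l l' r word_equiv_mult[OF l l'(1)] by (simp add: word_class_mult word_class_eq)
  qed
  have sub: "letters p (R / 2) \<subseteq> letters p ?r" using R by (auto simp: letters_def)
  have cls: "word_class p ?r X = normal_form (val X)" if X: "set X \<subseteq> letters p (R / 2)" for X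
  proof -
    have "word_class p ?r X = foldr (mult (word_group p ?r)) (map j (map snd X)) \<one>\<^bsub>word_group p ?r\<^esub>"
      using X
    proof (induction X)
      case Nil
      then show ?case by (simp add: word_group_def)
    next
      case (Cons l X)
      have "word_class p ?r (l # X) = word_class p ?r [l] \<otimes>\<^bsub>word_group p ?r\<^esub> word_class p ?r X"
        using word_class_mult[OF _ _ r, of "[l]" p X] Cons.prems sub by auto
      moreover have "word_class p ?r [l] = j (snd l)"
        using jq[of "fst l" "snd l"] Cons.prems sub by auto
      ultimately show ?case using Cons by simp
    qed
    also have "\<dots> = normal_form (val X)"
    proof (rule word_eq_normal_form, rule ballI)
      fix w assume "w \<in> set (map snd X)"
      then obtain q where "(q, w) \<in> set X" by auto
      then have "(q, w) \<in> letters p (R / 2)" using X by blast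
      then show "\<exists>q. w \<in> stab q \<and> 2 * dist p q \<le> R" by (intro exI[of _ q]) (simp add: letters_def)
    qed
    finally show ?thesis .
  qed
  have "word_class p ?r V = word_class p ?r W" using cls[OF V] cls[OF W] eq by simp
  then have "word_equiv p ?r V W" using V W sub r by (subst (asm) word_class_eq) auto
  then show ?thesis using u by (simp add: word_equiv_def)
qed

definition flat_union :: "'b set" where "flat_union = {\<Phi> u p | u p. u \<in> finite_size}"

lemma letters_shift: "dist p p' + r \<le> r' \<Longrightarrow> l \<in> letters p' r \<Longrightarrow> l \<in> letters p r'"
  using dist_triangle[of p "fst l" p'] by (auto simp: letters_def)

text \<open>Moving the base point of a letter along a flat; in the middle both paths pass through \<open>\<Phi> u q\<close>.\<close>

lemma flat_lpath_rebase:
  assumes u: "u \<in> finite_size" and l: "l \<in> letters p r" and p': "dist p p' \<le> r"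
  shows "homotopic_paths (region u p r) (flat u p p' +++ lpath u p' l) (lpath u p l +++ flat (u * snd l) p p')"
proof -
  let ?S = "region u p r"
  obtain q w where l': "l = (q, w)" "dist p q \<le> r" "w \<in> stab q" using l by (auto simp: letters_def)
  have d: "dist p p \<le> r" using radius_nonneg[OF l] by simp
  note wb = letters_box[OF l, unfolded l' snd_conv]
  have uw: "u * w \<in> finite_size" using finite_size_mult[OF u box_finite_size[OF wb]] .
  have e: "\<Phi> (u * w) q = \<Phi> u q" using glue[OF u l'(3)] .
  note f = flat_in[OF u d p'] and a = flat_in[OF u p' l'(2)] and a' = flat_in[OF u d l'(2)]
  note b = flat_in'[OF u wb l'(2) p', unfolded e] and b' = flat_in'[OF u wb l'(2) d, unfolded e]
    and g = flat_in'[OF u wb d p']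
  have "homotopic_paths ?S (flat u p p' +++ (flat u p' q +++ flat (u * w) q p'))
      ((flat u p p' +++ flat u p' q) +++ flat (u * w) q p')"
    by (rule homotopic_paths_sym[OF homotopic_assoc[OF f a b]])
  also have "homotopic_paths ?S \<dots> (flat u p q +++ flat (u * w) q p')"
    by (rule homotopic_join[OF flat_triangle[OF u d p' l'(2)] homotopic_refl[OF b] path_in_join[OF f a] b])
  also have "homotopic_paths ?S \<dots> (flat u p q +++ (flat (u * w) q p +++ flat (u * w) p p'))"
    by (rule homotopic_join[OF homotopic_refl[OF a'] homotopic_paths_sym a' b])
      (use flat_triangle[OF uw l'(2) d p'] in \<open>simp add: region_mult[OF wb]\<close>)
  also have "homotopic_paths ?S \<dots> ((flat u p q +++ flat (u * w) q p) +++ flat (u * w) p p')"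
    by (rule homotopic_paths_sym[OF homotopic_assoc[OF a' b' g]])
  finally show ?thesis by (simp add: lpath_def l')
qed

lemma flat_wpath_rebase:
  assumes "u \<in> finite_size" and "set W \<subseteq> letters p r" and p': "dist p p' \<le> r"
  shows "homotopic_paths (region u p r) (flat u p p' +++ wpath u p' W) (wpath u p W +++ flat (u * val W) p p')"
  using assms(1,2)
proof (induction W arbitrary: u)
  case Nil
  have d: "dist p p \<le> r" using order_trans[OF zero_le_dist p'] by simp
  note f = flat_in[OF Nil(1) d p']
  show ?case
    using homotopic_paths_trans[OF homotopic_join_const(1)[OF f] homotopic_paths_sym[OF homotopic_join_const(2)[OF f]]]
    by (simp add: linepath_refl)
next
  case (Cons l W)
  let ?S = "region u p r"
  from Cons.prems have u: "u \<in> finite_size" and l: "l \<in> letters p r" and W: "set W \<subseteq> letters p r" by auto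
  have d: "dist p p \<le> r" "0 \<le> r" using radius_nonneg[OF l] by auto
  note lb = letters_box[OF l]
  have ul: "u * snd l \<in> finite_size" using finite_size_mult[OF u box_finite_size[OF lb]] .
  have ulW: "u * snd l * val W \<in> finite_size" using finite_size_mult[OF ul box_finite_size[OF val_box[OF W]]] .
  note f = flat_in[OF u d(1) p'] and a = lpath_in_from[OF u l p'] and a' = lpath_in[OF u l]
  note g = flat_in'[OF u lb d(1) p']
  have b: "path_in ?S (\<Phi> (u * snd l) p') (\<Phi> (u * snd l * val W) p') (wpath (u * snd l) p' W)"
    using wpath_in_from[OF ul W p'] by (simp add: region_mult[OF lb])
  have b': "path_in ?S (\<Phi> (u * snd l) p) (\<Phi> (u * snd l * val W) p) (wpath (u * snd l) p W)"
    using wpath_in[OF ul W d(2)] by (simp add: region_mult[OF lb])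
  have h: "path_in ?S (\<Phi> (u * snd l * val W) p) (\<Phi> (u * snd l * val W) p') (flat (u * snd l * val W) p p')"
    using flat_in[OF ulW d(1) p'] by (simp add: region_mult[OF val_box[OF W]] region_mult[OF lb])
  have "homotopic_paths ?S (flat u p p' +++ (lpath u p' l +++ wpath (u * snd l) p' W))
     ((flat u p p' +++ lpath u p' l) +++ wpath (u * snd l) p' W)"
    by (rule homotopic_paths_sym[OF homotopic_assoc[OF f a b]])
  also have "homotopic_paths ?S \<dots> ((lpath u p l +++ flat (u * snd l) p p') +++ wpath (u * snd l) p' W)"
    by (rule homotopic_join[OF flat_lpath_rebase[OF u l p'] homotopic_refl[OF b] path_in_join[OF f a] b])
  also have "homotopic_paths ?S \<dots> (lpath u p l +++ (flat (u * snd l) p p' +++ wpath (u * snd l) p' W))"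
    by (rule homotopic_assoc[OF a' g b])
  also have "homotopic_paths ?S \<dots> (lpath u p l +++ (wpath (u * snd l) p W +++ flat (u * snd l * val W) p p'))"
    by (rule homotopic_join[OF homotopic_refl[OF a'] _ a' path_in_join[OF g b]])
      (use Cons.IH[OF ul W] in \<open>simp add: region_mult[OF lb]\<close>)
  also have "homotopic_paths ?S \<dots> ((lpath u p l +++ wpath (u * snd l) p W) +++ flat (u * snd l * val W) p p')"
    by (rule homotopic_paths_sym[OF homotopic_assoc[OF a' b' h]])
  finally show ?case by (simp add: mult.assoc)
qed

lemma wpath_flat_concat:
  assumes u: "u \<in> finite_size" and V: "set V \<subseteq> letters p r" and W: "set W \<subseteq> letters p r"
    and p': "dist p p' \<le> r" and q: "dist p q \<le> r"
  shows "homotopic_paths (region u p r)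
     ((wpath u p V +++ flat (u * val V) p p') +++ (wpath (u * val V) p' W +++ flat (u * val V * val W) p' q))
     (wpath u p (V @ W) +++ flat (u * val V * val W) p q)"
proof -
  let ?S = "region u p r" and ?v = "u * val V" and ?w = "u * val V * val W"
  have d: "dist p p \<le> r" "0 \<le> r" using order_trans[OF zero_le_dist p'] by simp_all
  note vb = val_box[OF V] and wb = val_box[OF W]
  have v: "?v \<in> finite_size" and w: "?w \<in> finite_size" using finite_size_mult[OF u box_finite_size[OF vb]] finite_size_mult[OF _ box_finite_size[OF wb]] by auto
  have reg: "region ?v p r = ?S" "region ?w p r = ?S" by (simp_all add: region_mult[OF vb] region_mult[OF wb])
  note a = wpath_in[OF u V d(2)]
    and b = flat_in[OF v d(1) p', unfolded reg]
    and c = wpath_in_from[OF v W p', unfolded reg]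
    and e = flat_in[OF w p' q, unfolded reg]
    and c' = wpath_in[OF v W d(2), unfolded reg]
    and b' = flat_in[OF w d(1) p', unfolded reg]
    and e' = flat_in[OF w d(1) q, unfolded reg]
  have "homotopic_paths ?S
     ((wpath u p V +++ flat ?v p p') +++ (wpath ?v p' W +++ flat ?w p' q))
     (((wpath u p V +++ flat ?v p p') +++ wpath ?v p' W) +++ flat ?w p' q)"
    by (rule homotopic_paths_sym[OF homotopic_assoc[OF path_in_join[OF a b] c e]])
  also have "homotopic_paths ?S \<dots> ((wpath u p V +++ (flat ?v p p' +++ wpath ?v p' W)) +++ flat ?w p' q)"
    by (rule homotopic_join[OF homotopic_assoc[OF a b c] homotopic_refl[OF e] path_in_join[OF path_in_join[OF a b] c] e])
  also have "homotopic_paths ?S \<dots> ((wpath u p V +++ (wpath ?v p W +++ flat ?w p p')) +++ flat ?w p' q)"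
    by (rule homotopic_join[OF homotopic_join[OF homotopic_refl[OF a] flat_wpath_rebase[OF v W p', unfolded reg] a path_in_join[OF b c]]
          homotopic_refl[OF e] path_in_join[OF a path_in_join[OF b c]] e])
  also have "homotopic_paths ?S \<dots> (((wpath u p V +++ wpath ?v p W) +++ flat ?w p p') +++ flat ?w p' q)"
    by (rule homotopic_join[OF homotopic_paths_sym[OF homotopic_assoc[OF a c' b']] homotopic_refl[OF e]
          path_in_join[OF a path_in_join[OF c' b']] e])
  also have "homotopic_paths ?S \<dots> ((wpath u p V +++ wpath ?v p W) +++ (flat ?w p p' +++ flat ?w p' q))"
    by (rule homotopic_assoc[OF path_in_join[OF a c'] b' e])
  also have "homotopic_paths ?S \<dots> (wpath u p (V @ W) +++ flat ?w p q)"
    by (rule homotopic_join[OF homotopic_paths_sym[OF wpath_append[OF u V W d(2)]]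
          flat_triangle[OF w d(1) p' q, unfolded reg] path_in_join[OF a c'] path_in_join[OF b' e]])
  finally show ?thesis .
qed

text \<open>The chosen path from \<open>x = \<Phi> u p\<close> to \<open>y = \<Phi> v q\<close> first follows a word with product \<open>uinv u * v\<close>, then goes
  from \<open>p\<close> to \<open>q\<close> in the flat of \<open>v\<close>. In a triangle, rebasing the second side turns the
  concatenation of two sides into a path of the same kind whose word has the same product as the word
  of the third side; the two words then give homotopic paths.\<close>

theorem flat_union_simply_connected:
  shows "path_connected flat_union" and "\<And>\<gamma>. path \<gamma> \<Longrightarrow> path_image \<gamma> \<subseteq> flat_union \<Longrightarrow> pathfinish \<gamma> = pathstart \<gamma> \<Longrightarrow>
     homotopic_paths flat_union (\<lambda>_. pathstart \<gamma>) \<gamma>"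
proof -
  have "\<forall>x. \<exists>u p. x \<in> flat_union \<longrightarrow> u \<in> finite_size \<and> x = \<Phi> u p" by (auto simp: flat_union_def)
  then obtain u p where up: "\<And>x. x \<in> flat_union \<Longrightarrow> u x \<in> finite_size" "\<And>x. x \<in> flat_union \<Longrightarrow> \<Phi> (u x) (p x) = x"
    by metis
  have "\<exists>W. val W = uinv (u x) * u y \<and> set W \<subseteq> letters (p x) (9 * (C * dist x y))" if "x \<in> flat_union" "y \<in> flat_union" for x y
  proof -
    interpret sized_ring_at sz "p x" "C * dist x y" by standard (simp add: C)
    have "uinv (u x) * u y \<in> box (p x) (C * dist x y)"
      using separated[OF up(1)[OF that(1)] up(1)[OF that(2)], of "p x" "p y"] up(2) that by simp
    from box_word[OF this] obtain ws where ws: "prod_list ws = uinv (u x) * u y"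
      "\<forall>w\<in>set ws. \<exists>q. w \<in> stab q \<and> dist (p x) q \<le> 9 * (C * dist x y)" by blast
    then obtain q where q: "\<And>w. w \<in> set ws \<Longrightarrow> w \<in> stab (q w) \<and> dist (p x) (q w) \<le> 9 * (C * dist x y)"
      by metis
    have "map snd (map (\<lambda>w. (q w, w)) ws) = ws" by (simp add: comp_def)
    then show ?thesis using ws(1) q
      by (intro exI[of _ "map (\<lambda>w. (q w, w)) ws"]) (auto simp: letters_def)
  qed
  then obtain W where W: "\<And>x y. x \<in> flat_union \<Longrightarrow> y \<in> flat_union \<Longrightarrow> val (W x y) = uinv (u x) * u y"
      "\<And>x y. x \<in> flat_union \<Longrightarrow> y \<in> flat_union \<Longrightarrow> set (W x y) \<subseteq> letters (p x) (9 * (C * dist x y))"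
    by metis
  define \<sigma> where "\<sigma> x y = wpath (u x) (p x) (W x y) +++ flat (u y) (p x) (p y)" for x y
  have pd: "dist (p x) (p y) \<le> C * dist x y" if "x \<in> flat_union" "y \<in> flat_union" for x y
    using separated[OF up(1)[OF that(1)] up(1)[OF that(2)], of "p x" "p y"] up(2) that by simp
  have region_sub: "region (u x) (p x) s \<subseteq> flat_union \<inter> cball x (3 * C * s)" if x: "x \<in> flat_union" and s: "0 \<le> s" for x s
  proof -
    have "region (u x) (p x) s \<subseteq> flat_union"
      unfolding region_def flat_union_def using finite_size_mult[OF up(1)[OF x] box_finite_size] by blast
    then show ?thesis using region_cball[OF up(1)[OF x] s, of "p x"] up(2)[OF x] by simp
  qed
  have letters_mono: "letters q s \<subseteq> letters q t" if "s \<le> t" for q s t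
    using that by (auto simp: letters_def)
  have \<sigma>_in: "path_in (region (u x) (p x) s) x y (\<sigma> x y)"
    if xy: "x \<in> flat_union" "y \<in> flat_union" and s: "9 * (C * dist x y) \<le> s" for x y s
  proof -
    have Cd: "0 \<le> C * dist x y" using C by simp
    then have s0: "0 \<le> s" "dist (p x) (p y) \<le> s" using s pd[OF xy] by linarith+
    have Ws: "set (W x y) \<subseteq> letters (p x) s" using W(2)[OF xy] letters_mono[OF s] by blast
    have wv: "u x * val (W x y) = u y" by (simp add: W(1)[OF xy])
    have "region (u y) (p x) s = region (u x) (p x) s"
      using region_mult[OF val_box[OF Ws], of "u x"] by (simp add: wv)
    then show ?thesis
      using path_in_join[OF wpath_in[OF up(1)[OF xy(1)] Ws s0(1)], of _ "flat (u y) (p x) (p y)"]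
        flat_in[OF up(1)[OF xy(2)], of "p x" "p x" s "p y"] s0 up(2) xy
      by (simp add: \<sigma>_def wv)
  qed
  show "path_connected flat_union"
    unfolding path_connected_def
  proof (intro ballI)
    fix x y assume xy: "x \<in> flat_union" "y \<in> flat_union"
    have "path_in (region (u x) (p x) (9 * (C * dist x y))) x y (\<sigma> x y)" by (rule \<sigma>_in[OF xy]) simp
    then show "\<exists>g. path g \<and> path_image g \<subseteq> flat_union \<and> pathstart g = x \<and> pathfinish g = y"
      using region_sub[OF xy(1), of "9 * (C * dist x y)"] C unfolding path_in_def by (intro exI[of _ "\<sigma> x y"]) auto
  qed
  fix \<gamma> :: "real \<Rightarrow> 'b" assume \<gamma>: "path \<gamma>" "path_image \<gamma> \<subseteq> flat_union" "pathfinish \<gamma> = pathstart \<gamma>"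
  show "homotopic_paths flat_union (\<lambda>_. pathstart \<gamma>) \<gamma>"
  proof (rule nullhomotopic_if_triangles_fill[OF _ _ \<gamma>])
    show "pathstart (\<sigma> x y) = x \<and> pathfinish (\<sigma> x y) = y" if "x \<in> flat_union" "y \<in> flat_union" for x y
      using \<sigma>_in[OF that order_refl] by (simp add: path_in_def)
    fix x y z r assume xyz: "x \<in> flat_union" "y \<in> flat_union" "z \<in> flat_union" and r: "dist x y \<le> r" "dist y z \<le> r" "dist x z \<le> r"
    have r0: "0 \<le> r" using r(1) zero_le_dist order_trans by blast
    \<comment> \<open>Letters lie within \<open>9 C r\<close> of the start of their side, hence within \<open>10 C r\<close> of \<open>p x\<close>, and this must be \<open>R / 2\<close>.\<close>
    define R where "R = 20 * (C * r)"
    have Cr: "0 \<le> C * r" "C * dist x y \<le> C * r" "C * dist y z \<le> C * r" "C * dist x z \<le> C * r"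
      using C r r0 by (auto intro: mult_left_mono)
    have R: "0 \<le> R" using Cr by (simp add: R_def)
    let ?S = "region (u x) (p x) (9 * R)"
    have R2: "R / 2 = 10 * (C * r)" by (simp add: R_def)
    have p: "dist (p x) (p y) \<le> R / 2" "dist (p x) (p z) \<le> R / 2"
      using pd[OF xyz(1,2)] pd[OF xyz(1,3)] Cr unfolding R2 by linarith+
    have "9 * (C * dist x y) \<le> R / 2" "9 * (C * dist x z) \<le> R / 2"
      using Cr unfolding R2 by linarith+
    then have Wxy: "set (W x y) \<subseteq> letters (p x) (R / 2)" "set (W x z) \<subseteq> letters (p x) (R / 2)"
      using W(2)[OF xyz(1,2)] W(2)[OF xyz(1,3)] letters_mono subset_trans by blast+
    have Wyz: "set (W y z) \<subseteq> letters (p x) (R / 2)"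
    proof -
      have "dist (p x) (p y) + 9 * (C * dist y z) \<le> R / 2" using pd[OF xyz(1,2)] Cr unfolding R2 by linarith
      then show ?thesis using W(2)[OF xyz(2,3)] letters_shift by blast
    qed
    have v: "u x * val (W x y) = u y" "u x * val (W x z) = u z" "u y * val (W y z) = u z"
      "val (W x y @ W y z) = val (W x z)"
      using W(1) xyz by (simp_all add: mult.assoc)
    have big: "letters (p x) (R / 2) \<subseteq> letters (p x) (9 * R)" by (rule letters_mono) (use R in simp)
    have p9: "dist (p x) (p y) \<le> 9 * R" "dist (p x) (p z) \<le> 9 * R" using p R by auto
    have "homotopic_paths ?S (\<sigma> x y +++ \<sigma> y z) (wpath (u x) (p x) (W x y @ W y z) +++ flat (u z) (p x) (p z))"
      using wpath_flat_concat[OF up(1)[OF xyz(1)], of "W x y" "p x" "9 * R" "W y z" "p y" "p z"] Wxy Wyz big p9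
      by (auto simp: \<sigma>_def v)
    moreover have "homotopic_paths ?S (\<sigma> x z) (wpath (u x) (p x) (W x y @ W y z) +++ flat (u z) (p x) (p z))"
      unfolding \<sigma>_def
    proof (rule homotopic_join)
      show "homotopic_paths ?S (wpath (u x) (p x) (W x z)) (wpath (u x) (p x) (W x y @ W y z))"
        using wpath_homotopic_if_same_product[OF R up(1)[OF xyz(1)] Wxy(2), of "W x y @ W y z"] Wxy Wyz v(4) by simp
      show "path_in ?S (\<Phi> (u x) (p x)) (\<Phi> (u z) (p x)) (wpath (u x) (p x) (W x z))"
        using wpath_in[OF up(1)[OF xyz(1)], of "W x z" "p x" "9 * R"] Wxy(2) big R by (simp add: v)
      have "region (u z) (p x) (9 * R) = ?S"
        using region_mult[OF val_box[of "W x z" "p x" "9 * R"], of "u x"] Wxy(2) big by (simp add: v)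
      then show pz: "path_in ?S (\<Phi> (u z) (p x)) (\<Phi> (u z) (p z)) (flat (u z) (p x) (p z))"
        using flat_in[OF up(1)[OF xyz(3)], of "p x" "p x" "9 * R" "p z"] p9 R by simp
      show "homotopic_paths ?S (flat (u z) (p x) (p z)) (flat (u z) (p x) (p z))"
        by (rule homotopic_refl[OF pz])
    qed
    ultimately have h: "homotopic_paths ?S (\<sigma> x z) (\<sigma> x y +++ \<sigma> y z)"
      using homotopic_paths_trans homotopic_paths_sym by blast
    have "?S \<subseteq> flat_union \<inter> cball x ((540 * C * C) * r)"
      using region_sub[OF xyz(1), of "9 * R"] R by (simp add: R_def algebra_simps)
    with h show "homotopic_paths (flat_union \<inter> cball x ((540 * C * C) * r)) (\<sigma> x z) (\<sigma> x y +++ \<sigma> y z)"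
      by (rule homotopic_paths_subset)
  qed
qed

end

section \<open>Nondiscrete locally compact fields\<close>

text \<open>Continuity of the multiplication at the points \<open>(0, y)\<close>, made uniform in \<open>y\<close> by compactness.\<close>

lemma tube_at_zero:
  fixes K U :: "'k::topological_field set"
  assumes K: "compact K" and U: "open U" "0 \<in> U"
  obtains W where "open W" "0 \<in> W" "\<And>w y. w \<in> W \<Longrightarrow> y \<in> K \<Longrightarrow> w * y \<in> U"
proof -
  have "\<exists>A B. open A \<and> open B \<and> 0 \<in> A \<and> y \<in> B \<and> (\<forall>a\<in>A. \<forall>b\<in>B. a * b \<in> U)" for y
  proof -
    have "LIM x (nhds (0::'k) \<times>\<^sub>F nhds y). fst x * snd x :> nhds 0"
      using tendsto_mult_Pair[of "0::'k" y] by simp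
    then have "eventually (\<lambda>x. fst x * snd x \<in> U) (nhds (0::'k) \<times>\<^sub>F nhds y)"
      using U by (auto simp: filterlim_iff eventually_nhds)
    then obtain P R where "eventually P (nhds (0::'k))" "eventually R (nhds y)" "\<And>a b. P a \<Longrightarrow> R b \<Longrightarrow> a * b \<in> U"
      unfolding eventually_prod_filter by auto
    then show ?thesis unfolding eventually_nhds by meson
  qed
  then obtain A B where AB: "\<And>y. open (A y)" "\<And>y. open (B y)" "\<And>y. 0 \<in> A y" "\<And>y. y \<in> B y"
    "\<And>y a b. a \<in> A y \<Longrightarrow> b \<in> B y \<Longrightarrow> a * b \<in> U" by metis
  have "K \<subseteq> (\<Union>y\<in>K. B y)" using AB by auto
  then obtain T where T: "finite T" "K \<subseteq> (\<Union>y\<in>T. B y)"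
    using compactE_image[OF K, of K B] AB by metis
  show ?thesis
  proof
    show "open (\<Inter>y\<in>T. A y)" using T AB by auto
    show "0 \<in> (\<Inter>y\<in>T. A y)" using AB by auto
    fix w y assume w: "w \<in> (\<Inter>y\<in>T. A y)" and "y \<in> K"
    then obtain v where v: "v \<in> T" "y \<in> B v" using T(2) by blast
    show "w * y \<in> U" by (rule AB(5)[of _ v]) (use w v in auto)
  qed
qed

lemma continuous_on_inverse_field:
  fixes S :: "'k::topological_field set"
  shows "0 \<notin> S \<Longrightarrow> continuous_on S inverse"
  unfolding continuous_on_def
  by (metis filterlim_at_within_If at_within_le_nhds tendsto_inverse_nhds tendsto_mono)

lemma open_scale:
  fixes c :: "'k::topological_field"
  assumes "c \<noteq> 0" "open S"
  shows "open ((\<lambda>x. c * x) ` S)"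
proof -
  have "(\<lambda>x. c * x) ` S = (\<lambda>x. inverse c * x) -` S"
  proof (intro equalityI subsetI)
    fix x assume "x \<in> (\<lambda>x. inverse c * x) -` S"
    moreover have "x = c * (inverse c * x)" using assms(1) by simp
    ultimately show "x \<in> (\<lambda>x. c * x) ` S" by blast
  qed (use assms(1) in \<open>auto simp flip: mult.assoc\<close>)
  then show ?thesis
    using assms(2) continuous_on_open_vimage[of UNIV "\<lambda>x. inverse c * x"]
    by (auto intro!: continuous_intros)
qed

lemma not_open_zero:
  assumes "(euclidean :: 'k::topological_field topology) \<noteq> discrete_topology UNIV"
  shows "\<not> open {0::'k}"
proof
  assume o: "open {0::'k}"
  have "open {x}" for x :: 'k
  proof -
    have "{x} = (\<lambda>y. y - x) -` {0}" by auto
    then show ?thesis using o continuous_on_open_vimage[of UNIV "\<lambda>y. y - x"]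
      by (auto intro!: continuous_intros)
  qed
  then have "open S" for S :: "'k set"
    using open_UN[of S "\<lambda>x. {x}"] by simp
  then show False using assms by (auto simp: topology_eq open_openin[symmetric])
qed

text \<open>A compact neighbourhood \<open>C\<close> of zero which division by \<open>\<beta>\<close> maps into \<open>C - {1}\<close>. It takes the
  place of an absolute value: that the point \<open>1\<close> is left out already forces the powers of this map
  to contract \<open>C\<close> to zero (\<open>shrink_into\<close>).\<close>

locale contracting =
  fixes C :: "'k::{topological_field, t2_space} set" and \<beta> :: 'k
  assumes compact_C: "compact C" and zero_C: "0 \<in> interior C" and one_C: "1 \<in> C"
    and \<beta>_nz: "\<beta> \<noteq> 0" and contract: "\<And>c. c \<in> C \<Longrightarrow> c / \<beta> \<in> C \<and> c / \<beta> \<noteq> 1"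

text \<open>By \<open>tube_at_zero\<close>, all sufficiently small elements map \<open>C\<close> into \<open>C - {1}\<close>, and as the field is
  not discrete one of them is nonzero.\<close>

theorem contracting_exists:
  assumes "locally_compact_space (euclidean :: 'k::{topological_field, t2_space} topology)"
    and "(euclidean :: 'k topology) \<noteq> discrete_topology UNIV"
  shows "\<exists>C (\<beta>::'k). contracting C \<beta>"
proof -
  obtain U K where UK: "open U" "compact K" "(0::'k) \<in> U" "U \<subseteq> K"
    using assms(1) unfolding locally_compact_space_def by (simp flip: open_openin) meson
  define C where "C = insert 1 K"
  have C: "compact C" "0 \<in> interior C" "1 \<in> C"
    using UK interior_maximal[of U C] by (auto simp: C_def)
  have "open (interior C - {1})" "0 \<in> interior C - {1}" using C by auto
  then obtain W where W: "open W" "0 \<in> W" "\<And>w y. w \<in> W \<Longrightarrow> y \<in> C \<Longrightarrow> w * y \<in> interior C - {1}"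
    using tube_at_zero[OF C(1)] by metis
  have "W \<noteq> {0}" using not_open_zero[OF assms(2)] W(1) by auto
  then obtain w where w: "w \<in> W" "w \<noteq> 0" using W(2) by blast
  have "contracting C (inverse w)"
    using C w W(3) interior_subset[of C] by unfold_locales (force simp: divide_inverse mult.commute)+
  then show ?thesis by blast
qed

context contracting
begin

lemma shrink: "c \<in> C \<Longrightarrow> c / \<beta> ^ n \<in> C"
proof (induction n)
  case (Suc n)
  then have "c / \<beta> ^ n / \<beta> \<in> C" using contract by blast
  then show ?case by (simp add: field_simps)
qed simp

lemma shrink_ne_1: "c \<in> C \<Longrightarrow> 0 < n \<Longrightarrow> c / \<beta> ^ n \<noteq> 1"
proof -
  assume "c \<in> C" "0 < n"
  then obtain m where "n = Suc m" by (cases n) auto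
  then show ?thesis using contract[OF shrink[OF \<open>c \<in> C\<close>, of m]] by (simp add: field_simps)
qed

lemma compact_scale: "compact K \<Longrightarrow> compact ((\<lambda>x. c * x) ` K)" for c :: 'k
  by (intro compact_continuous_image continuous_intros)

text \<open>Let \<open>y\<close> be a cluster point of the orbit. If \<open>y\<close> is nonzero, quotients of members of the orbit near
  \<open>y\<close> come arbitrarily close to \<open>1\<close>, but some of these quotients are negative powers of \<open>\<beta>\<close>, which
  lie in the closed set \<open>C / \<beta>\<close> that omits \<open>1\<close>. If \<open>y = 0\<close>, multiplying members of the orbit
  near \<open>0\<close> by negative powers of \<open>\<beta>\<close>, which lie in \<open>C\<close>, gives points near zero, but also \<open>x\<close> itself.\<close>

lemma bounded_orbit_zero:
  assumes x: "\<And>n. \<beta> ^ n * x \<in> C"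
  shows "x = 0"
proof (rule ccontr)
  assume nz: "x \<noteq> 0"
  let ?F = "filtermap (\<lambda>n. \<beta> ^ n * x) sequentially"
  have "?F \<noteq> bot" by (simp add: filtermap_bot_iff)
  moreover have "eventually (\<lambda>y. y \<in> C) ?F" using x by (simp add: eventually_filtermap)
  ultimately obtain y where y: "y \<in> C" "inf (nhds y) ?F \<noteq> bot"
    using compact_C unfolding compact_filter by blast
  have freq: "\<exists>n\<ge>N. \<beta> ^ n * x \<in> V" if V: "open V" "y \<in> V" for V N
  proof (rule ccontr)
    assume "\<not> ?thesis"
    then have "eventually (\<lambda>y. y \<notin> V) ?F"
      unfolding eventually_filtermap eventually_sequentially by blast
    moreover have "eventually (\<lambda>y. y \<in> V) (nhds y)" using V by (auto simp: eventually_nhds)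
    ultimately have "eventually (\<lambda>_. False) (inf (nhds y) ?F)" unfolding eventually_inf by blast
    then show False using y by (simp add: trivial_limit_def)
  qed
  show False
  proof (cases "y = 0")
    case True
    obtain V where V: "open V" "0 \<in> V" "\<And>v c. v \<in> V \<Longrightarrow> c \<in> C \<Longrightarrow> v * c \<in> - {x}"
      using tube_at_zero[OF compact_C, of "- {x}"] nz by (metis ComplI closed_singleton open_Compl singletonD)
    obtain n where "\<beta> ^ n * x \<in> V" using freq[OF V(1)] V(2) True by blast
    then have "(\<beta> ^ n * x) * (1 / \<beta> ^ n) \<in> - {x}" using V(3) shrink[OF one_C] by blast
    then show False using \<beta>_nz by simp
  next
    case False
    let ?U = "- ((\<lambda>c. inverse \<beta> * c) ` C)"
    have U: "open ?U" using compact_imp_closed[OF compact_scale[OF compact_C]] by blast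
    have "1 \<in> ?U" using contract by (auto simp: divide_inverse mult.commute)
    moreover have "((\<lambda>z. fst z * inverse (snd z)) \<longlongrightarrow> y * inverse y) (nhds y \<times>\<^sub>F nhds y)"
      using False by (intro tendsto_mult filterlim_fst filterlim_compose[OF tendsto_inverse_nhds filterlim_snd])
    ultimately have "eventually (\<lambda>z. fst z * inverse (snd z) \<in> ?U) (nhds y \<times>\<^sub>F nhds y)"
      using U False by (intro topological_tendstoD[of _ "y * inverse y"]) auto
    then obtain P R where "eventually P (nhds y)" "eventually R (nhds y)" "\<And>a b. P a \<Longrightarrow> R b \<Longrightarrow> a * inverse b \<in> ?U"
      unfolding eventually_prod_filter by auto
    then obtain A B where AB: "open A" "y \<in> A" "open B" "y \<in> B"
        "\<And>a b. a \<in> A \<Longrightarrow> b \<in> B \<Longrightarrow> a * inverse b \<in> ?U"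
      unfolding eventually_nhds by meson
    obtain n where n: "\<beta> ^ n * x \<in> A" using freq[OF AB(1,2)] by blast
    obtain m where m: "m \<ge> Suc n" "\<beta> ^ m * x \<in> B" using freq[OF AB(3,4)] by blast
    then obtain i where i: "m = n + Suc i" using less_iff_Suc_add[of n m] by auto
    have "\<beta> ^ n * x * inverse (\<beta> ^ m * x) = inverse \<beta> * (1 / \<beta> ^ i)"
      using nz \<beta>_nz by (simp add: i power_add field_simps)
    moreover have "inverse \<beta> * (1 / \<beta> ^ i) \<in> (\<lambda>c. inverse \<beta> * c) ` C" by (rule imageI[OF shrink[OF one_C]])
    ultimately show False using AB(5)[OF n m(2)] by (simp only: Compl_iff simp_thms)
  qed
qed

text \<open>The decreasing compact sets \<open>C / \<beta>^n\<close> intersect in zero by \<open>bounded_orbit_zero\<close>.\<close>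

lemma shrink_into:
  assumes W: "open W" "0 \<in> W"
  obtains N where "\<And>c. c \<in> C \<Longrightarrow> c / \<beta> ^ N \<in> W"
proof -
  let ?A = "\<lambda>n. W \<union> - ((\<lambda>c. inverse (\<beta> ^ n) * c) ` C)"
  have o: "open (?A n)" for n
    using W compact_imp_closed[OF compact_scale[OF compact_C]] by blast
  have "C \<subseteq> (\<Union>n. ?A n)"
  proof
    fix x assume "x \<in> C"
    show "x \<in> (\<Union>n. ?A n)"
    proof (cases "x = 0")
      case False
      then obtain n where "\<beta> ^ n * x \<notin> C" using bounded_orbit_zero by blast
      then have "x \<in> ?A n" using \<beta>_nz by (auto simp: field_simps)
      then show ?thesis by blast
    qed (use W in auto)
  qed
  then obtain T where T: "finite T" "C \<subseteq> (\<Union>n\<in>T. ?A n)"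
    using compactE_image[OF compact_C, of UNIV ?A] o by (metis UNIV_I)
  define N where "N = Max (insert 0 T)"
  have "c / \<beta> ^ N \<in> W" if c: "c \<in> C" for c
  proof -
    have "c / \<beta> ^ N \<in> C" by (rule shrink[OF c])
    then obtain n where n: "n \<in> T" "c / \<beta> ^ N \<in> ?A n" using T by blast
    have "n \<le> N" using T n unfolding N_def by (intro Max_ge) auto
    then have "c / \<beta> ^ N = inverse (\<beta> ^ n) * (c / \<beta> ^ (N - n))"
      using \<beta>_nz by (simp add: field_simps flip: power_add)
    then show ?thesis using n shrink[OF c, of "N - n"] by blast
  qed
  then show ?thesis by (rule that)
qed

lemma absorb:
  assumes "compact K"
  shows "\<exists>n. \<forall>x\<in>K. x / \<beta> ^ n \<in> C"
proof -
  obtain W where W: "open W" "0 \<in> W" "\<And>w y. w \<in> W \<Longrightarrow> y \<in> K \<Longrightarrow> w * y \<in> interior C"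
    using tube_at_zero[OF assms open_interior zero_C] by metis
  obtain n where "\<And>c. c \<in> C \<Longrightarrow> c / \<beta> ^ n \<in> W" using shrink_into[OF W(1,2)] by blast
  then have "1 / \<beta> ^ n \<in> W" using one_C by blast
  then have "\<forall>x\<in>K. 1 / \<beta> ^ n * x \<in> interior C" using W(3) by blast
  then show ?thesis using interior_subset[of C] by (intro exI[of _ n]) auto
qed

text \<open>The elements of size at most \<open>m\<close>.\<close>

definition Lz :: "int \<Rightarrow> 'k set" where "Lz m = {x. x / \<beta> powi m \<in> C}"

lemma Lz_mono: "m \<le> n \<Longrightarrow> Lz m \<subseteq> Lz n"
proof
  fix x assume "m \<le> n" "x \<in> Lz m"
  then have "x / \<beta> powi m / \<beta> ^ nat (n - m) \<in> C" by (intro shrink) (simp add: Lz_def)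
  moreover have "\<beta> powi m * \<beta> ^ nat (n - m) = \<beta> powi n"
    using \<beta>_nz \<open>m \<le> n\<close> by (simp flip: power_int_of_nat power_int_add)
  ultimately show "x \<in> Lz n" by (simp add: Lz_def)
qed

text \<open>A compact set away from zero which plays the role of the units: every nonzero element is
  a power of \<open>\<beta>\<close> times an element of \<open>Q\<close>.\<close>

definition "Q = C - interior ((\<lambda>c. inverse \<beta> * c) ` C)"

lemma compact_Q: "compact Q" unfolding Q_def by (intro compact_diff compact_C open_interior)

lemma zero_Q: "0 \<notin> Q"
proof -
  have "open ((\<lambda>c. inverse \<beta> * c) ` interior C)" using \<beta>_nz by (intro open_scale) auto
  moreover have "(\<lambda>c. inverse \<beta> * c) ` interior C \<subseteq> (\<lambda>c. inverse \<beta> * c) ` C"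
    using interior_subset by blast
  moreover have "0 \<in> (\<lambda>c. inverse \<beta> * c) ` interior C" using zero_C by force
  ultimately show ?thesis unfolding Q_def using interior_maximal by blast
qed

text \<open>Multiply \<open>x\<close> by \<open>\<beta>\<close> until it is about to leave \<open>C\<close>.\<close>

lemma polar: assumes "x \<noteq> 0" obtains m :: int and b where "x = \<beta> powi m * b" "b \<in> Q"
proof -
  obtain n where n: "x / \<beta> ^ n \<in> C" using absorb[of "{x}"] by auto
  have "\<exists>N. \<beta> ^ N * (x / \<beta> ^ n) \<notin> C" using bounded_orbit_zero[of "x / \<beta> ^ n"] assms \<beta>_nz by auto
  define N where "N = (LEAST N. \<beta> ^ N * (x / \<beta> ^ n) \<notin> C)"
  have N: "\<beta> ^ N * (x / \<beta> ^ n) \<notin> C" unfolding N_def by (rule LeastI_ex) fact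
  then obtain M where M: "N = Suc M" using n by (cases N) auto
  define b where "b = \<beta> ^ M * (x / \<beta> ^ n)"
  have "b \<in> C" using not_less_Least[of M "\<lambda>N. \<beta> ^ N * (x / \<beta> ^ n) \<notin> C"] M unfolding N_def[symmetric] b_def by auto
  moreover have "b \<notin> (\<lambda>c. inverse \<beta> * c) ` C"
    using N \<beta>_nz by (auto simp: b_def M field_simps)
  ultimately have "b \<in> Q" unfolding Q_def using interior_subset by blast
  moreover have "x = \<beta> powi (int n - int M) * b"
    using \<beta>_nz by (simp add: b_def power_int_diff)
  ultimately show ?thesis using that by blast
qed

text \<open>One constant for the failure of \<open>C\<close> to be closed under the field operations.\<close>

definition "k = (SOME k. (\<forall>x\<in>C. \<forall>y\<in>C. (x + y) / \<beta> ^ k \<in> C) \<and> (\<forall>x\<in>C. (- x) / \<beta> ^ k \<in> C) \<and>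
   (\<forall>x\<in>C. \<forall>y\<in>C. (x * y) / \<beta> ^ k \<in> C) \<and> (\<forall>x\<in>Q. inverse x / \<beta> ^ k \<in> C))"

lemma k: "x \<in> C \<Longrightarrow> y \<in> C \<Longrightarrow> (x + y) / \<beta> ^ k \<in> C" "x \<in> C \<Longrightarrow> (- x) / \<beta> ^ k \<in> C"
   "x \<in> C \<Longrightarrow> y \<in> C \<Longrightarrow> (x * y) / \<beta> ^ k \<in> C" "x \<in> Q \<Longrightarrow> inverse x / \<beta> ^ k \<in> C"
proof -
  have K: "compact ((\<lambda>z. fst z + snd z) ` (C \<times> C) \<union> uminus ` C \<union> (\<lambda>z. fst z * snd z) ` (C \<times> C) \<union> inverse ` Q)"
    using compact_C compact_Q zero_Q
    by (intro compact_Un compact_continuous_image compact_Times continuous_on_inverse_field continuous_intros) auto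
  obtain n where n: "\<forall>x \<in> ((\<lambda>z. fst z + snd z) ` (C \<times> C) \<union> uminus ` C \<union> (\<lambda>z. fst z * snd z) ` (C \<times> C) \<union> inverse ` Q). x / \<beta> ^ n \<in> C"
    using absorb[OF K] by blast
  then have "\<exists>n. (\<forall>x\<in>C. \<forall>y\<in>C. (x + y) / \<beta> ^ n \<in> C) \<and> (\<forall>x\<in>C. (- x) / \<beta> ^ n \<in> C) \<and>
   (\<forall>x\<in>C. \<forall>y\<in>C. (x * y) / \<beta> ^ n \<in> C) \<and> (\<forall>x\<in>Q. inverse x / \<beta> ^ n \<in> C)"
    by (intro exI[of _ n]) (force simp: image_iff Bex_def)
  from someI_ex[OF this] show "x \<in> C \<Longrightarrow> y \<in> C \<Longrightarrow> (x + y) / \<beta> ^ k \<in> C" "x \<in> C \<Longrightarrow> (- x) / \<beta> ^ k \<in> C"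
   "x \<in> C \<Longrightarrow> y \<in> C \<Longrightarrow> (x * y) / \<beta> ^ k \<in> C" "x \<in> Q \<Longrightarrow> inverse x / \<beta> ^ k \<in> C"
    unfolding k_def[symmetric] by auto
qed

lemma powi_add: "\<beta> powi (m + n) = \<beta> powi m * \<beta> powi n"
  using \<beta>_nz by (simp add: power_int_add)

lemma Lz_add: "x \<in> Lz m \<Longrightarrow> y \<in> Lz m \<Longrightarrow> x + y \<in> Lz (m + int k)"
  using k(1)[of "x / \<beta> powi m" "y / \<beta> powi m"] by (simp add: Lz_def powi_add add_divide_distrib)

lemma Lz_minus: "x \<in> Lz m \<Longrightarrow> - x \<in> Lz (m + int k)"
  using k(2)[of "x / \<beta> powi m"] by (simp add: Lz_def powi_add)

lemma Lz_mult: "x \<in> Lz m \<Longrightarrow> y \<in> Lz n \<Longrightarrow> x * y \<in> Lz (m + n + int k)"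
  using k(3)[of "x / \<beta> powi m" "y / \<beta> powi n"] by (simp add: Lz_def powi_add)

definition L :: "real \<Rightarrow> 'k set" where "L t = Lz \<lfloor>t\<rfloor>"

lemma L_mono: "x \<in> L s \<Longrightarrow> s \<le> t \<Longrightarrow> x \<in> L t"
  unfolding L_def using Lz_mono[OF floor_mono] by blast

lemma L_0 [simp]: "0 \<in> L t"
  using zero_C interior_subset[of C] by (auto simp: L_def Lz_def)

lemma L_1: "1 \<in> L 0"
  using one_C by (simp add: L_def Lz_def)

text \<open>This is where sizes are bounded from below; it makes the exponent in \<open>L_polar\<close> unique up to a
  bounded error.\<close>

lemma one_L: assumes "1 \<in> L t" shows "0 \<le> t"
proof (rule ccontr)
  assume "\<not> 0 \<le> t"
  then obtain N where N: "\<lfloor>t\<rfloor> = - int N" "0 < N"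
    by (metis floor_less_zero neg_0_less_iff_less not_le zero_less_imp_eq_int minus_minus)
  then have "\<beta> ^ N \<in> C"
    using assms by (simp add: L_def Lz_def power_int_minus divide_inverse)
  from shrink_ne_1[OF this N(2)] show False using \<beta>_nz by simp
qed

lemma L_add: "x \<in> L t \<Longrightarrow> y \<in> L t \<Longrightarrow> x + y \<in> L (t + real k)"
  using Lz_add[of x "\<lfloor>t\<rfloor>" y] by (simp add: L_def)

lemma L_minus: "x \<in> L t \<Longrightarrow> - x \<in> L (t + real k)"
  using Lz_minus[of x "\<lfloor>t\<rfloor>"] by (simp add: L_def)

lemma L_mult: assumes "x \<in> L s" "y \<in> L t" shows "x * y \<in> L (s + t + real k)"
proof -
  have "\<lfloor>s\<rfloor> + \<lfloor>t\<rfloor> + int k \<le> \<lfloor>s + t + real k\<rfloor>" by linarith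
  then show ?thesis using Lz_mono Lz_mult[of x "\<lfloor>s\<rfloor>" y "\<lfloor>t\<rfloor>"] assms unfolding L_def by blast
qed

lemma L_pow: "\<beta> powi m \<in> L (real_of_int m)"
  using one_C \<beta>_nz by (simp add: L_def Lz_def)

lemma L_compact: assumes "compact K" obtains t where "0 \<le> t" "K \<subseteq> L t"
proof -
  obtain n where "\<forall>x\<in>K. x / \<beta> ^ n \<in> C" using absorb[OF assms] by blast
  then have "K \<subseteq> L (real n)" by (auto simp: L_def Lz_def)
  then show ?thesis by (intro that[of "real n"]) simp_all
qed

lemma L_polar:
  assumes "x \<noteq> 0"
  obtains m :: int and b where "x = \<beta> powi m * b" "b \<in> Q" "x \<in> L m" "inverse x \<in> L (real k - m)"
proof -
  obtain m b where mb: "x = \<beta> powi m * b" "b \<in> Q" using polar[OF assms] .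
  have "b \<in> C" using mb(2) by (simp add: Q_def)
  then have "x \<in> L m" using \<beta>_nz by (simp add: L_def Lz_def mb(1))
  moreover have "inverse x / \<beta> powi (int k - m) = inverse b / \<beta> ^ k"
    using \<beta>_nz by (simp add: mb(1) power_int_diff field_simps)
  then have "inverse x \<in> L (real k - m)" using k(4)[OF mb(2)] by (simp add: L_def Lz_def)
  ultimately show ?thesis using that mb by blast
qed

end

section \<open>Words and coordinates in the matrix group\<close>

context group
begin

definition word_product :: "'a list \<Rightarrow> 'a" where "word_product xs = foldr (\<otimes>) xs \<one>"

lemma word_product_simps [simp]: "word_product [] = \<one>" "word_product (x # xs) = x \<otimes> word_product xs"
  by (simp_all add: word_product_def)

lemma word_product_closed: "set xs \<subseteq> carrier G \<Longrightarrow> word_product xs \<in> carrier G"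
  by (induction xs) auto

lemma word_product_append:
  "set xs \<subseteq> carrier G \<Longrightarrow> set ys \<subseteq> carrier G \<Longrightarrow> word_product (xs @ ys) = word_product xs \<otimes> word_product ys"
  by (induction xs) (auto simp: word_product_closed m_assoc)

lemma word_length_le:
  "set xs \<subseteq> S \<union> m_inv G ` S \<Longrightarrow> word_length G S (word_product xs) \<le> length xs"
  unfolding word_length_def word_product_def by (rule Least_le) auto

context
  fixes S
  assumes S: "S \<subseteq> carrier G" and gen: "generate G S = carrier G"
begin

abbreviation "len \<equiv> word_length G S"

lemma word_length_attained:
  assumes "g \<in> carrier G"
  obtains xs where "length xs = len g" "set xs \<subseteq> S \<union> m_inv G ` S" "g = word_product xs"
proof -
  have T: "S \<union> m_inv G ` S \<subseteq> carrier G" using S by auto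
  have "\<exists>xs. set xs \<subseteq> S \<union> m_inv G ` S \<and> g = word_product xs" if "g \<in> generate G S" for g
    using that
  proof induction
    case one then show ?case by (intro exI[of _ "[]"]) simp
  next
    case (incl h) then show ?case using S by (intro exI[of _ "[h]"]) auto
  next
    case (inv h) then show ?case using S by (intro exI[of _ "[inv h]"]) auto
  next
    case (eng h1 h2)
    then obtain xs ys where "set xs \<subseteq> S \<union> m_inv G ` S" "h1 = word_product xs"
      "set ys \<subseteq> S \<union> m_inv G ` S" "h2 = word_product ys" by blast
    moreover from this have "word_product (xs @ ys) = word_product xs \<otimes> word_product ys"
      using T by (intro word_product_append) blast+
    ultimately show ?case by (intro exI[of _ "xs @ ys"]) auto
  qed
  then have "\<exists>n xs. length xs = n \<and> set xs \<subseteq> S \<union> m_inv G ` S \<and> g = word_product xs"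
    using assms gen by auto
  from LeastI_ex[OF this] show ?thesis
    using that unfolding word_length_def word_product_def by auto
qed

lemma len_one [simp]: "len \<one> = 0"
  using word_length_le[of "[]" S] by simp

lemma len_mult: assumes "g \<in> carrier G" "h \<in> carrier G" shows "len (g \<otimes> h) \<le> len g + len h"
proof -
  interpret Metric_space "carrier G" "word_dist G S" by (rule Metric_space_word_dist[OF S gen])
  have "inv g \<otimes> (g \<otimes> h) = h" using assms by (simp flip: m_assoc)
  then show ?thesis
    using triangle[of \<one> g "g \<otimes> h"] assms by (simp add: word_dist_def)
qed

lemma len_inv: assumes "g \<in> carrier G" shows "len (inv g) = len g"
proof -
  interpret Metric_space "carrier G" "word_dist G S" by (rule Metric_space_word_dist[OF S gen])
  show ?thesis using commute[of g \<one>] assms by (simp add: word_dist_def)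
qed

end

end

text \<open>The matrix of \<open>u\<close> times the diagonal matrix \<open>(1, s, t, 1)\<close>.\<close>

definition udiag :: "'k::field \<Rightarrow> 'k \<Rightarrow> 'k uni \<Rightarrow> 'k ^ 4 ^ 4" where
  "udiag s t u = (\<chi> i j. if i = 1 then if j = 1 then 1 else if j = 2 then e12 u * s else if j = 3 then e13 u * t else e14 u
     else if i = 2 then if j = 1 then 0 else if j = 2 then s else if j = 3 then e23 u * t else e24 u
     else if i = 3 then if j = 3 then t else if j = 4 then e34 u else 0
     else if j = 4 then 1 else 0)"

lemma udiag_entries [simp]:
  "udiag s t u $ 1 $ 1 = 1" "udiag s t u $ 1 $ 2 = e12 u * s" "udiag s t u $ 1 $ 3 = e13 u * t" "udiag s t u $ 1 $ 4 = e14 u"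
  "udiag s t u $ 2 $ 1 = 0" "udiag s t u $ 2 $ 2 = s" "udiag s t u $ 2 $ 3 = e23 u * t" "udiag s t u $ 2 $ 4 = e24 u"
  "udiag s t u $ 3 $ 1 = 0" "udiag s t u $ 3 $ 2 = 0" "udiag s t u $ 3 $ 3 = t" "udiag s t u $ 3 $ 4 = e34 u"
  "udiag s t u $ 4 $ 1 = 0" "udiag s t u $ 4 $ 2 = 0" "udiag s t u $ 4 $ 3 = 0" "udiag s t u $ 4 $ 4 = 1"
  unfolding udiag_def by simp_all

text \<open>Conjugation by the diagonal matrix \<open>(1, s, t, 1)\<close>.\<close>

definition twist :: "'k::field \<Rightarrow> 'k \<Rightarrow> 'k uni \<Rightarrow> 'k uni" where
  "twist s t v = Uni (e12 v / s) (e13 v / t) (e14 v) (s * e23 v / t) (s * e24 v) (t * e34 v)"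

lemma mat_eq_iff4: "x = y \<longleftrightarrow> (\<forall>i j. x $ i $ j = y $ i $ j)" for x y :: "'k ^ 4 ^ 4"
  by (simp add: vec_eq_iff)

lemma udiag_mult:
  assumes "s \<noteq> 0" "t \<noteq> 0"
  shows "udiag s t u ** udiag s' t' v = udiag (s * s') (t * t') (u * twist s t v)"
  using assms
  by (simp add: mat_eq_iff4 forall_4 matrix_matrix_mult_def sum_4 twist_def times_uni_def field_simps)

lemma udiag_one: "udiag 1 1 1 = (mat 1 :: 'k::field ^ 4 ^ 4)"
  by (simp add: mat_eq_iff4 forall_4 mat_def one_uni_def)

lemma udiag_carrier [simp]: "udiag s t u \<in> carrier A4 \<longleftrightarrow> s \<noteq> 0 \<and> t \<noteq> 0"
  by (simp add: A4_def A4_carrier_def dvd_field_iff)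

definition diag2 :: "'k::field ^ 4 ^ 4 \<Rightarrow> 'k" where "diag2 x = x $ 2 $ 2"
definition diag3 :: "'k::field ^ 4 ^ 4 \<Rightarrow> 'k" where "diag3 x = x $ 3 $ 3"
definition unipotent_part :: "'k::field ^ 4 ^ 4 \<Rightarrow> 'k uni" where
  "unipotent_part x = Uni (x $ 1 $ 2 / x $ 2 $ 2) (x $ 1 $ 3 / x $ 3 $ 3) (x $ 1 $ 4) (x $ 2 $ 3 / x $ 3 $ 3) (x $ 2 $ 4) (x $ 3 $ 4)"

lemma A4_coords:
  assumes "x \<in> carrier (A4 :: ('k::field ^ 4 ^ 4) monoid)"
  shows "diag2 x \<noteq> 0" "diag3 x \<noteq> 0" "udiag (diag2 x) (diag3 x) (unipotent_part x) = x"
  using assms by (auto simp: A4_def A4_carrier_def dvd_field_iff mat_eq_iff4 forall_4 diag2_def diag3_def unipotent_part_def)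

lemma coords_udiag [simp]: "diag2 (udiag s t u) = s" "diag3 (udiag s t u) = t" "s \<noteq> 0 \<Longrightarrow> t \<noteq> 0 \<Longrightarrow> unipotent_part (udiag s t u) = u"
  by (cases u; simp add: diag2_def diag3_def unipotent_part_def)+

lemma A4_mult: "x \<otimes>\<^bsub>A4\<^esub> y = x ** y" and A4_one: "\<one>\<^bsub>A4\<^esub> = udiag 1 1 1"
  by (simp_all add: A4_def udiag_one)

lemma twist_mult: "s \<noteq> 0 \<Longrightarrow> t \<noteq> 0 \<Longrightarrow> twist s t (u * v) = twist s t u * twist s t v"
  by (simp add: twist_def times_uni_def field_simps)

lemma twist_one [simp]: "twist s t 1 = 1" "twist 1 1 u = u"
  by (cases u; simp add: twist_def one_uni_def)+

lemma A4_inv: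
  assumes "s \<noteq> 0" "t \<noteq> 0"
  shows "inv\<^bsub>A4\<^esub> (udiag s t u) = udiag (inverse s) (inverse t) (twist (inverse s) (inverse t) (uinv u))"
proof -
  interpret group "A4 :: ('a ^ 4 ^ 4) monoid" by (rule group_A4)
  show ?thesis
    by (rule inv_equality)
      (use assms in \<open>simp_all add: A4_mult A4_one udiag_mult flip: twist_mult\<close>)
qed

text \<open>The elementary matrices, both for entries off the diagonal and for diagonal ones, so that one
  category argument serves the additive and the multiplicative one-parameter groups.\<close>

definition ent :: "4 \<Rightarrow> 4 \<Rightarrow> 'k::field \<Rightarrow> 'k ^ 4 ^ 4" where
  "ent a b x = (\<chi> i j. if i = a \<and> j = b then x else mat 1 $ i $ j)"

lemma ent_entry: "ent a b x $ i $ j = (if i = a \<and> j = b then x else if i = j then 1 else 0)"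
  by (auto simp: ent_def mat_def)

lemma ent_udiag:
  "ent 1 2 x = udiag 1 1 (Uni x 0 0 0 0 0)" "ent 1 3 x = udiag 1 1 (Uni 0 x 0 0 0 0)"
  "ent 2 3 x = udiag 1 1 (Uni 0 0 0 x 0 0)" "ent 2 4 x = udiag 1 1 (Uni 0 0 0 0 x 0)"
  "ent 3 4 x = udiag 1 1 (Uni 0 0 0 0 0 x)" "ent 2 2 x = udiag x 1 1" "ent 3 3 x = udiag 1 x 1"
  by (simp_all add: mat_eq_iff4 forall_4 ent_entry one_uni_def)

lemma continuous_on_matrix_mult:
  fixes f g :: "'x::topological_space \<Rightarrow> 'k::topological_field ^ 4 ^ 4"
  shows "continuous_on X f \<Longrightarrow> continuous_on X g \<Longrightarrow> continuous_on X (\<lambda>x. f x ** g x)"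
  unfolding matrix_matrix_mult_def sum_4 by (intro continuous_intros)

lemma continuous_on_udiag:
  fixes s t :: "'x::topological_space \<Rightarrow> 'k::topological_field"
  assumes "continuous_on X s" "continuous_on X t" "continuous_on X (\<lambda>x. e12 (u x))" "continuous_on X (\<lambda>x. e13 (u x))"
    "continuous_on X (\<lambda>x. e14 (u x))" "continuous_on X (\<lambda>x. e23 (u x))" "continuous_on X (\<lambda>x. e24 (u x))" "continuous_on X (\<lambda>x. e34 (u x))"
  shows "continuous_on X (\<lambda>x. udiag (s x) (t x) (u x))"
proof -
  have *: "continuous_on X (\<lambda>x. udiag (s x) (t x) (u x) $ i $ j)" for i j
    using exhaust_4[of i] exhaust_4[of j] by (elim disjE; simp add: assms continuous_on_mult')
  have "continuous_on X (\<lambda>x. \<chi> i j. udiag (s x) (t x) (u x) $ i $ j)"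
    by (intro continuous_on_vec_lambda *)
  then show ?thesis by simp
qed

lemma continuous_on_coords:
  fixes X :: "('k::topological_field ^ 4 ^ 4) set"
  assumes "X \<subseteq> carrier A4"
  shows "continuous_on X diag2" "continuous_on X diag3" "continuous_on X (\<lambda>x. inverse (diag2 x))" "continuous_on X (\<lambda>x. inverse (diag3 x))"
    "continuous_on X (\<lambda>x. e12 (unipotent_part x))" "continuous_on X (\<lambda>x. e13 (unipotent_part x))" "continuous_on X (\<lambda>x. e14 (unipotent_part x))"
    "continuous_on X (\<lambda>x. e23 (unipotent_part x))" "continuous_on X (\<lambda>x. e24 (unipotent_part x))" "continuous_on X (\<lambda>x. e34 (unipotent_part x))"
proof -
  have c: "continuous_on X diag2" "continuous_on X diag3"
    unfolding diag2_def diag3_def by (intro continuous_intros)+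
  have i: "continuous_on X (\<lambda>x. inverse (diag2 x))" "continuous_on X (\<lambda>x. inverse (diag3 x))"
    using A4_coords(1,2) assms
    by (auto intro!: continuous_on_compose2[OF continuous_on_inverse_field c(1), of "- {0}"]
        continuous_on_compose2[OF continuous_on_inverse_field c(2), of "- {0}"])
  show "continuous_on X diag2" "continuous_on X diag3" "continuous_on X (\<lambda>x. inverse (diag2 x))" "continuous_on X (\<lambda>x. inverse (diag3 x))"
    by (fact c i)+
  show "continuous_on X (\<lambda>x. e12 (unipotent_part x))" "continuous_on X (\<lambda>x. e13 (unipotent_part x))" "continuous_on X (\<lambda>x. e14 (unipotent_part x))"
    "continuous_on X (\<lambda>x. e23 (unipotent_part x))" "continuous_on X (\<lambda>x. e24 (unipotent_part x))" "continuous_on X (\<lambda>x. e34 (unipotent_part x))"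
    using i by (auto simp: unipotent_part_def divide_inverse diag2_def diag3_def intro!: continuous_intros)
qed

lemma continuous_on_A4_inv:
  fixes X :: "('k::topological_field ^ 4 ^ 4) set"
  assumes "X \<subseteq> carrier A4"
  shows "continuous_on X (\<lambda>x. inv\<^bsub>A4\<^esub> x)"
proof -
  have "continuous_on X (\<lambda>x. udiag (inverse (diag2 x)) (inverse (diag3 x)) (twist (inverse (diag2 x)) (inverse (diag3 x)) (uinv (unipotent_part x))))"
    using continuous_on_coords[OF assms]
    by (intro continuous_on_udiag) (auto simp: twist_def uinv_def divide_inverse intro!: continuous_intros)
  then show ?thesis
  proof (rule continuous_on_eq)
    fix x assume "x \<in> X"
    then have x: "x \<in> carrier A4" using assms by blast
    show "udiag (inverse (diag2 x)) (inverse (diag3 x)) (twist (inverse (diag2 x)) (inverse (diag3 x)) (uinv (unipotent_part x))) = inv\<^bsub>A4\<^esub> x"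
      using A4_inv[OF A4_coords(1,2)[OF x], of "unipotent_part x"] A4_coords(3)[OF x] by simp
  qed
qed

text \<open>From here on word length refers to the given compact generating set \<open>S\<close>.\<close>

locale A4_generated = contracting C \<beta> for C and \<beta> :: "'k::{topological_field, t2_space}" +
  fixes S :: "('k ^ 4 ^ 4) set"
  assumes lc: "locally_compact_space (euclidean :: 'k topology)"
    and nondiscrete: "(euclidean :: 'k topology) \<noteq> discrete_topology UNIV"
    and S: "S \<subseteq> carrier A4" "compact S" "generate A4 S = carrier A4"
begin

interpretation A4: group "A4 :: ('k ^ 4 ^ 4) monoid" by (rule group_A4)

abbreviation "wl \<equiv> word_length (A4 :: ('k ^ 4 ^ 4) monoid) S"

lemmas len = A4.len_mult[OF S(1,3), unfolded A4_mult] A4.len_inv[OF S(1,3)]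

definition "T = {mat 1} \<union> (S \<union> m_inv A4 ` S)"

lemma compact_T: "compact T"
  unfolding T_def
  by (intro compact_Un finite_imp_compact S(2) compact_continuous_image[OF continuous_on_A4_inv[OF S(1)]]) simp

fun ball_set :: "nat \<Rightarrow> ('k ^ 4 ^ 4) set" where
  "ball_set 0 = {mat 1}"
| "ball_set (Suc n) = (\<lambda>z. fst z ** snd z) ` (T \<times> ball_set n)"

lemma compact_ball_set: "compact (ball_set n)"
  by (induction n) (auto intro!: compact_continuous_image compact_Times compact_T continuous_on_matrix_mult continuous_intros)

lemma ball_set_len: "x \<in> ball_set n \<Longrightarrow> x \<in> carrier A4 \<and> wl x \<le> n"
proof (induction n arbitrary: x)
  case 0
  then show ?case using A4.len_one[OF S(1,3)] by (simp add: A4_one udiag_one[symmetric])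
next
  case (Suc n)
  then obtain y z where yz: "x = y ** z" "y \<in> T" "z \<in> ball_set n" by auto
  have "y \<in> carrier A4" "wl y \<le> 1"
  proof -
    have one: "(mat 1 :: 'k ^ 4 ^ 4) \<in> carrier A4" "wl (mat 1) = 0"
      using A4.len_one[OF S(1,3)] by (simp_all add: A4_one udiag_one[symmetric])
    show c: "y \<in> carrier A4" using yz(2) S(1) one by (auto simp: T_def)
    show "wl y \<le> 1"
    proof (cases "y = mat 1")
      case False
      then have "set [y] \<subseteq> S \<union> m_inv A4 ` S" using yz(2) by (auto simp: T_def)
      from A4.word_length_le[OF this] c show ?thesis by simp
    qed (use one in simp)
  qed
  then show ?case using Suc.IH[OF yz(3)] len(1)[of y z] A4.m_closed[of y z] by (simp add: yz A4_mult)
qed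

lemma ball_set_ex: assumes "x \<in> carrier A4" shows "\<exists>n. x \<in> ball_set n"
proof -
  obtain xs where xs: "set xs \<subseteq> S \<union> m_inv A4 ` S" "x = A4.word_product xs"
    using A4.word_length_attained[OF S(1,3) assms] by metis
  have "A4.word_product xs \<in> ball_set (length xs)"
    using xs(1)
  proof (induction xs)
    case Nil
    then show ?case by (simp add: A4_one udiag_one)
  next
    case (Cons y ys)
    then show ?case by (force simp: A4_mult T_def)
  qed
  then show ?thesis using xs by blast
qed

text \<open>Baire's theorem: the parameters of the elementary matrices in \<open>ball_set n\<close> form compact sets that
  cover all nonzero parameters, so one of them has interior points. Compactness comes from reading off
  one entry of a compact set of matrices.\<close>

lemma ent_interior:
  assumes "\<And>x::'k. x \<noteq> 0 \<Longrightarrow> ent a b x \<in> carrier A4"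
  obtains n V where "open V" "V \<noteq> {}" "0 \<notin> V" "\<And>x. x \<in> V \<Longrightarrow> wl (ent a b x) \<le> n"
proof -
  define F where "F n = (\<lambda>m. m $ a $ b) ` (ball_set n \<inter> {m. \<forall>i j. m $ i $ j \<in> (if i = a \<and> j = b then UNIV else {mat 1 $ i $ j})})" for n
  have Fx: "ent a b x \<in> ball_set n" if x: "x \<in> F n" for x n
  proof -
    obtain m where m: "m \<in> ball_set n" "x = m $ a $ b"
      "\<And>i j. m $ i $ j \<in> (if i = a \<and> j = b then UNIV else {mat 1 $ i $ j})"
      using x by (auto simp: F_def)
    have "m $ i $ j = mat 1 $ i $ j" if "\<not> (i = a \<and> j = b)" for i j
      using m(3)[of i j] that by (simp split: if_splits)
    then have "m = ent a b x" using m(2) unfolding mat_eq_iff4 ent_def by simp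
    then show ?thesis using m by simp
  qed
  have "closed (F n)" for n
  proof -
    have "closed {m :: 'k ^ 4 ^ 4. \<forall>i j. m $ i $ j \<in> (if i = a \<and> j = b then UNIV else {mat 1 $ i $ j})}"
    proof (intro closed_Collect_all)
      fix i j
      have "closed ((\<lambda>m :: 'k ^ 4 ^ 4. m $ i $ j) -` (if i = a \<and> j = b then UNIV else {mat 1 $ i $ j}))"
        by (rule continuous_on_closed_vimage[THEN iffD1, rule_format, of UNIV, simplified]) (auto intro!: continuous_intros)
      then show "closed {m :: 'k ^ 4 ^ 4. m $ i $ j \<in> (if i = a \<and> j = b then UNIV else {mat 1 $ i $ j})}"
        by (simp add: vimage_def)
    qed
    then show ?thesis
      unfolding F_def
      by (intro compact_imp_closed compact_continuous_image compact_Int_closed compact_ball_set continuous_intros)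
  qed
  have cover: "(\<Union>n. F n) \<union> {0} = UNIV"
  proof -
    have "x \<in> (\<Union>n. F n)" if nz: "x \<noteq> 0" for x
    proof -
      obtain n where "ent a b x \<in> ball_set n" using ball_set_ex[OF assms[OF nz]] by blast
      then have "x \<in> F n" unfolding F_def
        by (intro image_eqI[of _ _ "ent a b x"]) (auto simp: ent_def)
      then show ?thesis by blast
    qed
    then show ?thesis by blast
  qed
  have "\<exists>n. interior (F n) \<noteq> {}"
  proof (rule ccontr)
    assume *: "\<not> ?thesis"
    have "Hausdorff_space (euclidean :: 'k topology)"
      unfolding Hausdorff_space_def disjnt_def using hausdorff by (simp flip: open_openin) blast
    then have "regular_space (euclidean :: 'k topology)"
      using lc locally_compact_Hausdorff_imp_regular_space by blast
    then have "euclidean interior_of \<Union>(insert {0} (range F)) = {}"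
    proof (intro Baire_category_alt disjI2 conjI lc)
      show "countable (insert {0} (range F))" by simp
      fix X assume X: "X \<in> insert {0} (range F)"
      show "closedin euclidean X" using X \<open>\<And>n. closed (F n)\<close> by auto
      \<comment> \<open>The parameter zero has to be added to the cover, but contributes no interior since the field is not discrete.\<close>
      have "interior {0::'k} = {}"
        using not_open_zero[OF nondiscrete] interior_subset[of "{0::'k}"] open_interior[of "{0::'k}"]
        by (metis subset_singletonD)
      then show "euclidean interior_of X = {}" using X * by auto
    qed
    moreover have "\<Union>(insert {0} (range F)) = UNIV" using cover by auto
    ultimately show False by simp
  qed
  then obtain n where n: "interior (F n) \<noteq> {}" by blast
  show ?thesis
  proof (rule that)
    show "open (interior (F n) - {0})" by auto
    show "interior (F n) - {0} \<noteq> {}"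
      using n not_open_zero[OF nondiscrete] open_interior[of "F n"] by (metis Diff_eq_empty_iff subset_singletonD)
    show "0 \<notin> interior (F n) - {0}" by simp
    show "wl (ent a b x) \<le> n" if "x \<in> interior (F n) - {0}" for x
      using ball_set_len[OF Fx[of x n]] interior_subset[of "F n"] that by auto
  qed
qed

lemma locally_bounded_compact:
  assumes K: "compact K" and loc: "\<And>q. q \<in> K \<Longrightarrow> \<exists>N (c::nat). open N \<and> q \<in> N \<and> (\<forall>y\<in>N. f y \<le> c)"
  shows "\<exists>c. \<forall>y\<in>K. f y \<le> c"
proof -
  obtain N c where N: "\<And>q. q \<in> K \<Longrightarrow> open (N q) \<and> q \<in> N q \<and> (\<forall>y\<in>N q. f y \<le> (c q :: nat))"
    using loc by metis
  have "K \<subseteq> (\<Union>q\<in>K. N q)" using N by auto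
  then obtain D where D: "D \<subseteq> K" "finite D" "K \<subseteq> (\<Union>q\<in>D. N q)"
    using compactE_image[OF K, of K N] N by metis
  have "f y \<le> (\<Sum>q\<in>D. c q)" if y: "y \<in> K" for y
  proof -
    obtain q where q: "q \<in> D" "y \<in> N q" using D(3) y by blast
    then have "f y \<le> c q" using N D by blast
    also have "\<dots> \<le> (\<Sum>q\<in>D. c q)" using D q by (intro member_le_sum) auto
    finally show ?thesis .
  qed
  then show ?thesis by blast
qed

text \<open>An open set of parameters of bounded word length has translates that cover \<open>K\<close>.\<close>

lemma additive_bounded:
  assumes carr: "\<And>x::'k. ent a b x \<in> carrier A4" and add: "\<And>x y::'k. ent a b x ** ent a b y = ent a b (x + y)" and K: "compact K"
  shows "\<exists>c. \<forall>y\<in>K. wl (ent a b y) \<le> c"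
proof (rule locally_bounded_compact[OF K])
  fix q
  obtain n V where V: "open V" "V \<noteq> {}" "\<And>x. x \<in> V \<Longrightarrow> wl (ent a b x) \<le> n"
    using ent_interior[of a b] carr by metis
  obtain v where v: "v \<in> V" using V by blast
  let ?N = "(\<lambda>y. y - q + v) -` V"
  have "open ?N" using V(1) continuous_on_open_vimage[of UNIV "\<lambda>y. y - q + v"] by (auto intro!: continuous_intros)
  moreover have "wl (ent a b y) \<le> n + wl (ent a b (q - v))" if "y \<in> ?N" for y
  proof -
    have "ent a b y = ent a b (y - q + v) ** ent a b (q - v)" by (simp add: add)
    then show ?thesis using len(1)[OF carr carr, of "y - q + v" "q - v"] V(3)[of "y - q + v"] that by simp
  qed
  ultimately show "\<exists>N c. open N \<and> q \<in> N \<and> (\<forall>y\<in>N. wl (ent a b y) \<le> c)"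
    using v by (intro exI[of _ ?N] exI[of _ "n + wl (ent a b (q - v))"]) auto
qed

lemma multiplicative_bounded:
  assumes carr: "\<And>x::'k. x \<noteq> 0 \<Longrightarrow> ent a b x \<in> carrier A4" and mult: "\<And>x y::'k. ent a b x ** ent a b y = ent a b (x * y)"
    and K: "compact K" "0 \<notin> K"
  shows "\<exists>c. \<forall>y\<in>K. wl (ent a b y) \<le> c"
proof (rule locally_bounded_compact[OF K(1)])
  fix q assume "q \<in> K"
  then have q: "q \<noteq> 0" using K by auto
  obtain n V where V: "open V" "V \<noteq> {}" "0 \<notin> V" "\<And>x. x \<in> V \<Longrightarrow> wl (ent a b x) \<le> n"
    using ent_interior[of a b] carr by metis
  obtain v where v: "v \<in> V" "v \<noteq> 0" using V by blast
  let ?N = "(\<lambda>y. (v / q) * y) -` V"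
  have "continuous_on UNIV (\<lambda>y. (v / q) * y)"
    by (intro continuous_on_mult' continuous_on_const continuous_on_id)
  then have "open ?N" using V(1) by (auto intro: open_vimage)
  moreover have "wl (ent a b y) \<le> n + wl (ent a b (q / v))" if y: "y \<in> ?N" for y
  proof -
    have "ent a b y = ent a b (v / q * y) ** ent a b (q / v)" using q v by (simp add: mult)
    moreover have "v / q * y \<noteq> 0" "q / v \<noteq> 0" using y V(3) q v by auto
    ultimately show ?thesis using len(1)[OF carr carr, of "v / q * y" "q / v"] V(4)[of "v / q * y"] y by simp
  qed
  ultimately show "\<exists>N c. open N \<and> q \<in> N \<and> (\<forall>y\<in>N. wl (ent a b y) \<le> c)"
    using v q by (intro exI[of _ ?N] exI[of _ "n + wl (ent a b (q / v))"]) auto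
qed

end

section \<open>Word length and size of the coordinates\<close>

context A4_generated begin

interpretation A4: group "A4 :: ('k ^ 4 ^ 4) monoid" by (rule group_A4)

lemma udiag_uni_mult: "udiag 1 1 u ** udiag 1 1 v = udiag 1 1 (u * v)" for u v :: "'k uni"
  by (simp add: udiag_mult)

lemma len_uni_mult: "wl (udiag 1 1 (u * v)) \<le> wl (udiag 1 1 u) + wl (udiag 1 1 v)"
  using len(1)[of "udiag 1 1 u" "udiag 1 1 v"] by (simp add: udiag_uni_mult)

lemma len_uni_uinv: "wl (udiag 1 1 (uinv u)) = wl (udiag 1 1 u)"
  using len(2)[of "udiag 1 1 u"] by (simp add: A4_inv)

lemma len_diag_inv: "s \<noteq> 0 \<Longrightarrow> t \<noteq> 0 \<Longrightarrow> wl (udiag (inverse s) (inverse t) 1) = wl (udiag s t 1)"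
  using len(2)[of "udiag s t 1"] by (simp add: A4_inv uinv_def one_uni_def twist_def)

lemma len_diag_mult:
  "s \<noteq> 0 \<Longrightarrow> t \<noteq> 0 \<Longrightarrow> s' \<noteq> 0 \<Longrightarrow> t' \<noteq> 0 \<Longrightarrow> wl (udiag (s * s') (t * t') 1) \<le> wl (udiag s t 1) + wl (udiag s' t' 1)"
  using len(1)[of "udiag s t 1" "udiag s' t' 1"] by (simp add: udiag_mult)

text \<open>The entries of a unipotent matrix are rescaled exponentially at linear cost.\<close>

lemma len_twist:
  assumes "s \<noteq> 0" "t \<noteq> 0"
  shows "wl (udiag 1 1 (twist s t u)) \<le> 2 * wl (udiag s t 1) + wl (udiag 1 1 u)"
proof -
  have "udiag 1 1 (twist s t u) = udiag s t 1 ** udiag 1 1 u ** udiag (inverse s) (inverse t) 1"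
    using assms by (simp add: udiag_mult)
  then show ?thesis
    using len(1)[of "udiag s t 1 ** udiag 1 1 u" "udiag (inverse s) (inverse t) 1"] len(1)[of "udiag s t 1" "udiag 1 1 u"]
      len_diag_inv[of s t] assms by (simp add: udiag_mult)
qed

lemma len_diag_powi: "\<exists>c. \<forall>m n. wl (udiag (\<beta> powi m) (\<beta> powi n) 1) \<le> c * (nat \<bar>m\<bar> + nat \<bar>n\<bar>)"
proof -
  have nn: "wl (udiag (\<beta> ^ m) 1 1) \<le> m * wl (udiag \<beta> 1 1)" "wl (udiag 1 (\<beta> ^ m) 1) \<le> m * wl (udiag 1 \<beta> 1)" for m
  proof (induction m)
    case 0
    case 1 then show ?case using A4.len_one[OF S(1,3)] by (simp add: A4_one)
    case 2 then show ?case using A4.len_one[OF S(1,3)] by (simp add: A4_one)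
  next
    case (Suc m)
    case 1 then show ?case using Suc len_diag_mult[of \<beta> 1 "\<beta> ^ m" 1] \<beta>_nz by simp
    case 2 then show ?case using Suc len_diag_mult[of 1 \<beta> 1 "\<beta> ^ m"] \<beta>_nz by simp
  qed
  have z2: "wl (udiag (\<beta> powi m) 1 1) \<le> nat \<bar>m\<bar> * wl (udiag \<beta> 1 1)" for m
  proof (cases "m \<ge> 0")
    case True
    then show ?thesis using nn(1)[of "nat m"] by (simp add: power_int_def)
  next
    case False
    then show ?thesis using nn(1)[of "nat (- m)"] len_diag_inv[of "\<beta> ^ nat (- m)" 1] \<beta>_nz
      by (simp add: power_int_def power_inverse)
  qed
  have z3: "wl (udiag 1 (\<beta> powi m) 1) \<le> nat \<bar>m\<bar> * wl (udiag 1 \<beta> 1)" for m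
  proof (cases "m \<ge> 0")
    case True
    then show ?thesis using nn(2)[of "nat m"] by (simp add: power_int_def)
  next
    case False
    then show ?thesis using nn(2)[of "nat (- m)"] len_diag_inv[of 1 "\<beta> ^ nat (- m)"] \<beta>_nz
      by (simp add: power_int_def power_inverse)
  qed
  show ?thesis
  proof (intro exI allI)
    fix m n
    have "wl (udiag (\<beta> powi m) (\<beta> powi n) 1) \<le> wl (udiag (\<beta> powi m) 1 1) + wl (udiag 1 (\<beta> powi n) 1)"
      using len_diag_mult[of "\<beta> powi m" 1 1 "\<beta> powi n"] \<beta>_nz by simp
    then show "wl (udiag (\<beta> powi m) (\<beta> powi n) 1) \<le> (wl (udiag \<beta> 1 1) + wl (udiag 1 \<beta> 1)) * (nat \<bar>m\<bar> + nat \<bar>n\<bar>)"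
      using z2[of m] z3[of n] by (simp add: algebra_simps)
  qed
qed

definition lin_bounded :: "('k \<Rightarrow> 'k uni) \<Rightarrow> bool" where
  "lin_bounded f \<longleftrightarrow> (\<exists>A\<ge>0. \<forall>m x. 0 \<le> m \<longrightarrow> x \<in> L m \<longrightarrow> real (wl (udiag 1 1 (f x))) \<le> A * (m + 1))"

text \<open>An entry \<open>x\<close> of size \<open>m\<close> is conjugate to an entry in \<open>C\<close> by a diagonal matrix with
  powers of \<open>\<beta>\<close> as entries, with exponents of absolute value at most \<open>m\<close>.\<close>

lemma lin_bounded_root:
  assumes f: "\<And>i x. f (\<beta> powi i * x) = twist (\<beta> powi (a * i)) (\<beta> powi (b * i)) (f x)"
    and ab: "\<bar>a\<bar> \<le> 1" "\<bar>b\<bar> \<le> (1::int)" and bd: "\<exists>c. \<forall>x\<in>C. wl (udiag 1 1 (f x)) \<le> c"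
  shows "lin_bounded f"
proof -
  obtain c where c: "\<And>m n. wl (udiag (\<beta> powi m) (\<beta> powi n) 1) \<le> c * (nat \<bar>m\<bar> + nat \<bar>n\<bar>)"
    using len_diag_powi by blast
  obtain d where d: "\<And>x. x \<in> C \<Longrightarrow> wl (udiag 1 1 (f x)) \<le> d" using bd by blast
  have "real (wl (udiag 1 1 (f x))) \<le> (4 * real c + real d) * (m + 1)" if m: "0 \<le> m" and x: "x \<in> L m" for m x
  proof -
    define i y where "i = \<lfloor>m\<rfloor>" and "y = x / \<beta> powi i"
    have y: "y \<in> C" "x = \<beta> powi i * y" using x \<beta>_nz by (auto simp: L_def Lz_def i_def y_def)
    have "\<bar>a * i\<bar> \<le> i" "\<bar>b * i\<bar> \<le> i"
      using ab m mult_right_mono[of "\<bar>a\<bar>" 1 i] mult_right_mono[of "\<bar>b\<bar>" 1 i] by (auto simp: abs_mult i_def)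
    then have ii: "nat \<bar>a * i\<bar> + nat \<bar>b * i\<bar> \<le> 2 * nat i" by linarith
    have "wl (udiag 1 1 (f x)) \<le> 2 * wl (udiag (\<beta> powi (a * i)) (\<beta> powi (b * i)) 1) + wl (udiag 1 1 (f y))"
      unfolding y(2) f using len_twist[of "\<beta> powi (a * i)" "\<beta> powi (b * i)" "f y"] \<beta>_nz by simp
    also have "\<dots> \<le> 2 * (c * (2 * nat i)) + d"
      using c[of "a * i" "b * i"] d[OF y(1)] mult_left_mono[OF ii, of c] by linarith
    finally have "real (wl (udiag 1 1 (f x))) \<le> real (2 * (c * (2 * nat i)) + d)" by (rule of_nat_mono)
    also have "\<dots> = 4 * real c * real (nat i) + real d" by simp
    also have "\<dots> \<le> 4 * real c * m + real d * (m + 1)"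
    proof (intro add_mono mult_left_mono)
      show "real (nat i) \<le> m" using m by (simp add: i_def)
      show "real d \<le> real d * (m + 1)" using m by (simp add: mult_le_cancel_left1)
    qed simp
    also have "\<dots> \<le> (4 * real c + real d) * (m + 1)" by (simp add: algebra_simps)
    finally show ?thesis .
  qed
  then show ?thesis unfolding lin_bounded_def by (intro exI[of _ "4 * real c + real d"]) auto
qed

lemma lin_bounded_roots:
  "lin_bounded (\<lambda>x. Uni x 0 0 0 0 0)" "lin_bounded (\<lambda>x. Uni 0 x 0 0 0 0)"
  "lin_bounded (\<lambda>x. Uni 0 0 0 x 0 0)" "lin_bounded (\<lambda>x. Uni 0 0 0 0 x 0)"
  "lin_bounded (\<lambda>x. Uni 0 0 0 0 0 x)"
proof -
  have add: "ent a b x ** ent a b y = ent a b (x + y)" "ent a b x \<in> carrier A4"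
    if "(a, b) \<in> {(1, 2), (1, 3), (2, 3), (2, 4), (3, 4)}" for a b :: 4 and x y :: 'k
    using that by (auto simp: ent_udiag udiag_uni_mult times_uni_def)
  have bd: "\<exists>c. \<forall>x\<in>C. wl (ent a b x) \<le> c"
    if "(a, b) \<in> {(1, 2), (1, 3), (2, 3), (2, 4), (3, 4)}" for a b
    by (rule additive_bounded[OF add(2)[OF that] add(1)[OF that] compact_C])
  note b = bd[of 1 2, unfolded ent_udiag] bd[of 1 3, unfolded ent_udiag] bd[of 2 3, unfolded ent_udiag]
    bd[of 2 4, unfolded ent_udiag] bd[of 3 4, unfolded ent_udiag]
  show "lin_bounded (\<lambda>x. Uni x 0 0 0 0 0)"
    by (rule lin_bounded_root[of _ "-1" 0]) (use b in \<open>simp_all add: twist_def power_int_minus divide_inverse mult.commute\<close>)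
  show "lin_bounded (\<lambda>x. Uni 0 x 0 0 0 0)"
    by (rule lin_bounded_root[of _ 0 "-1"]) (use b in \<open>simp_all add: twist_def power_int_minus divide_inverse mult.commute\<close>)
  show "lin_bounded (\<lambda>x. Uni 0 0 0 x 0 0)"
    by (rule lin_bounded_root[of _ 1 0]) (use b in \<open>simp_all add: twist_def\<close>)
  show "lin_bounded (\<lambda>x. Uni 0 0 0 0 x 0)"
    by (rule lin_bounded_root[of _ 1 0]) (use b in \<open>simp_all add: twist_def\<close>)
  show "lin_bounded (\<lambda>x. Uni 0 0 0 0 0 x)"
    by (rule lin_bounded_root[of _ 0 1]) (use b in \<open>simp_all add: twist_def\<close>)
qed

text \<open>Diagonal matrices centralise the entry \<open>14\<close>. It is a commutator of entries \<open>13\<close> and \<open>34\<close>,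
  one of which can be rescaled to carry all of the size.\<close>

lemma lin_bounded_14: "lin_bounded (\<lambda>x. Uni 0 0 x 0 0 0)"
proof -
  obtain A where A: "0 \<le> A" "\<And>m x. 0 \<le> m \<Longrightarrow> x \<in> L m \<Longrightarrow> real (wl (udiag 1 1 (Uni 0 x 0 0 0 0))) \<le> A * (m + 1)"
    using lin_bounded_roots(2) unfolding lin_bounded_def by blast
  obtain B where B: "0 \<le> B" "\<And>m x. 0 \<le> m \<Longrightarrow> x \<in> L m \<Longrightarrow> real (wl (udiag 1 1 (Uni 0 0 0 0 0 x))) \<le> B * (m + 1)"
    using lin_bounded_roots(5) unfolding lin_bounded_def by blast
  have "real (wl (udiag 1 1 (Uni 0 0 x 0 0 0))) \<le> (2 * A + 2 * B) * (m + 1)" if m: "0 \<le> m" and x: "x \<in> L m" for m x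
  proof -
    define b c where "b = \<beta> powi \<lfloor>m\<rfloor>" and "c = x / \<beta> powi \<lfloor>m\<rfloor>"
    have bc: "b * c = x" "b \<in> L m" "c \<in> L m"
    proof -
      show "b * c = x" using \<beta>_nz by (simp add: b_def c_def)
      show "b \<in> L m" using L_mono[OF L_pow, of "\<lfloor>m\<rfloor>" m] by (simp add: b_def)
      have "c \<in> L 0" using x by (simp add: c_def L_def Lz_def)
      then show "c \<in> L m" using L_mono m by blast
    qed
    let ?p = "Uni 0 b 0 0 0 0" and ?q = "Uni 0 0 0 0 0 c"
    have "Uni 0 0 x 0 0 0 = ?p * (?q * (uinv ?p * uinv ?q))"
      by (simp add: times_uni_def uinv_def flip: bc(1))
    then have "wl (udiag 1 1 (Uni 0 0 x 0 0 0)) \<le> 2 * wl (udiag 1 1 ?p) + 2 * wl (udiag 1 1 ?q)"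
      using len_uni_mult[of ?p "?q * (uinv ?p * uinv ?q)"] len_uni_mult[of ?q "uinv ?p * uinv ?q"]
        len_uni_mult[of "uinv ?p" "uinv ?q"] len_uni_uinv[of ?p] len_uni_uinv[of ?q] by simp
    then have "real (wl (udiag 1 1 (Uni 0 0 x 0 0 0))) \<le> 2 * real (wl (udiag 1 1 ?p)) + 2 * real (wl (udiag 1 1 ?q))"
      by linarith
    then show ?thesis using A(2)[OF m bc(2)] B(2)[OF m bc(3)] by (simp add: algebra_simps)
  qed
  then show ?thesis unfolding lin_bounded_def using A B by (intro exI[of _ "2 * A + 2 * B"]) auto
qed

definition coords_le :: "real \<Rightarrow> 'k \<Rightarrow> 'k \<Rightarrow> 'k uni \<Rightarrow> bool" where
  "coords_le r s t u \<longleftrightarrow> s \<noteq> 0 \<and> t \<noteq> 0 \<and> {s, t, inverse s, inverse t} \<subseteq> L r \<and> set_uni u \<subseteq> L r"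

lemma set_uni_iff: "set_uni u \<subseteq> X \<longleftrightarrow> e12 u \<in> X \<and> e13 u \<in> X \<and> e14 u \<in> X \<and> e23 u \<in> X \<and> e24 u \<in> X \<and> e34 u \<in> X"
  by (cases u) auto

lemma L_add': "x \<in> L a \<Longrightarrow> y \<in> L b \<Longrightarrow> max a b + real k \<le> c \<Longrightarrow> x + y \<in> L c"
  using L_mono[OF L_add[of x "max a b" y], of c] L_mono[of x a "max a b"] L_mono[of y b "max a b"] by auto

lemma L_mult': "x \<in> L a \<Longrightarrow> y \<in> L b \<Longrightarrow> a + b + real k \<le> c \<Longrightarrow> x * y \<in> L c"
  using L_mono[OF L_mult] by blast

text \<open>Multiplication by a matrix from a bounded set increases sizes by a constant only: in each
  product that occurs, just one factor comes from the second matrix.\<close>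

lemma coords_le_mult:
  assumes g: "coords_le r0 s t u" "coords_le r s' t' v" and r: "0 \<le> r" "0 \<le> r0"
  shows "coords_le (r + (3 * r0 + 6 * real k)) (s * s') (t * t') (u * twist s t v)"
proof -
  \<comment> \<open>\<open>?q\<close> bounds the entries of the conjugate of \<open>v\<close>.\<close>
  let ?q = "r + 2 * r0 + 2 * real k" and ?c = "r + (3 * r0 + 6 * real k)"
  have d: "s \<noteq> 0" "t \<noteq> 0" "s' \<noteq> 0" "t' \<noteq> 0" "s \<in> L r0" "t \<in> L r0" "inverse s \<in> L r0" "inverse t \<in> L r0"
     "s' \<in> L r" "t' \<in> L r" "inverse s' \<in> L r" "inverse t' \<in> L r"
    and u: "e12 u \<in> L r0" "e13 u \<in> L r0" "e14 u \<in> L r0" "e23 u \<in> L r0" "e24 u \<in> L r0" "e34 u \<in> L r0"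
    and v: "e12 v \<in> L r" "e13 v \<in> L r" "e14 v \<in> L r" "e23 v \<in> L r" "e24 v \<in> L r" "e34 v \<in> L r"
    using g by (auto simp: coords_le_def set_uni_iff)
  let ?w = "twist s t v"
  have w: "e12 ?w \<in> L ?q" "e13 ?w \<in> L ?q" "e14 ?w \<in> L ?q" "e23 ?w \<in> L ?q" "e24 ?w \<in> L ?q" "e34 ?w \<in> L ?q"
    unfolding twist_def uni.sel divide_inverse
    using L_mult'[OF v(1) d(7), of ?q] L_mult'[OF v(2) d(8), of ?q] L_mono[OF v(3), of ?q]
      L_mult'[OF L_mult[OF d(5) v(4)] d(8), of ?q] L_mult'[OF d(5) v(5), of ?q] L_mult'[OF d(6) v(6), of ?q] r
    by auto
  have m: "x * y \<in> L (r + 3 * r0 + 3 * real k)" if "x \<in> L r0" "y \<in> L ?q" for x y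
    by (rule L_mult'[OF that]) simp
  have "set_uni (u * ?w) \<subseteq> L ?c"
    unfolding set_uni_iff times_uni_def uni.sel
  proof (intro conjI)
    show "e12 u + e12 ?w \<in> L ?c" by (rule L_add'[OF u(1) w(1)]) (use r in auto)
    show "e23 u + e23 ?w \<in> L ?c" by (rule L_add'[OF u(4) w(4)]) (use r in auto)
    show "e34 u + e34 ?w \<in> L ?c" by (rule L_add'[OF u(6) w(6)]) (use r in auto)
    have "e13 u + e13 ?w \<in> L (r + 3 * r0 + 3 * real k)" by (rule L_add'[OF u(2) w(2)]) (use r in auto)
    then show "e13 u + e13 ?w + e12 u * e23 ?w \<in> L ?c"
      by (rule L_add'[OF _ m[OF u(1) w(4)]]) (use r in auto)
    have "e24 u + e24 ?w \<in> L (r + 3 * r0 + 3 * real k)" by (rule L_add'[OF u(5) w(5)]) (use r in auto)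
    then show "e24 u + e24 ?w + e23 u * e34 ?w \<in> L ?c"
      by (rule L_add'[OF _ m[OF u(4) w(6)]]) (use r in auto)
    have "e14 u + e14 ?w \<in> L (r + 3 * r0 + 3 * real k)" by (rule L_add'[OF u(3) w(3)]) (use r in auto)
    then have "e14 u + e14 ?w + e12 u * e24 ?w \<in> L (r + 3 * r0 + 4 * real k)"
      by (rule L_add'[OF _ m[OF u(1) w(5)]]) (use r in auto)
    then show "e14 u + e14 ?w + e12 u * e24 ?w + e13 u * e34 ?w \<in> L ?c"
      by (rule L_add'[OF _ m[OF u(2) w(6)]]) (use r in auto)
  qed
  moreover have "s * s' \<in> L ?c" "t * t' \<in> L ?c" "inverse (s * s') \<in> L ?c" "inverse (t * t') \<in> L ?c"
    using L_mult'[OF d(5,9), of ?c] L_mult'[OF d(6,10), of ?c] L_mult'[OF d(7,11), of ?c] L_mult'[OF d(8,12), of ?c] r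
    by auto
  ultimately show ?thesis using d by (simp add: coords_le_def)
qed

theorem word_length_lower:
  "\<exists>A\<ge>0. \<forall>g\<in>carrier A4. coords_le (A * real (wl g)) (diag2 g) (diag3 g) (unipotent_part g)"
proof -
  have Tc: "T \<subseteq> carrier A4"
    using S(1) A4.one_closed by (auto simp: T_def A4_one udiag_one)
  note cc = continuous_on_coords[OF Tc]
  let ?K = "diag2 ` T \<union> diag3 ` T \<union> (\<lambda>x. inverse (diag2 x)) ` T \<union> (\<lambda>x. inverse (diag3 x)) ` T \<union>
    (\<lambda>x. e12 (unipotent_part x)) ` T \<union> (\<lambda>x. e13 (unipotent_part x)) ` T \<union> (\<lambda>x. e14 (unipotent_part x)) ` T \<union>
    (\<lambda>x. e23 (unipotent_part x)) ` T \<union> (\<lambda>x. e24 (unipotent_part x)) ` T \<union> (\<lambda>x. e34 (unipotent_part x)) ` T"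
  have "compact ?K" by (intro compact_Un compact_continuous_image cc compact_T)
  then obtain r0 where r0: "0 \<le> r0" "?K \<subseteq> L r0" by (rule L_compact)
  have gT: "coords_le r0 (diag2 x) (diag3 x) (unipotent_part x)" if "x \<in> T" for x
    using r0(2) that A4_coords(1,2)[of x] Tc by (auto simp: coords_le_def set_uni_iff)
  define A where "A = 3 * r0 + 6 * real k"
  have A: "0 \<le> A" using r0 by (simp add: A_def)
  have word: "coords_le (A * real (length xs)) (diag2 (A4.word_product xs)) (diag3 (A4.word_product xs)) (unipotent_part (A4.word_product xs))"
    if "set xs \<subseteq> S \<union> m_inv A4 ` S" for xs
    using that
  proof (induction xs)
    case Nil
    then show ?case using L_1 by (simp add: A4_one coords_le_def one_uni_def)
  next
    case (Cons x xs)
    then have x: "x \<in> T" by (auto simp: T_def)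
    have "set xs \<subseteq> T" using Cons.prems by (auto simp: T_def)
    then have xc: "x \<in> carrier A4" "A4.word_product xs \<in> carrier A4"
      using x Tc by (auto intro!: A4.word_product_closed)
    let ?y = "A4.word_product xs"
    have prod: "A4.word_product (x # xs) = udiag (diag2 x * diag2 ?y) (diag3 x * diag3 ?y) (unipotent_part x * twist (diag2 x) (diag3 x) (unipotent_part ?y))"
      using udiag_mult[OF A4_coords(1,2)[OF xc(1)], of "unipotent_part x" "diag2 ?y" "diag3 ?y" "unipotent_part ?y"] A4_coords(3)[OF xc(1)] A4_coords(3)[OF xc(2)]
      by (simp add: A4_mult)
    have y: "coords_le (A * real (length xs)) (diag2 ?y) (diag3 ?y) (unipotent_part ?y)" and nn: "0 \<le> A * real (length xs)"
      using Cons A by simp_all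
    have "A * real (length (x # xs)) = A * real (length xs) + A" by (simp add: algebra_simps)
    with coords_le_mult[OF gT[OF x] y nn r0(1), folded A_def]
    have "coords_le (A * real (length (x # xs))) (diag2 x * diag2 ?y) (diag3 x * diag3 ?y) (unipotent_part x * twist (diag2 x) (diag3 x) (unipotent_part ?y))"
      by (simp only:)
    then show ?case
      unfolding prod using A4_coords(1,2)[OF xc(1)] A4_coords(1,2)[OF xc(2)] by simp
  qed
  have "coords_le (A * real (wl g)) (diag2 g) (diag3 g) (unipotent_part g)" if g: "g \<in> carrier A4" for g
  proof -
    obtain xs where "length xs = wl g" "set xs \<subseteq> S \<union> m_inv A4 ` S" "g = A4.word_product xs"
      by (rule A4.word_length_attained[OF S(1,3) g])
    then show ?thesis using word by metis
  qed
  then show ?thesis using A by blast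
qed

text \<open>The sizes of \<open>s\<close> and of its inverse bound the exponent of \<open>\<beta>\<close> in its polar
  decomposition from both sides.\<close>

lemma diag_length_upper:
  "\<exists>A\<ge>0. \<forall>m s t u. 0 \<le> m \<longrightarrow> coords_le m s t u \<longrightarrow> real (wl (udiag s t 1)) \<le> A * (m + 1)"
proof -
  obtain c where c: "\<And>m n. wl (udiag (\<beta> powi m) (\<beta> powi n) 1) \<le> c * (nat \<bar>m\<bar> + nat \<bar>n\<bar>)"
    using len_diag_powi by blast
  have mult: "ent a a x ** ent a a y = ent a a (x * y)" and carr: "x \<noteq> 0 \<Longrightarrow> ent a a x \<in> carrier A4"
    if "a \<in> {2, 3}" for a :: 4 and x y :: 'k
  proof -
    show "x \<noteq> 0 \<Longrightarrow> ent a a x \<in> carrier A4" using that by (auto simp: ent_udiag)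
    show "ent a a x ** ent a a y = ent a a (x * y)"
      using that by (auto simp: mat_eq_iff4 forall_4 matrix_matrix_mult_def sum_4 ent_entry)
  qed
  have bd: "\<exists>d. \<forall>x\<in>Q. wl (ent a a x) \<le> d" if "a \<in> {2, 3}" for a :: 4
    by (rule multiplicative_bounded[OF carr[OF that] mult[OF that] compact_Q zero_Q])
  obtain d where d: "\<And>x. x \<in> Q \<Longrightarrow> wl (udiag x 1 1) \<le> d" using bd[of 2] by (auto simp: ent_udiag)
  obtain d' where d': "\<And>x. x \<in> Q \<Longrightarrow> wl (udiag 1 x 1) \<le> d'" using bd[of 3] by (auto simp: ent_udiag)
  have polar_bound: "\<exists>i b. s = \<beta> powi i * b \<and> b \<in> Q \<and> real (nat \<bar>i\<bar>) \<le> m + 2 * real k"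
    if s: "s \<noteq> 0" "s \<in> L m" "inverse s \<in> L m" for s m
  proof -
    obtain i b where ib: "s = \<beta> powi i * b" "b \<in> Q" "s \<in> L i" "inverse s \<in> L (real k - i)"
      by (rule L_polar[OF s(1)])
    have "1 \<in> L (m + (real k - i) + real k)" "1 \<in> L (i + m + real k)"
      using L_mult[OF s(2) ib(4)] L_mult[OF ib(3) s(3)] s(1) by simp_all
    then have "real_of_int i \<le> m + 2 * real k" "- real_of_int i \<le> m + real k"
      using one_L by fastforce+
    then have "real (nat \<bar>i\<bar>) \<le> m + 2 * real k" by linarith
    then show ?thesis using ib by blast
  qed
  define A where "A = 2 * real c + 4 * real c * real k + real d + real d'"
  have "real (wl (udiag s t 1)) \<le> A * (m + 1)" if m: "0 \<le> m" and g: "coords_le m s t u" for m s t u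
  proof -
    have st: "s \<noteq> 0" "t \<noteq> 0" "s \<in> L m" "inverse s \<in> L m" "t \<in> L m" "inverse t \<in> L m"
      using g by (auto simp: coords_le_def)
    obtain i b where i: "s = \<beta> powi i * b" "b \<in> Q" "real (nat \<bar>i\<bar>) \<le> m + 2 * real k"
      using polar_bound[OF st(1,3,4)] by blast
    obtain i' b' where i': "t = \<beta> powi i' * b'" "b' \<in> Q" "real (nat \<bar>i'\<bar>) \<le> m + 2 * real k"
      using polar_bound[OF st(2,5,6)] by blast
    have nz: "b \<noteq> 0" "b' \<noteq> 0" using i(2) i'(2) zero_Q by auto
    have "wl (udiag s t 1) \<le> wl (udiag (\<beta> powi i) (\<beta> powi i') 1) + (wl (udiag b 1 1) + wl (udiag 1 b' 1))"
      using len_diag_mult[of "\<beta> powi i" "\<beta> powi i'" b b'] len_diag_mult[of b 1 1 b'] nz \<beta>_nz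
      by (simp add: i(1) i'(1))
    also have "\<dots> \<le> c * (nat \<bar>i\<bar> + nat \<bar>i'\<bar>) + (d + d')"
      using c[of i i'] d[OF i(2)] d'[OF i'(2)] by linarith
    finally have "real (wl (udiag s t 1)) \<le> real (c * (nat \<bar>i\<bar> + nat \<bar>i'\<bar>) + (d + d'))" by (rule of_nat_mono)
    also have "\<dots> = real c * (real (nat \<bar>i\<bar>) + real (nat \<bar>i'\<bar>)) + (real d + real d')" by simp
    also have "\<dots> \<le> real c * ((m + 2 * real k) + (m + 2 * real k)) + (real d + real d')"
      using i(3) i'(3) by (intro add_mono mult_left_mono) auto
    also have "\<dots> \<le> A * (m + 1)"
      using m by (simp add: A_def algebra_simps)
    finally show ?thesis .
  qed
  moreover have "0 \<le> A" by (simp add: A_def)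
  ultimately show ?thesis by blast
qed

theorem word_length_upper:
  "\<exists>A\<ge>0. \<forall>m s t u. 0 \<le> m \<longrightarrow> coords_le m s t u \<longrightarrow> real (wl (udiag s t u)) \<le> A * (m + 1)"
proof -
  note lb = lin_bounded_roots[unfolded lin_bounded_def] lin_bounded_14[unfolded lin_bounded_def]
  obtain A1 where A1: "0 \<le> A1" "\<And>m x. 0 \<le> m \<Longrightarrow> x \<in> L m \<Longrightarrow> real (wl (udiag 1 1 (Uni x 0 0 0 0 0))) \<le> A1 * (m + 1)"
    using lb(1) by blast
  obtain A2 where A2: "0 \<le> A2" "\<And>m x. 0 \<le> m \<Longrightarrow> x \<in> L m \<Longrightarrow> real (wl (udiag 1 1 (Uni 0 x 0 0 0 0))) \<le> A2 * (m + 1)"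
    using lb(2) by blast
  obtain A3 where A3: "0 \<le> A3" "\<And>m x. 0 \<le> m \<Longrightarrow> x \<in> L m \<Longrightarrow> real (wl (udiag 1 1 (Uni 0 0 0 x 0 0))) \<le> A3 * (m + 1)"
    using lb(3) by blast
  obtain A4 where A4: "0 \<le> A4" "\<And>m x. 0 \<le> m \<Longrightarrow> x \<in> L m \<Longrightarrow> real (wl (udiag 1 1 (Uni 0 0 0 0 x 0))) \<le> A4 * (m + 1)"
    using lb(4) by blast
  obtain A5 where A5: "0 \<le> A5" "\<And>m x. 0 \<le> m \<Longrightarrow> x \<in> L m \<Longrightarrow> real (wl (udiag 1 1 (Uni 0 0 0 0 0 x))) \<le> A5 * (m + 1)"
    using lb(5) by blast
  obtain A6 where A6: "0 \<le> A6" "\<And>m x. 0 \<le> m \<Longrightarrow> x \<in> L m \<Longrightarrow> real (wl (udiag 1 1 (Uni 0 0 x 0 0 0))) \<le> A6 * (m + 1)"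
    using lb(6) by blast
  obtain A0 where A0: "0 \<le> A0" "\<And>m s t u. 0 \<le> m \<Longrightarrow> coords_le m s t u \<Longrightarrow> real (wl (udiag s t 1)) \<le> A0 * (m + 1)"
    using diag_length_upper by blast
  define A where "A = A0 + A1 + A2 + A3 + A4 + A5 + A6"
  have "real (wl (udiag s t u)) \<le> A * (m + 1)" if m: "0 \<le> m" and g: "coords_le m s t u" for m s t u
  proof -
    let ?a = "Uni (e12 u) 0 0 0 0 0" and ?b = "Uni 0 (e13 u) 0 0 0 0" and ?c = "Uni 0 0 (e14 u) 0 0 0"
      and ?d = "Uni 0 0 0 (e23 u) 0 0" and ?e = "Uni 0 0 0 0 (e24 u) 0" and ?f = "Uni 0 0 0 0 0 (e34 u)"
    have st: "s \<noteq> 0" "t \<noteq> 0" and u: "e12 u \<in> L m" "e13 u \<in> L m" "e14 u \<in> L m" "e23 u \<in> L m" "e24 u \<in> L m" "e34 u \<in> L m"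
      using g by (auto simp: coords_le_def set_uni_iff)
    have fac: "u = ?f * (?e * (?d * (?b * (?a * ?c))))" by (cases u) (simp add: times_uni_def)
    have "wl (udiag s t u) \<le> wl (udiag 1 1 u) + wl (udiag s t 1)"
      using len(1)[of "udiag 1 1 u" "udiag s t 1"] st by (simp add: udiag_mult)
    moreover have "wl (udiag 1 1 u) \<le> wl (udiag 1 1 ?f) + (wl (udiag 1 1 ?e) + (wl (udiag 1 1 ?d) + (wl (udiag 1 1 ?b) + (wl (udiag 1 1 ?a) + wl (udiag 1 1 ?c)))))"
    proof -
      have "wl (udiag 1 1 (?f * (?e * (?d * (?b * (?a * ?c)))))) \<le> wl (udiag 1 1 ?f) + (wl (udiag 1 1 ?e) + (wl (udiag 1 1 ?d) + (wl (udiag 1 1 ?b) + (wl (udiag 1 1 ?a) + wl (udiag 1 1 ?c)))))"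
        by (intro order_trans[OF len_uni_mult] add_left_mono order_refl)
      then show ?thesis by (simp flip: fac)
    qed
    ultimately have "real (wl (udiag s t u)) \<le> real (wl (udiag 1 1 ?f)) + (real (wl (udiag 1 1 ?e)) + (real (wl (udiag 1 1 ?d)) +
        (real (wl (udiag 1 1 ?b)) + (real (wl (udiag 1 1 ?a)) + real (wl (udiag 1 1 ?c)))))) + real (wl (udiag s t 1))"
      by linarith
    also have "\<dots> \<le> A5 * (m + 1) + (A4 * (m + 1) + (A3 * (m + 1) + (A2 * (m + 1) + (A1 * (m + 1) + A6 * (m + 1))))) + A0 * (m + 1)"
      using A1(2)[OF m u(1)] A2(2)[OF m u(2)] A6(2)[OF m u(3)] A3(2)[OF m u(4)] A4(2)[OF m u(5)] A5(2)[OF m u(6)]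
        A0(2)[OF m g] by (intro add_mono)
    also have "\<dots> = A * (m + 1)" by (simp add: A_def algebra_simps)
    finally show ?thesis .
  qed
  moreover have "0 \<le> A" using A0 A1 A2 A3 A4 A5 A6 by (simp add: A_def)
  ultimately show ?thesis by blast
qed

end

section \<open>Cones of metric spaces\<close>

text \<open>The embedding \<open>x \<mapsto> d(x, -) - d(a, -)\<close> into bounded functions. It makes the calculus of paths in normed
  spaces available for the cone; the discrete copy of the type makes all functions on it continuous.\<close>

lemma Kuratowski_embedding:
  fixes M :: "'a set"
  assumes "Metric_space M d"
  obtains \<kappa> :: "'a \<Rightarrow> 'a discrete \<Rightarrow>\<^sub>C real" where "\<And>x y. x \<in> M \<Longrightarrow> y \<in> M \<Longrightarrow> dist (\<kappa> x) (\<kappa> y) = d x y"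
proof (cases "M = {}")
  case False
  interpret Metric_space M d by fact
  obtain a where a: "a \<in> M" using False by blast
  define f where "f x = (\<lambda>y. if of_discrete y \<in> M then d x (of_discrete y) - d a (of_discrete y) else 0)" for x
  have le: "\<bar>d x z - d y z\<bar> \<le> d x y" if "x \<in> M" "y \<in> M" "z \<in> M" for x y z
    using triangle[of x y z] triangle[of y x z] that commute[of x y] by simp
  have bc: "f x \<in> bcontfun" if "x \<in> M" for x
    unfolding bcontfun_def
  proof (intro CollectI conjI)
    show "continuous_on UNIV (f x)"
      by (rule continuous_on_open_vimage[THEN iffD2]) (auto simp: open_discrete)
    show "bounded (range (f x))"
      unfolding bounded_iff using le that a by (intro exI[of _ "d x a"]) (auto simp: f_def)
  qed
  define \<kappa> where "\<kappa> x = Bcontfun (f x)" for x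
  have ap: "apply_bcontfun (\<kappa> x) = f x" if "x \<in> M" for x
    using bc[OF that] by (simp add: \<kappa>_def Bcontfun_inverse)
  have "dist (\<kappa> x) (\<kappa> y) = d x y" if xy: "x \<in> M" "y \<in> M" for x y
  proof (rule antisym)
    have "dist (apply_bcontfun (\<kappa> x) z) (apply_bcontfun (\<kappa> y) z) \<le> d x y" for z
      using le[OF xy, of "of_discrete z"] xy by (auto simp: ap f_def dist_real_def)
    then show "dist (\<kappa> x) (\<kappa> y) \<le> d x y" by (rule dist_bound)
    have "dist (apply_bcontfun (\<kappa> x) (discrete y)) (apply_bcontfun (\<kappa> y) (discrete y)) \<le> dist (\<kappa> x) (\<kappa> y)"
      by (rule dist_bounded)
    then show "d x y \<le> dist (\<kappa> x) (\<kappa> y)"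
      using xy by (simp add: ap f_def dist_real_def discrete_inverse)
  qed
  then show ?thesis using that by blast
qed (use that in blast)

lemma simply_connected_space_if_isometric:
  fixes \<kappa> :: "'a \<Rightarrow> 'b::real_normed_vector"
  assumes M: "Metric_space M d" and \<kappa>: "\<And>x y. x \<in> M \<Longrightarrow> y \<in> M \<Longrightarrow> dist (\<kappa> x) (\<kappa> y) = d x y"
    and pc: "path_connected (\<kappa> ` M)"
    and null: "\<And>\<gamma>. path \<gamma> \<Longrightarrow> path_image \<gamma> \<subseteq> \<kappa> ` M \<Longrightarrow> pathfinish \<gamma> = pathstart \<gamma> \<Longrightarrow>
      homotopic_paths (\<kappa> ` M) (\<lambda>_. pathstart \<gamma>) \<gamma>"
  shows "simply_connected_space (Metric_space.mtopology M d)"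
proof -
  interpret Metric_space M d by fact
  let ?N = "\<kappa> ` M"
  have inj: "inj_on \<kappa> M" by (rule inj_onI) (metis \<kappa> dist_self zero)
  define unembed where "unembed = inv_into M \<kappa>"
  have inv: "unembed (\<kappa> x) = x" if "x \<in> M" for x using inj that by (simp add: unembed_def)
  have c1: "continuous_map mtopology (top_of_set ?N) \<kappa>"
    unfolding continuous_map_in_subtopology
  proof (intro conjI)
    show "continuous_map mtopology euclidean \<kappa>"
      unfolding continuous_map_def
    proof (intro conjI allI impI)
      fix U :: "'b set" assume "openin euclidean U"
      then have U: "open U" by simp
      show "openin mtopology {x \<in> topspace mtopology. \<kappa> x \<in> U}"
        unfolding openin_mtopology
      proof (intro conjI allI impI)
        fix x assume "x \<in> {x \<in> topspace mtopology. \<kappa> x \<in> U}"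
        then have x: "x \<in> M" "\<kappa> x \<in> U" by auto
        then obtain e where e: "e > 0" "\<And>z. dist z (\<kappa> x) < e \<Longrightarrow> z \<in> U" using U unfolding open_dist by blast
        have "mball x e \<subseteq> {x \<in> topspace mtopology. \<kappa> x \<in> U}"
          using e(2) \<kappa> commute by (auto simp: in_mball)
        then show "\<exists>r>0. mball x r \<subseteq> {x \<in> topspace mtopology. \<kappa> x \<in> U}" using e(1) by blast
      qed auto
    qed auto
  qed auto
  have c2: "continuous_map (top_of_set ?N) mtopology unembed"
    unfolding continuous_map_to_metric
  proof (intro ballI allI impI)
    fix z and e :: real assume "z \<in> topspace (top_of_set ?N)" and e: "0 < e"
    then obtain x where x: "x \<in> M" "z = \<kappa> x" by auto
    have "unembed y \<in> mball (unembed z) e" if "y \<in> ?N \<inter> ball z e" for y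
      using that x inv \<kappa> by (auto simp: in_mball)
    then show "\<exists>U. openin (top_of_set ?N) U \<and> z \<in> U \<and> (\<forall>y\<in>U. unembed y \<in> mball (unembed z) e)"
      using e x by (intro exI[of _ "?N \<inter> ball z e"]) (auto simp: openin_open_Int)
  qed
  have hom: "homeomorphic_map mtopology (top_of_set ?N) \<kappa>"
    unfolding homeomorphic_map_maps homeomorphic_maps_def
    using c1 c2 inv by (intro exI[of _ unembed]) auto
  have "path_connected_space mtopology"
    using pc homeomorphic_path_connected_space[OF homeomorphic_map_imp_homeomorphic_space[OF hom]]
    unfolding path_connectedin_euclidean[symmetric] path_connectedin_def by simp
  moreover have "homotopic_with (\<lambda>h. h 0 = g 0 \<and> h 1 = g 0) (top_of_set {0..1}) mtopology g (\<lambda>_. g 0)"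
    if g: "pathin mtopology g" "g 0 = g 1" for g
  proof -
    have g01: "g t \<in> M" if "t \<in> {0..1}" for t
      using g(1) that by (auto simp: pathin_def continuous_map_def)
    let ?\<gamma> = "\<kappa> \<circ> g"
    have "continuous_map (top_of_set {0..1}) (top_of_set ?N) ?\<gamma>"
      using g(1) c1 unfolding pathin_def by (rule continuous_map_compose)
    then have p: "path ?\<gamma>" "path_image ?\<gamma> \<subseteq> ?N"
      using g01 by (auto simp: path_def path_image_def continuous_map_in_subtopology)
    have "pathfinish ?\<gamma> = pathstart ?\<gamma>" using g(2) by (simp add: pathstart_def pathfinish_def)
    from null[OF p this] have "homotopic_paths ?N (\<lambda>_. \<kappa> (g 0)) ?\<gamma>" by (simp add: pathstart_def)
    then have "homotopic_with (\<lambda>r. r 0 = \<kappa> (g 0) \<and> r 1 = \<kappa> (g 0)) (top_of_set {0..1}) (top_of_set ?N) ?\<gamma> (\<lambda>_. \<kappa> (g 0))"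
      using homotopic_paths_sym by (fastforce simp: homotopic_paths_def pathstart_def pathfinish_def g(2))
    then have "homotopic_with (\<lambda>h. h 0 = g 0 \<and> h 1 = g 0) (top_of_set {0..1}) mtopology (unembed \<circ> ?\<gamma>) (unembed \<circ> (\<lambda>_. \<kappa> (g 0)))"
      by (rule homotopic_with_compose_continuous_map_left[OF _ c2]) (use g01 inv in \<open>auto simp: pathstart_def pathfinish_def\<close>)
    then show ?thesis
      by (rule homotopic_with_eq) (use g01 inv in auto)
  qed
  ultimately show ?thesis by (auto simp: simply_connected_space_def)
qed

lemma nonprincipal_le_sequentially:
  assumes \<omega>: "nonprincipal_ultrafilter \<omega>"
  shows "\<omega> \<le> sequentially"
  unfolding le_filter_def
proof (intro allI impI)
  fix P :: "nat \<Rightarrow> bool" assume "eventually P sequentially"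
  then obtain N where N: "\<And>n. n \<ge> N \<Longrightarrow> P n" by (auto simp: eventually_sequentially)
  have "eventually (\<lambda>n. n \<noteq> a) \<omega>" for a
    using \<omega> unfolding nonprincipal_ultrafilter_def by blast
  then have "eventually (\<lambda>n. \<forall>a\<in>{..<N}. n \<noteq> a) \<omega>"
    by (subst eventually_ball_finite_distrib) auto
  then show "eventually P \<omega>" by eventually_elim (metis N lessThan_iff not_le)
qed

lemma ultralimit_exists:
  fixes f :: "nat \<Rightarrow> real"
  assumes \<omega>: "nonprincipal_ultrafilter \<omega>" and bnd: "eventually (\<lambda>n. \<bar>f n\<bar> \<le> B) \<omega>"
  obtains l where "(f \<longlongrightarrow> l) \<omega>"
proof -
  have filter_nontrivial: "\<omega> \<noteq> bot" and ultra: "\<And>P. eventually P \<omega> \<or> eventually (\<lambda>x. \<not> P x) \<omega>"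
    using \<omega> by (auto simp: nonprincipal_ultrafilter_def)
  have "filtermap f \<omega> \<noteq> bot" using filter_nontrivial by (simp add: filtermap_bot_iff)
  moreover have "eventually (\<lambda>r. r \<in> {-B..B}) (filtermap f \<omega>)"
    using bnd unfolding eventually_filtermap by eventually_elim auto
  ultimately obtain l where l: "inf (nhds l) (filtermap f \<omega>) \<noteq> bot"
    using compact_Icc[of "-B" B] unfolding compact_filter by blast
  have "(f \<longlongrightarrow> l) \<omega>"
    unfolding filterlim_iff
  proof (intro allI impI)
    fix P assume P: "eventually P (nhds l)"
    show "eventually (\<lambda>n. P (f n)) \<omega>"
    proof (rule ccontr)
      assume "\<not> ?thesis"
      then have "eventually (\<lambda>r. \<not> P r) (filtermap f \<omega>)"
        using ultra[of "\<lambda>n. P (f n)"] by (auto simp: eventually_filtermap)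
      then have "eventually (\<lambda>_. False) (inf (nhds l) (filtermap f \<omega>))"
        using P unfolding eventually_inf by blast
      then show False using l by (simp add: trivial_limit_def)
    qed
  qed
  then show ?thesis by (rule that)
qed

lemma eventually_linear_large:
  assumes "nonprincipal_ultrafilter \<omega>" "0 < e"
  shows "eventually (\<lambda>n. c \<le> e * real n) \<omega>"
proof -
  obtain N where N: "c / e \<le> real N" using real_arch_simple by blast
  have "c \<le> e * real n" if "n \<ge> N" for n
  proof -
    have "c / e \<le> real n" using N that by linarith
    then show ?thesis using assms(2) by (simp add: field_simps)
  qed
  then have "eventually (\<lambda>n. c \<le> e * real n) sequentially" by (auto simp: eventually_sequentially)
  then show ?thesis using nonprincipal_le_sequentially[OF assms(1)] by (rule filter_leD[rotated])
qed

context Metric_space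
begin

definition linear_growth :: "nat filter \<Rightarrow> 'a \<Rightarrow> (nat \<Rightarrow> 'a) \<Rightarrow> bool" where
  "linear_growth \<omega> x0 x \<longleftrightarrow> (\<forall>n. x n \<in> M) \<and> (\<exists>c. eventually (\<lambda>n. d (x n) x0 \<le> c * real n) \<omega>)"

text \<open>Only the terms of index in a set of the ultrafilter matter for a point of the cone. A sequence of
  linear growth along the ultrafilter need not be in the precone, but all its representatives there
  form one class.\<close>

definition cone_class :: "nat filter \<Rightarrow> 'a \<Rightarrow> (nat \<Rightarrow> 'a) \<Rightarrow> (nat \<Rightarrow> 'a) set" where
  "cone_class \<omega> x0 x = {y \<in> precone M d x0. \<forall>\<epsilon>>0. eventually (\<lambda>n. d (x n) (y n) \<le> \<epsilon> * real n) \<omega>}"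

context
  fixes \<omega> :: "nat filter" and x0
  assumes \<omega>: "nonprincipal_ultrafilter \<omega>" and x0: "x0 \<in> M"
begin

abbreviation "P \<equiv> precone M d x0"
abbreviation "pd \<equiv> precone_dist d \<omega>"

lemma filter_nontrivial: "\<omega> \<noteq> bot" using \<omega> by (auto simp: nonprincipal_ultrafilter_def)

lemma precone_D: "x \<in> P \<Longrightarrow> x n \<in> M" by (auto simp: precone_def)

lemma pd_eventually:
  assumes "x \<in> P" "y \<in> P" "0 < \<epsilon>"
  shows "eventually (\<lambda>n. d (x n) (y n) \<le> (pd x y + \<epsilon>) * real n) \<omega>"
proof -
  have "eventually (\<lambda>n. d (x n) (y n) / real n < pd x y + \<epsilon>) \<omega>"
    using precone_tendsto[OF \<omega> assms(1,2) x0] assms(3) by (intro order_tendstoD(2)) auto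
  moreover have "eventually (\<lambda>n. 1 \<le> 1 * real n) \<omega>" by (rule eventually_linear_large[OF \<omega>]) simp
  ultimately show ?thesis by eventually_elim (simp add: field_simps)
qed

lemma pd_le:
  assumes "x \<in> P" "y \<in> P" and e: "\<And>\<epsilon>. 0 < \<epsilon> \<Longrightarrow> eventually (\<lambda>n. d (x n) (y n) \<le> (c + \<epsilon>) * real n) \<omega>"
  shows "pd x y \<le> c"
proof (rule field_le_epsilon)
  fix \<epsilon> :: real assume \<epsilon>: "0 < \<epsilon>"
  have "eventually (\<lambda>n. 1 \<le> 1 * real n) \<omega>" by (rule eventually_linear_large[OF \<omega>]) simp
  with e[OF \<epsilon>] have "eventually (\<lambda>n. d (x n) (y n) / real n \<le> c + \<epsilon>) \<omega>"
    by eventually_elim (simp add: field_simps)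
  then show "pd x y \<le> c + \<epsilon>" by (rule tendsto_upperbound[OF precone_tendsto[OF \<omega> assms(1,2) x0] _ filter_nontrivial])
qed

lemma pd_nonneg: "x \<in> P \<Longrightarrow> y \<in> P \<Longrightarrow> 0 \<le> pd x y"
  by (rule tendsto_lowerbound[OF precone_tendsto[OF \<omega> _ _ x0]]) (auto simp: filter_nontrivial)

lemma pd_zero_iff:
  assumes "x \<in> P" "y \<in> P"
  shows "pd x y = 0 \<longleftrightarrow> (\<forall>\<epsilon>>0. eventually (\<lambda>n. d (x n) (y n) \<le> \<epsilon> * real n) \<omega>)"
  using pd_eventually[OF assms] pd_le[OF assms, of 0] pd_nonneg[OF assms] by (auto intro: antisym)

text \<open>Replace the terms that are too far away by the base point.\<close>

lemma linear_growth_representative: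
  assumes "linear_growth \<omega> x0 x"
  obtains x' where "x' \<in> P" "eventually (\<lambda>n. x' n = x n) \<omega>"
proof -
  obtain c where c: "eventually (\<lambda>n. d (x n) x0 \<le> c * real n) \<omega>" and x: "\<And>n. x n \<in> M"
    using assms by (auto simp: linear_growth_def)
  define x' where "x' n = (if d (x n) x0 \<le> c * real n then x n else x0)" for n
  have "d (x' n) x0 / real n \<le> \<bar>c\<bar>" for n
  proof -
    have "d (x' n) x0 \<le> \<bar>c\<bar> * real n"
      using x0 order_trans[OF _ mult_right_mono[of c "\<bar>c\<bar>" "real n"]] by (auto simp: x'_def)
    then show ?thesis by (cases "n = 0") (auto simp: field_simps)
  qed
  then have "limsup (\<lambda>n. ereal (d (x' n) x0 / real n)) \<le> ereal \<bar>c\<bar>"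
    by (intro Limsup_bounded) auto
  then have "limsup (\<lambda>n. ereal (d (x' n) x0 / real n)) < \<infinity>" by (rule le_less_trans) simp
  then have "x' \<in> P" using x x0 by (auto simp: precone_def x'_def)
  moreover have "eventually (\<lambda>n. x' n = x n) \<omega>" using c by eventually_elim (simp add: x'_def)
  ultimately show ?thesis by (rule that)
qed

lemma precone_linear_growth: assumes "x \<in> P" shows "linear_growth \<omega> x0 x"
proof -
  have "(\<lambda>_. x0) \<in> P" using x0 by (auto simp: precone_def Limsup_const)
  from pd_eventually[OF assms this, of 1] show ?thesis
    using precone_D[OF assms] by (auto simp: linear_growth_def)
qed

abbreviation "cls \<equiv> {(x, y). x \<in> P \<and> y \<in> P \<and> pd x y = 0}"

lemma cone_class_eq:
  assumes x': "x' \<in> P" "eventually (\<lambda>n. x' n = x n) \<omega>"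
  shows "cone_class \<omega> x0 x = cls `` {x'}"
proof -
  have "(\<forall>\<epsilon>>0. eventually (\<lambda>n. d (x n) (y n) \<le> \<epsilon> * real n) \<omega>) \<longleftrightarrow> (\<forall>\<epsilon>>0. eventually (\<lambda>n. d (x' n) (y n) \<le> \<epsilon> * real n) \<omega>)" for y
    by (intro all_cong eventually_subst) (use x'(2) in \<open>eventually_elim, simp\<close>)
  then show ?thesis using x'(1) pd_zero_iff[OF x'(1)] by (auto simp: cone_class_def)
qed

lemma cone_class_in_cone: assumes "linear_growth \<omega> x0 x" shows "cone_class \<omega> x0 x \<in> cone M d x0 \<omega>"
proof -
  obtain x' where x': "x' \<in> P" "eventually (\<lambda>n. x' n = x n) \<omega>" by (rule linear_growth_representative[OF assms])
  then show ?thesis unfolding cone_class_eq[OF x'] cone_def by (intro quotientI)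
qed

lemma cone_class_exists: assumes "A \<in> cone M d x0 \<omega>" obtains x where "linear_growth \<omega> x0 x" "A = cone_class \<omega> x0 x"
proof -
  obtain x where "x \<in> P" "A = cls `` {x}" using assms by (auto simp: cone_def quotient_def)
  then show ?thesis using that[of x] precone_linear_growth cone_class_eq[of x x] by simp
qed

lemma pd_cong:
  assumes "x \<in> P" "y \<in> P" "x' \<in> P" "y' \<in> P" "pd x x' = 0" "pd y y' = 0"
  shows "pd x' y' = pd x y"
proof -
  have "pd x' y' \<le> pd x y" if "x \<in> P" "y \<in> P" "x' \<in> P" "y' \<in> P" "pd x x' = 0" "pd y y' = 0" for x y x' y'
  proof (rule pd_le)
    fix \<epsilon> :: real assume "0 < \<epsilon>"
    then have e: "0 < \<epsilon> / 3" by simp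
    show "eventually (\<lambda>n. d (x' n) (y' n) \<le> (pd x y + \<epsilon>) * real n) \<omega>"
      using pd_eventually[OF that(1,3) e] pd_eventually[OF that(2,4) e] pd_eventually[OF that(1,2) e]
    proof eventually_elim
      case (elim n)
      have "d (x' n) (y' n) \<le> d (x' n) (x n) + (d (x n) (y n) + d (y n) (y' n))"
        using triangle[of "x' n" "x n" "y' n"] triangle[of "x n" "y n" "y' n"] that by (auto simp: precone_D)
      then show ?case using elim that(5,6) commute[of "x' n" "x n"] by (simp add: algebra_simps)
    qed
  qed (use that in auto)
  moreover have "pd x' x = 0" "pd y' y = 0" using assms by (simp_all add: precone_dist_def commute)
  ultimately show ?thesis using assms by (intro antisym) auto
qed

lemma cone_dist_class_eq:
  assumes x: "x \<in> P" "eventually (\<lambda>n. x n = x' n) \<omega>" and y: "y \<in> P" "eventually (\<lambda>n. y n = y' n) \<omega>"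
  shows "cone_dist M d x0 \<omega> (cone_class \<omega> x0 x') (cone_class \<omega> x0 y') = pd x y"
proof -
  have refl: "pd x x = 0" if "x \<in> P" for x
    using that precone_D[OF that] by (subst pd_zero_iff) auto
  have "(THE r. \<forall>a\<in>cls `` {x}. \<forall>b\<in>cls `` {y}. r = pd a b) = pd x y"
  proof (rule the_equality)
    show "\<forall>a\<in>cls `` {x}. \<forall>b\<in>cls `` {y}. pd x y = pd a b"
      using x(1) y(1) by (auto intro!: pd_cong[symmetric])
    show "r = pd x y" if "\<forall>a\<in>cls `` {x}. \<forall>b\<in>cls `` {y}. r = pd a b" for r
      using that x(1) y(1) refl by blast
  qed
  moreover have "cls `` {x} \<in> cone M d x0 \<omega>" "cls `` {y} \<in> cone M d x0 \<omega>"
    unfolding cone_def by (rule quotientI[OF x(1)], rule quotientI[OF y(1)])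
  ultimately show ?thesis unfolding cone_class_eq[OF x] cone_class_eq[OF y] cone_dist_def by simp
qed

lemma cone_dist_class_eventually:
  assumes "linear_growth \<omega> x0 x" "linear_growth \<omega> x0 y" "0 < \<epsilon>"
  shows "eventually (\<lambda>n. d (x n) (y n) \<le> (cone_dist M d x0 \<omega> (cone_class \<omega> x0 x) (cone_class \<omega> x0 y) + \<epsilon>) * real n) \<omega>"
proof -
  obtain x' where x': "x' \<in> P" "eventually (\<lambda>n. x' n = x n) \<omega>" by (rule linear_growth_representative[OF assms(1)])
  obtain y' where y': "y' \<in> P" "eventually (\<lambda>n. y' n = y n) \<omega>" by (rule linear_growth_representative[OF assms(2)])
  show ?thesis
    unfolding cone_dist_class_eq[OF x' y'] using pd_eventually[OF x'(1) y'(1) assms(3)] x'(2) y'(2)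
    by eventually_elim simp
qed

lemma cone_dist_class_le:
  assumes "linear_growth \<omega> x0 x" "linear_growth \<omega> x0 y"
    and e: "\<And>\<epsilon>. 0 < \<epsilon> \<Longrightarrow> eventually (\<lambda>n. d (x n) (y n) \<le> (c + \<epsilon>) * real n) \<omega>"
  shows "cone_dist M d x0 \<omega> (cone_class \<omega> x0 x) (cone_class \<omega> x0 y) \<le> c"
proof -
  obtain x' where x': "x' \<in> P" "eventually (\<lambda>n. x' n = x n) \<omega>" by (rule linear_growth_representative[OF assms(1)])
  obtain y' where y': "y' \<in> P" "eventually (\<lambda>n. y' n = y n) \<omega>" by (rule linear_growth_representative[OF assms(2)])
  show ?thesis
    unfolding cone_dist_class_eq[OF x' y']
  proof (rule pd_le[OF x'(1) y'(1)])
    fix \<epsilon> :: real assume "0 < \<epsilon>"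
    from e[OF this] x'(2) y'(2) show "eventually (\<lambda>n. d (x' n) (y' n) \<le> (c + \<epsilon>) * real n) \<omega>"
      by eventually_elim simp
  qed
qed

end

end

section \<open>Flats in the asymptotic cone\<close>

locale A4_cone = A4_generated C \<beta> S for C and \<beta> :: "'k::{topological_field, t2_space}" and S +
  fixes \<omega> :: "nat filter"
  assumes \<omega>: "nonprincipal_ultrafilter \<omega>"
begin

text \<open>The rescaled size along the ultrafilter, for sequences in the field with pointwise operations.
  Allowing every \<open>\<epsilon>\<close> absorbs additive constants.\<close>

definition sz :: "(nat \<Rightarrow> 'k) \<Rightarrow> real \<Rightarrow> bool" where
  "sz x a \<longleftrightarrow> (\<forall>\<epsilon>>0. eventually (\<lambda>n. x n \<in> L ((a + \<epsilon>) * real n)) \<omega>)"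

lemma szI: "(\<And>\<epsilon>. 0 < \<epsilon> \<Longrightarrow> eventually (\<lambda>n. x n \<in> L ((a + \<epsilon>) * real n)) \<omega>) \<Longrightarrow> sz x a"
  by (simp add: sz_def)

lemma szD: "sz x a \<Longrightarrow> 0 < \<epsilon> \<Longrightarrow> eventually (\<lambda>n. x n \<in> L ((a + \<epsilon>) * real n)) \<omega>"
  by (simp add: sz_def)

lemma eventually_large: "0 < \<epsilon> \<Longrightarrow> eventually (\<lambda>n. c \<le> \<epsilon> * real n) \<omega>"
  by (rule eventually_linear_large[OF \<omega>])

text \<open>A sequence of units of rescaled size exactly \<open>a\<close>.\<close>

definition pw :: "real \<Rightarrow> nat \<Rightarrow> 'k" where "pw a = (\<lambda>n. \<beta> powi \<lfloor>a * real n\<rfloor>)"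
definition ipw :: "real \<Rightarrow> nat \<Rightarrow> 'k" where "ipw a = (\<lambda>n. inverse (pw a n))"

lemma pw_nz [simp]: "pw a n \<noteq> 0" using \<beta>_nz by (simp add: pw_def)

lemma powi_L: "real_of_int m \<le> t \<Longrightarrow> \<beta> powi m \<in> L t"
  by (rule L_mono[OF L_pow])

lemma sz_pw: "sz (pw a) a" "sz (ipw a) (- a)" "pw a * ipw a = 1"
proof -
  show "sz (pw a) a"
  proof (rule szI)
    fix \<epsilon> :: real assume "0 < \<epsilon>"
    then have "pw a n \<in> L ((a + \<epsilon>) * real n)" for n
      unfolding pw_def by (intro powi_L) (simp add: algebra_simps add_increasing)
    then show "eventually (\<lambda>n. pw a n \<in> L ((a + \<epsilon>) * real n)) \<omega>" by simp
  qed
  show "sz (ipw a) (- a)"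
  proof (rule szI)
    fix \<epsilon> :: real assume "0 < \<epsilon>"
    from eventually_large[OF this, of 1] show "eventually (\<lambda>n. ipw a n \<in> L ((- a + \<epsilon>) * real n)) \<omega>"
    proof eventually_elim
      case (elim n)
      have "ipw a n = \<beta> powi (- \<lfloor>a * real n\<rfloor>)" by (simp add: ipw_def pw_def power_int_minus)
      moreover have "real_of_int (- \<lfloor>a * real n\<rfloor>) \<le> (- a + \<epsilon>) * real n"
        using elim by (simp add: algebra_simps) linarith
      ultimately show ?case by (simp only: powi_L)
    qed
  qed
  show "pw a * ipw a = 1" by (auto simp: ipw_def times_fun_def one_fun_def)
qed

sublocale sized_ring sz
proof
  fix x y :: "nat \<Rightarrow> 'k" and a b :: real
  show "sz x b" if "sz x a" "a \<le> b"
  proof (rule szI)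
    fix \<epsilon> :: real assume "0 < \<epsilon>"
    from szD[OF that(1) this] show "eventually (\<lambda>n. x n \<in> L ((b + \<epsilon>) * real n)) \<omega>"
      by eventually_elim (erule L_mono, use that(2) in \<open>simp add: mult_right_mono\<close>)
  qed
  show "sz 0 a" by (simp add: sz_def)
  show "sz (x + y) a" if "sz x a" "sz y a"
  proof (rule szI)
    fix \<epsilon> :: real assume "0 < \<epsilon>"
    then have e: "0 < \<epsilon> / 2" by simp
    from szD[OF that(1) e] szD[OF that(2) e] eventually_large[OF e, of "real k"]
    show "eventually (\<lambda>n. (x + y) n \<in> L ((a + \<epsilon>) * real n)) \<omega>"
      by eventually_elim (simp, erule (1) L_add', simp add: algebra_simps)
  qed
  show "sz (- x) a" if "sz x a"
  proof (rule szI)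
    fix \<epsilon> :: real assume "0 < \<epsilon>"
    then have e: "0 < \<epsilon> / 2" by simp
    from szD[OF that(1) e] eventually_large[OF e, of "real k"]
    show "eventually (\<lambda>n. (- x) n \<in> L ((a + \<epsilon>) * real n)) \<omega>"
      by eventually_elim (rule L_mono, simp, erule L_minus, simp add: algebra_simps)
  qed
  show "sz (x * y) (a + b)" if "sz x a" "sz y b"
  proof (rule szI)
    fix \<epsilon> :: real assume "0 < \<epsilon>"
    then have e: "0 < \<epsilon> / 3" by simp
    from szD[OF that(1) e] szD[OF that(2) e] eventually_large[OF e, of "real k"]
    show "eventually (\<lambda>n. (x * y) n \<in> L ((a + b + \<epsilon>) * real n)) \<omega>"
      by eventually_elim (simp, erule (1) L_mult', simp add: algebra_simps)
  qed
  show "\<exists>x y. sz x a \<and> sz y (- a) \<and> x * y = 1" using sz_pw by blast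
qed

definition uni_at :: "(nat \<Rightarrow> 'k) uni \<Rightarrow> nat \<Rightarrow> 'k uni" where
  "uni_at u n = Uni (e12 u n) (e13 u n) (e14 u n) (e23 u n) (e24 u n) (e34 u n)"

lemma uni_at_mult [simp]: "uni_at (u * v) n = uni_at u n * uni_at v n" and uni_at_uinv [simp]: "uni_at (uinv u) n = uinv (uni_at u n)"
  by (simp_all add: uni_at_def times_uni_def uinv_def fun_diff_def)

text \<open>A representative of the point \<open>p\<close> of the flat of \<open>u\<close>.\<close>

definition flat_seq :: "(nat \<Rightarrow> 'k) uni \<Rightarrow> real \<times> real \<Rightarrow> nat \<Rightarrow> 'k ^ 4 ^ 4" where
  "flat_seq u p n = udiag (pw (fst p) n) (pw (snd p) n) (uni_at u n)"

interpretation A4: group "A4 :: ('k ^ 4 ^ 4) monoid" by (rule group_A4)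

abbreviation "G \<equiv> carrier (A4 :: ('k ^ 4 ^ 4) monoid)"
abbreviation "wd \<equiv> word_dist (A4 :: ('k ^ 4 ^ 4) monoid) S"
abbreviation "o1 \<equiv> \<one>\<^bsub>A4 :: ('k ^ 4 ^ 4) monoid\<^esub>"

interpretation W: Metric_space G wd by (rule A4.Metric_space_word_dist[OF S(1,3)])

lemma one_G: "o1 \<in> G" by (rule A4.one_closed)

abbreviation "cls_of \<equiv> W.cone_class \<omega> o1"
abbreviation "linear_growth \<equiv> W.linear_growth \<omega> o1"
abbreviation "cd \<equiv> cone_dist G wd o1 \<omega>"

lemma wd_udiag:
  assumes "s \<noteq> 0" "t \<noteq> 0" "s' \<noteq> 0" "t' \<noteq> 0"
  shows "wd (udiag s t u) (udiag s' t' v) = real (wl (udiag (s' / s) (t' / t) (twist (inverse s) (inverse t) (uinv u * v))))"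
  using assms by (simp add: word_dist_def A4_inv A4_mult udiag_mult twist_mult divide_inverse mult.commute)

lemma coords_le_mono: "coords_le r s t u \<Longrightarrow> r \<le> r' \<Longrightarrow> coords_le r' s t u"
  unfolding coords_le_def using L_mono by (meson subsetD subsetI)

text \<open>How the upper bound for word lengths turns into an upper bound for distances in the cone.\<close>

lemma cd_le:
  assumes r: "0 \<le> r" and a: "linear_growth x" "linear_growth y"
    and g: "\<And>\<epsilon>. 0 < \<epsilon> \<Longrightarrow> eventually (\<lambda>n. \<exists>s t u. wd (x n) (y n) = real (wl (udiag s t u)) \<and> coords_le ((r + \<epsilon>) * real n) s t u) \<omega>"
    and A: "0 \<le> A" "\<And>m s t u. 0 \<le> m \<Longrightarrow> coords_le m s t u \<Longrightarrow> real (wl (udiag s t u)) \<le> A * (m + 1)"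
  shows "cd (cls_of x) (cls_of y) \<le> A * r"
proof (rule W.cone_dist_class_le[OF \<omega> one_G a])
  fix \<epsilon> :: real assume \<epsilon>: "0 < \<epsilon>"
  \<comment> \<open>Half of the error pays for \<open>e\<close> in the size, half for the additive constant \<open>A\<close>; the denominator is positive even if \<open>A = 0\<close>.\<close>
  define e where "e = \<epsilon> / (2 * (A + 1))"
  have e: "0 < e" "2 * (A * e) \<le> \<epsilon>" using \<epsilon> A by (auto simp: e_def field_simps)
  from g[OF e(1)] eventually_large[OF e(1), of 1]
  show "eventually (\<lambda>n. wd (x n) (y n) \<le> (A * r + \<epsilon>) * real n) \<omega>"
  proof eventually_elim
    case (elim n)
    then obtain s t u where stu: "wd (x n) (y n) = real (wl (udiag s t u))" "coords_le ((r + e) * real n) s t u" by blast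
    have "wd (x n) (y n) \<le> A * ((r + e) * real n + 1)"
      unfolding stu(1) by (rule A(2)[OF _ stu(2)]) (use r e in simp)
    also have "\<dots> \<le> A * ((r + e) * real n + e * real n)" using A(1) elim(2) by (intro mult_left_mono) auto
    also have "\<dots> = (A * r + 2 * (A * e)) * real n" by (simp add: algebra_simps)
    also have "\<dots> \<le> (A * r + \<epsilon>) * real n" using e(2) by (intro mult_right_mono) auto
    finally show ?case .
  qed
qed

lemma wd_flat_seq_shear: "wd (flat_seq u p n) (flat_seq (u * w) p n) = real (wl (udiag 1 1 (twist (inverse (pw (fst p) n)) (inverse (pw (snd p) n)) (uni_at w n))))"
  by (simp add: flat_seq_def wd_udiag)

lemma wd_flat_seq_flat: "wd (flat_seq u p n) (flat_seq u q n) = real (wl (udiag (pw (fst q) n / pw (fst p) n) (pw (snd q) n / pw (snd p) n) 1))"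
  by (simp add: flat_seq_def wd_udiag)

lemma pw_quotient: 
  assumes "0 < \<epsilon>" "\<bar>b - a\<bar> \<le> r"
  shows "eventually (\<lambda>n. pw b n / pw a n \<in> L ((r + \<epsilon>) * real n)) \<omega>"
  using eventually_large[OF assms(1), of 1]
proof eventually_elim
  case (elim n)
  have eq: "pw b n / pw a n = \<beta> powi (\<lfloor>b * real n\<rfloor> - \<lfloor>a * real n\<rfloor>)"
    using \<beta>_nz by (simp add: pw_def power_int_diff)
  have "b * real n - a * real n \<le> r * real n"
    using assms(2) mult_right_mono[of "b - a" r "real n"] by (simp add: algebra_simps)
  then have "real_of_int (\<lfloor>b * real n\<rfloor> - \<lfloor>a * real n\<rfloor>) \<le> (r + \<epsilon>) * real n"
    using elim by (simp add: algebra_simps) linarith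
  then show ?case unfolding eq by (rule powi_L)
qed

lemma one_L_nonneg: "0 \<le> t \<Longrightarrow> 1 \<in> L t" using L_mono[OF L_1] .

text \<open>Conjugating \<open>w\<close> by the diagonal part of \<open>flat_seq u p\<close> changes the size at \<open>(i, j)\<close> by \<open>p_j - p_i\<close>,
  so that the sizes relative to \<open>p\<close> in \<open>box p r\<close> become the actual sizes.\<close>

lemma shear_bound:
  assumes u: "linear_growth (flat_seq u p)" "linear_growth (flat_seq (u * w) p)" and r: "0 \<le> r" and w: "w \<in> box p r"
    and A: "0 \<le> A" "\<And>m s t u. 0 \<le> m \<Longrightarrow> coords_le m s t u \<Longrightarrow> real (wl (udiag s t u)) \<le> A * (m + 1)"
  shows "cd (cls_of (flat_seq u p)) (cls_of (flat_seq (u * w) p)) \<le> A * (3 * r)"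
proof (rule cd_le[OF _ u _ A])
  let ?s = "pw (fst p)" and ?t = "pw (snd p)"
  have m: "sz x (3 * r)" if "sz x a" "a \<le> 3 * r" for x a using sz_mono that by blast
  have *: "sz (e12 w * ?s) (3 * r)" "sz (e13 w * ?t) (3 * r)" "sz (e14 w) (3 * r)"
     "sz (ipw (fst p) * e23 w * ?t) (3 * r)" "sz (ipw (fst p) * e24 w) (3 * r)" "sz (ipw (snd p) * e34 w) (3 * r)"
    using w r
    by (auto simp: box_def intro!: sz_mult'[OF _ sz_pw(1)] sz_mult'[OF sz_pw(2)] sz_mult[OF sz_pw(2)])
  fix \<epsilon> :: real assume \<epsilon>: "0 < \<epsilon>"
  from *[THEN szD[OF _ \<epsilon>]] show "eventually (\<lambda>n. \<exists>s t v. wd (flat_seq u p n) (flat_seq (u * w) p n) = real (wl (udiag s t v)) \<and> coords_le ((3 * r + \<epsilon>) * real n) s t v) \<omega>"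
  proof eventually_elim
    case (elim n)
    have "coords_le ((3 * r + \<epsilon>) * real n) 1 1 (twist (inverse (?s n)) (inverse (?t n)) (uni_at w n))"
      using elim r \<epsilon> one_L_nonneg[of "(3 * r + \<epsilon>) * real n"]
      by (simp add: coords_le_def set_uni_iff twist_def uni_at_def ipw_def divide_inverse)
    then show ?case unfolding wd_flat_seq_shear by blast
  qed
qed (use r in simp)

lemma flat_bound:
  assumes u: "linear_growth (flat_seq u p)" "linear_growth (flat_seq u q)"
    and A: "0 \<le> A" "\<And>m s t u. 0 \<le> m \<Longrightarrow> coords_le m s t u \<Longrightarrow> real (wl (udiag s t u)) \<le> A * (m + 1)"
  shows "cd (cls_of (flat_seq u p)) (cls_of (flat_seq u q)) \<le> A * dist p q"
proof (rule cd_le[OF _ u _ A])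
  have d: "\<bar>fst p - fst q\<bar> \<le> dist p q" "\<bar>snd p - snd q\<bar> \<le> dist p q"
    using dist_fst_le[of p q] dist_snd_le[of p q] by (auto simp: dist_real_def)
  then have d': "\<bar>fst q - fst p\<bar> \<le> dist p q" "\<bar>snd q - snd p\<bar> \<le> dist p q" by linarith+
  fix \<epsilon> :: real assume \<epsilon>: "0 < \<epsilon>"
  from pw_quotient[OF \<epsilon> d(1)] pw_quotient[OF \<epsilon> d(2)] pw_quotient[OF \<epsilon> d'(1)] pw_quotient[OF \<epsilon> d'(2)]
  show "eventually (\<lambda>n. \<exists>s t v. wd (flat_seq u p n) (flat_seq u q n) = real (wl (udiag s t v)) \<and> coords_le ((dist p q + \<epsilon>) * real n) s t v) \<omega>"
  proof eventually_elim
    case (elim n)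
    have "coords_le ((dist p q + \<epsilon>) * real n) (pw (fst q) n / pw (fst p) n) (pw (snd q) n / pw (snd p) n) 1"
      using elim by (simp add: coords_le_def set_uni_iff one_uni_def)
    then show ?case unfolding wd_flat_seq_flat by blast
  qed
qed simp

lemma wd_one_udiag: "s \<noteq> 0 \<Longrightarrow> t \<noteq> 0 \<Longrightarrow> wd o1 (udiag s t u) = real (wl (udiag s t u))"
  using wd_udiag[of 1 1 s t 1 u] by (simp add: A4_one uinv_def one_uni_def times_uni_def)

lemma linear_growth_flat_seq:
  assumes u: "u \<in> finite_size"
    and A: "0 \<le> A" "\<And>m s t u. 0 \<le> m \<Longrightarrow> coords_le m s t u \<Longrightarrow> real (wl (udiag s t u)) \<le> A * (m + 1)"
  shows "linear_growth (flat_seq u p)"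
proof -
  obtain r where r: "0 \<le> r" "u \<in> box (0, 0) r" using u by (auto simp: finite_size_def)
  define R where "R = 3 * r + \<bar>fst p\<bar> + \<bar>snd p\<bar>"
  have R0: "0 \<le> R" using r by (simp add: R_def)
  have *: "sz (e12 u) R" "sz (e13 u) R" "sz (e14 u) R" "sz (e23 u) R" "sz (e24 u) R" "sz (e34 u) R"
    "sz (pw (fst p)) R" "sz (pw (snd p)) R" "sz (ipw (fst p)) R" "sz (ipw (snd p)) R"
    using r sz_pw(1,2)[of "fst p"] sz_pw(1,2)[of "snd p"] by (auto simp: box_def R_def elim!: sz_mono)
  have "eventually (\<lambda>n. wd (flat_seq u p n) o1 \<le> (A * (R + 2)) * real n) \<omega>"
    using *[THEN szD[OF _ zero_less_one]] eventually_large[OF zero_less_one, of 1]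
  proof eventually_elim
    case (elim n)
    have "coords_le ((R + 1) * real n) (pw (fst p) n) (pw (snd p) n) (uni_at u n)"
      using elim by (simp add: coords_le_def set_uni_iff uni_at_def ipw_def)
    then have "real (wl (flat_seq u p n)) \<le> A * ((R + 1) * real n + 1)"
      unfolding flat_seq_def by (rule A(2)[rotated]) (use R0 in simp)
    also have "\<dots> \<le> A * ((R + 1) * real n + real n)" using elim A(1) by (intro mult_left_mono) auto
    also have "\<dots> = (A * (R + 2)) * real n" by (simp add: algebra_simps)
    finally show ?case using wd_one_udiag[of "pw (fst p) n" "pw (snd p) n" "uni_at u n"] W.commute[of "flat_seq u p n" o1]
      by (simp add: flat_seq_def)
  qed
  then show ?thesis by (auto simp: W.linear_growth_def flat_seq_def)
qed

lemma sz_one: assumes "sz 1 c" shows "0 \<le> c"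
proof (rule field_le_epsilon)
  fix \<epsilon> :: real assume "0 < \<epsilon>"
  from szD[OF assms this] eventually_large[OF zero_less_one, of 1]
  have "eventually (\<lambda>n. 0 \<le> c + \<epsilon>) \<omega>"
  proof eventually_elim
    case (elim n)
    then have "0 \<le> (c + \<epsilon>) * real n" "0 < real n" using one_L by auto
    then show ?case by (simp add: zero_le_mult_iff)
  qed
  then show "0 \<le> c + \<epsilon>" using W.filter_nontrivial[OF \<omega> one_G] by (simp add: eventually_const_iff)
qed

text \<open>The quotient has size exactly \<open>b - a\<close>: multiplied by its inverse it gives \<open>1\<close>, whose size
  is not negative.\<close>

lemma pw_quotient_le:
  assumes "sz (pw b * ipw a) r"
  shows "b - a \<le> r"
proof -
  have "sz ((pw b * ipw a) * (pw a * ipw b)) (r + (a + - b))"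
    by (intro sz_mult assms sz_pw)
  moreover have "(pw b * ipw a) * (pw a * ipw b) = 1"
    by (intro ext) (simp add: ipw_def field_simps)
  ultimately show ?thesis using sz_one by fastforce
qed

text \<open>The lower bound for word lengths applied to the quotient of the two sequences; its diagonal part
  compares \<open>p\<close> with \<open>q\<close>, and its unipotent part is a conjugate of \<open>uinv u * v\<close> by powers of \<open>\<beta>\<close>.\<close>

lemma separated_bound:
  assumes a: "linear_growth (flat_seq u p)" "linear_growth (flat_seq v q)"
    and A: "0 \<le> A" "\<And>g. g \<in> G \<Longrightarrow> coords_le (A * real (wl g)) (diag2 g) (diag3 g) (unipotent_part g)"
  defines "r \<equiv> A * cd (cls_of (flat_seq u p)) (cls_of (flat_seq v q))"
  shows "dist p q \<le> 2 * r" "uinv u * v \<in> box p r"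
proof -
  let ?w = "uinv u * v" and ?s = "pw (fst p)" and ?t = "pw (snd p)" and ?is = "ipw (fst p)" and ?it = "ipw (snd p)"
  have ev: "eventually (\<lambda>n. coords_le ((r + \<epsilon>) * real n) (pw (fst q) n / ?s n) (pw (snd q) n / ?t n)
      (twist (inverse (?s n)) (inverse (?t n)) (uni_at ?w n))) \<omega>" if \<epsilon>: "0 < \<epsilon>" for \<epsilon>
  proof -
    define e where "e = \<epsilon> / (A + 1)"
    have e: "0 < e" "A * e \<le> \<epsilon>" using \<epsilon> A by (auto simp: e_def field_simps)
    from W.cone_dist_class_eventually[OF \<omega> one_G a e(1)] show ?thesis
    proof eventually_elim
      case (elim n)
      let ?g = "udiag (pw (fst q) n / ?s n) (pw (snd q) n / ?t n) (twist (inverse (?s n)) (inverse (?t n)) (uni_at ?w n))"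
      have g: "?g \<in> G" by simp
      have "A * real (wl ?g) \<le> A * ((cd (cls_of (flat_seq u p)) (cls_of (flat_seq v q)) + e) * real n)"
        using elim A(1) by (intro mult_left_mono) (simp_all add: flat_seq_def wd_udiag)
      also have "\<dots> = (r + A * e) * real n" by (simp add: r_def algebra_simps)
      also have "\<dots> \<le> (r + \<epsilon>) * real n" using e by (intro mult_right_mono) auto
      finally show ?case using coords_le_mono[OF A(2)[OF g]] by simp
    qed
  qed
  have szr: "sz x r" if "\<And>n \<rho>. coords_le \<rho> (pw (fst q) n / ?s n) (pw (snd q) n / ?t n)
      (twist (inverse (?s n)) (inverse (?t n)) (uni_at ?w n)) \<Longrightarrow> x n \<in> L \<rho>" for x
    by (rule szI) (rule eventually_mono[OF ev], assumption, erule that)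
  have q: "sz (pw (fst q) * ?is) r" "sz (pw (fst p) * ipw (fst q)) r" "sz (pw (snd q) * ?it) r" "sz (pw (snd p) * ipw (snd q)) r"
    by (rule szr, simp add: coords_le_def ipw_def divide_inverse mult.commute)+
  have w: "sz (e12 ?w * ?s) r" "sz (e13 ?w * ?t) r" "sz (e14 ?w) r" "sz (?is * e23 ?w * ?t) r" "sz (?is * e24 ?w) r" "sz (?it * e34 ?w) r"
    by (rule szr, simp only: coords_le_def set_uni_iff twist_def uni_at_def ipw_def divide_inverse uni.sel times_fun_apply inverse_inverse_eq)+
  have "\<bar>fst p - fst q\<bar> \<le> r" "\<bar>snd p - snd q\<bar> \<le> r"
    using q[THEN pw_quotient_le] by auto
  moreover have "dist p q \<le> \<bar>fst p - fst q\<bar> + \<bar>snd p - snd q\<bar>"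
    using sqrt_sum_squares_le_sum_abs[of "fst p - fst q" "snd p - snd q"] by (simp add: dist_prod_def dist_real_def)
  ultimately show "dist p q \<le> 2 * r" by linarith
  have r0: "0 \<le> r" using \<open>\<bar>fst p - fst q\<bar> \<le> r\<close> by linarith
  have c: "x * pw a * ipw a = x" "ipw a * x * pw a = x" "pw a * (ipw a * x) = x" for x a
    by (intro ext; simp add: ipw_def field_simps)+
  have "sz (e12 ?w) (r + - fst p)" using sz_mult[OF w(1) sz_pw(2)[of "fst p"]] by (simp only: c)
  moreover have "sz (e13 ?w) (r + - snd p)" using sz_mult[OF w(2) sz_pw(2)[of "snd p"]] by (simp only: c)
  moreover have "sz (e23 ?w) (fst p + (r + - snd p))"
  proof -
    have "pw (fst p) * (?is * e23 ?w * ?t * ?it) = e23 ?w" by (intro ext) (simp add: ipw_def field_simps)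
    then show ?thesis using sz_mult[OF sz_pw(1)[of "fst p"] sz_mult[OF w(4) sz_pw(2)[of "snd p"]]] by (simp only:)
  qed
  moreover have "sz (e24 ?w) (fst p + r)" using sz_mult[OF sz_pw(1)[of "fst p"] w(5)] by (simp only: c)
  moreover have "sz (e34 ?w) (snd p + r)" using sz_mult[OF sz_pw(1)[of "snd p"] w(6)] by (simp only: c)
  ultimately show "?w \<in> box p r"
    using w(3) r0 by (auto simp: box_def elim!: sz_mono)
qed

text \<open>The limit along the ultrafilter of \<open>1/n\<close> times the exponents in the polar decompositions.\<close>

lemma diag_limit:
  assumes nz: "\<And>n. x n \<noteq> 0" and R: "0 \<le> R"
    and x: "eventually (\<lambda>n. x n \<in> L (R * real n)) \<omega>" "eventually (\<lambda>n. inverse (x n) \<in> L (R * real n)) \<omega>"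
  shows "\<exists>p. \<forall>\<epsilon>>0. eventually (\<lambda>n. pw p n / x n \<in> L (\<epsilon> * real n)) \<omega> \<and>
    eventually (\<lambda>n. x n / pw p n \<in> L (\<epsilon> * real n)) \<omega>"
proof -
  have "\<exists>i::int. x n \<in> L i \<and> inverse (x n) \<in> L (real k - i)" for n
    by (rule L_polar[OF nz[of n]]) blast
  then obtain i :: "nat \<Rightarrow> int" where i: "\<And>n. x n \<in> L (i n)" "\<And>n. inverse (x n) \<in> L (real k - i n)" by metis
  have "eventually (\<lambda>n. \<bar>real_of_int (i n) / real n\<bar> \<le> R + 2) \<omega>"
    using x eventually_large[OF zero_less_one, of "real k"] eventually_large[OF zero_less_one, of 1]
  proof eventually_elim
    case (elim n)
    have "1 \<in> L (R * real n + (real k - i n) + real k)" "1 \<in> L (i n + R * real n + real k)"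
      using L_mult[OF elim(1) i(2)[of n]] L_mult[OF i(1)[of n] elim(2)] nz[of n] by simp_all
    then have "0 \<le> R * real n + (real k - i n) + real k" "0 \<le> i n + R * real n + real k" using one_L by blast+
    then have "\<bar>real_of_int (i n)\<bar> \<le> (R + 2) * real n" using elim by (simp add: algebra_simps)
    then show ?case using elim by (simp add: field_simps)
  qed
  then obtain p where p: "((\<lambda>n. real_of_int (i n) / real n) \<longlongrightarrow> p) \<omega>" by (rule ultralimit_exists[OF \<omega>])
  have close: "eventually (\<lambda>n. \<bar>i n - p * real n\<bar> \<le> \<epsilon> * real n) \<omega>" if "0 < \<epsilon>" for \<epsilon>
    using tendstoD[OF p that] eventually_large[OF zero_less_one, of 1]
  proof eventually_elim
    case (elim n)
    have "i n - p * real n = (i n / real n - p) * real n" using elim by (simp add: field_simps)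
    then have "\<bar>i n - p * real n\<bar> = \<bar>i n / real n - p\<bar> * real n" by (simp add: abs_mult)
    also have "\<dots> \<le> \<epsilon> * real n" using elim by (intro mult_right_mono) (auto simp: dist_real_def)
    finally show ?case .
  qed
  show ?thesis
  proof (intro exI[of _ p] allI impI conjI)
    fix \<epsilon> :: real assume "0 < \<epsilon>"
    then have e: "0 < \<epsilon> / 2" by simp
    have half: "\<epsilon> * real n = \<epsilon> / 2 * real n + \<epsilon> / 2 * real n" for n by simp
    show "eventually (\<lambda>n. pw p n / x n \<in> L (\<epsilon> * real n)) \<omega>"
      using close[OF e] eventually_large[OF e, of "2 * real k"]
    proof eventually_elim
      case (elim n)
      have "pw p n \<in> L (p * real n)" unfolding pw_def by (rule powi_L) simp
      then have "pw p n * inverse (x n) \<in> L (\<epsilon> * real n)"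
        by (rule L_mult'[OF _ i(2)]) (use elim half[of n] in linarith)
      then show ?case by (simp add: divide_inverse)
    qed
    show "eventually (\<lambda>n. x n / pw p n \<in> L (\<epsilon> * real n)) \<omega>"
      using close[OF e] eventually_large[OF e, of "real k + 1"]
    proof eventually_elim
      case (elim n)
      have "inverse (pw p n) = \<beta> powi (- \<lfloor>p * real n\<rfloor>)" by (simp add: pw_def power_int_minus)
      moreover have "\<beta> powi (- \<lfloor>p * real n\<rfloor>) \<in> L (1 - p * real n)" by (rule powi_L) linarith
      ultimately have "inverse (pw p n) \<in> L (1 - p * real n)" by simp
      then have "x n * inverse (pw p n) \<in> L (\<epsilon> * real n)"
        by (rule L_mult'[OF i(1)]) (use elim half[of n] in linarith)
      then show ?case by (simp add: divide_inverse)
    qed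
  qed
qed

text \<open>The unipotent part of a sequence is \<open>u\<close> as it stands; the diagonal part may be replaced by
  powers of \<open>\<beta>\<close> at sublinear cost.\<close>

lemma cone_point:
  assumes a: "a \<in> cone G wd o1 \<omega>"
    and A: "0 \<le> A" "\<And>m s t u. 0 \<le> m \<Longrightarrow> coords_le m s t u \<Longrightarrow> real (wl (udiag s t u)) \<le> A * (m + 1)"
    and B: "0 \<le> B" "\<And>g. g \<in> G \<Longrightarrow> coords_le (B * real (wl g)) (diag2 g) (diag3 g) (unipotent_part g)"
  obtains u p where "u \<in> finite_size" "a = cls_of (flat_seq u p)"
proof -
  obtain x where x: "linear_growth x" "a = cls_of x" by (rule W.cone_class_exists[OF \<omega> one_G a])
  obtain c where c: "eventually (\<lambda>n. wd (x n) o1 \<le> c * real n) \<omega>" and xG: "\<And>n. x n \<in> G"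
    using x(1) by (auto simp: W.linear_growth_def)
  note co = A4_coords[OF xG]
  define R where "R = B * max c 0"
  have R: "0 \<le> R" using B by (simp add: R_def)
  have g: "eventually (\<lambda>n. coords_le (R * real n) (diag2 (x n)) (diag3 (x n)) (unipotent_part (x n))) \<omega>"
    using c
  proof eventually_elim
    case (elim n)
    have "real (wl (x n)) = wd (x n) o1"
      using wd_one_udiag[OF co(1,2), of n n "unipotent_part (x n)"] co(3)[of n] W.commute[of "x n" o1] by simp
    also have "\<dots> \<le> max c 0 * real n" using elim by (rule order_trans) (intro mult_right_mono, auto)
    finally have "B * real (wl (x n)) \<le> R * real n"
      using B(1) mult_left_mono[of "real (wl (x n))" "max c 0 * real n" B] by (simp add: R_def mult.assoc)
    then show ?case by (rule coords_le_mono[OF B(2)[OF xG]])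
  qed
  define u where "u = Uni (\<lambda>n. e12 (unipotent_part (x n))) (\<lambda>n. e13 (unipotent_part (x n))) (\<lambda>n. e14 (unipotent_part (x n)))
     (\<lambda>n. e23 (unipotent_part (x n))) (\<lambda>n. e24 (unipotent_part (x n))) (\<lambda>n. e34 (unipotent_part (x n)))"
  have uat: "uni_at u n = unipotent_part (x n)" for n by (simp add: uni_at_def u_def)
  have szR: "sz y R" if y: "\<And>n \<rho>. coords_le \<rho> (diag2 (x n)) (diag3 (x n)) (unipotent_part (x n)) \<Longrightarrow> y n \<in> L \<rho>" for y
  proof (rule szI)
    fix \<epsilon> :: real assume "0 < \<epsilon>"
    then have m: "R * real n \<le> (R + \<epsilon>) * real n" for n by (intro mult_right_mono) auto
    show "eventually (\<lambda>n. y n \<in> L ((R + \<epsilon>) * real n)) \<omega>"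
      using g by eventually_elim (rule L_mono[OF y m])
  qed
  have "sz (e12 u) R" "sz (e13 u) R" "sz (e14 u) R" "sz (e23 u) R" "sz (e24 u) R" "sz (e34 u) R"
    by (rule szR, simp add: u_def coords_le_def set_uni_iff)+
  then have "u \<in> box (0, 0) R" using R by (auto simp: box_def elim!: sz_mono)
  then have uF: "u \<in> finite_size" by (rule box_finite_size)
  have L: "eventually (\<lambda>n. diag2 (x n) \<in> L (R * real n)) \<omega>" "eventually (\<lambda>n. inverse (diag2 (x n)) \<in> L (R * real n)) \<omega>"
    "eventually (\<lambda>n. diag3 (x n) \<in> L (R * real n)) \<omega>" "eventually (\<lambda>n. inverse (diag3 (x n)) \<in> L (R * real n)) \<omega>"
    by (rule eventually_mono[OF g], simp add: coords_le_def)+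
  obtain p1 where p1: "\<And>\<epsilon>. 0 < \<epsilon> \<Longrightarrow> eventually (\<lambda>n. pw p1 n / diag2 (x n) \<in> L (\<epsilon> * real n)) \<omega>"
    "\<And>\<epsilon>. 0 < \<epsilon> \<Longrightarrow> eventually (\<lambda>n. diag2 (x n) / pw p1 n \<in> L (\<epsilon> * real n)) \<omega>"
    using diag_limit[of "\<lambda>n. diag2 (x n)", OF co(1) R L(1,2)] by auto
  obtain p2 where p2: "\<And>\<epsilon>. 0 < \<epsilon> \<Longrightarrow> eventually (\<lambda>n. pw p2 n / diag3 (x n) \<in> L (\<epsilon> * real n)) \<omega>"
    "\<And>\<epsilon>. 0 < \<epsilon> \<Longrightarrow> eventually (\<lambda>n. diag3 (x n) / pw p2 n \<in> L (\<epsilon> * real n)) \<omega>"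
    using diag_limit[of "\<lambda>n. diag3 (x n)", OF co(2) R L(3,4)] by auto
  let ?p = "(p1, p2)"
  have linear_growth: "linear_growth (flat_seq u ?p)" by (rule linear_growth_flat_seq[OF uF A])
  have "cd (cls_of x) (cls_of (flat_seq u ?p)) \<le> A * 0"
  proof (rule cd_le[OF order_refl x(1) linear_growth _ A])
    fix \<epsilon> :: real assume e: "0 < \<epsilon>"
    from p1(1)[OF e] p1(2)[OF e] p2(1)[OF e] p2(2)[OF e]
    show "eventually (\<lambda>n. \<exists>s t v. wd (x n) (flat_seq u ?p n) = real (wl (udiag s t v)) \<and> coords_le ((0 + \<epsilon>) * real n) s t v) \<omega>"
    proof eventually_elim
      case (elim n)
      have "wd (udiag (diag2 (x n)) (diag3 (x n)) (unipotent_part (x n))) (flat_seq u ?p n) = real (wl (udiag (pw p1 n / diag2 (x n)) (pw p2 n / diag3 (x n)) 1))"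
        using co(1,2) by (simp add: flat_seq_def wd_udiag uat)
      moreover have "coords_le ((0 + \<epsilon>) * real n) (pw p1 n / diag2 (x n)) (pw p2 n / diag3 (x n)) 1"
        using elim co(1,2) by (simp add: coords_le_def set_uni_iff one_uni_def)
      ultimately show ?case unfolding co(3) by blast
    qed
  qed
  moreover have "Metric_space (cone G wd o1 \<omega>) cd" by (rule W.Metric_space_cone[OF \<omega> one_G])
  then interpret X: Metric_space "cone G wd o1 \<omega>" cd .
  have "cls_of x = cls_of (flat_seq u ?p)"
    using calculation X.nonneg[of "cls_of x" "cls_of (flat_seq u ?p)"] X.zero[of "cls_of x" "cls_of (flat_seq u ?p)"]
      W.cone_class_in_cone[OF \<omega> one_G x(1)] W.cone_class_in_cone[OF \<omega> one_G linear_growth] by simp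
  then show ?thesis using that[OF uF, of ?p] x(2) by simp
qed

theorem cone_simply_connected: "simply_connected_space (cone_topology G wd o1 \<omega>)"
proof -
  obtain A where A: "0 \<le> A" "\<And>m s t u. 0 \<le> m \<Longrightarrow> coords_le m s t u \<Longrightarrow> real (wl (udiag s t u)) \<le> A * (m + 1)"
    using word_length_upper by blast
  obtain B where B: "0 \<le> B" "\<And>g. g \<in> G \<Longrightarrow> coords_le (B * real (wl g)) (diag2 g) (diag3 g) (unipotent_part g)"
    using word_length_lower by blast
  let ?X = "cone G wd o1 \<omega>"
  have M: "Metric_space ?X cd" by (rule W.Metric_space_cone[OF \<omega> one_G])
  then interpret X: Metric_space ?X cd .
  obtain \<kappa> :: "(nat \<Rightarrow> 'k ^ 4 ^ 4) set \<Rightarrow> (nat \<Rightarrow> 'k ^ 4 ^ 4) set discrete \<Rightarrow>\<^sub>C real"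
    where \<kappa>: "\<And>x y. x \<in> ?X \<Longrightarrow> y \<in> ?X \<Longrightarrow> dist (\<kappa> x) (\<kappa> y) = cd x y"
    by (rule Kuratowski_embedding[OF M]) blast
  define \<Phi> where "\<Phi> u p = \<kappa> (cls_of (flat_seq u p))" for u p
  have linear_growth: "linear_growth (flat_seq u p)" if "u \<in> finite_size" for u p by (rule linear_growth_flat_seq[OF that A])
  have PX: "cls_of (flat_seq u p) \<in> ?X" if "u \<in> finite_size" for u p by (rule W.cone_class_in_cone[OF \<omega> one_G linear_growth[OF that]])
  have dist_\<Phi>: "dist (\<Phi> u p) (\<Phi> v q) = cd (cls_of (flat_seq u p)) (cls_of (flat_seq v q))" if "u \<in> finite_size" "v \<in> finite_size" for u v p q
    unfolding \<Phi>_def by (rule \<kappa>[OF PX[OF that(1)] PX[OF that(2)]])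
  define K where "K = 3 * A + 2 * B"
  have K: "0 \<le> K" using A B by (simp add: K_def)
  have le: "A * r \<le> K * r" "A * (3 * r) \<le> K * r" "2 * (B * r) \<le> K * r" "B * r \<le> K * r" if "0 \<le> r" for r
    using that A(1) B(1) by (simp_all add: K_def distrib_right)
  interpret flat_complex sz \<Phi> K
  proof unfold_locales
    show "0 \<le> K" by (rule K)
    fix u assume u: "u \<in> finite_size"
    show "dist (\<Phi> u p) (\<Phi> (u * w) p) \<le> K * r" if "0 \<le> r" "w \<in> box p r" for w p r
    proof -
      have uw: "u * w \<in> finite_size" by (rule finite_size_mult[OF u box_finite_size[OF that(2)]])
      show ?thesis
        unfolding dist_\<Phi>[OF u uw] using shear_bound[OF linear_growth[OF u] linear_growth[OF uw] that A] le(2)[OF that(1)] by linarith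
    qed
    show "dist (\<Phi> u p) (\<Phi> u q) \<le> K * dist p q" for p q
      unfolding dist_\<Phi>[OF u u] using flat_bound[OF linear_growth[OF u] linear_growth[OF u] A, of p q] le(1)[of "dist p q"] by simp
    fix v p q assume v: "v \<in> finite_size"
    let ?\<delta> = "cd (cls_of (flat_seq u p)) (cls_of (flat_seq v q))"
    have \<delta>: "0 \<le> ?\<delta>" by simp
    note sb = separated_bound[OF linear_growth[OF u] linear_growth[OF v] B, of p q]
    have "uinv u * v \<in> box p (K * ?\<delta>)"
      using box_mono[OF sb(2), of p "K * ?\<delta>"] le(4)[OF \<delta>] by simp
    then show "dist p q \<le> K * dist (\<Phi> u p) (\<Phi> v q) \<and> uinv u * v \<in> box p (K * dist (\<Phi> u p) (\<Phi> v q))"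
      unfolding dist_\<Phi>[OF u v] using sb(1) le(3)[OF \<delta>] by simp
  qed
  have im: "\<kappa> ` ?X = flat_union"
  proof
    show "flat_union \<subseteq> \<kappa> ` ?X" using PX by (auto simp: flat_union_def \<Phi>_def)
    show "\<kappa> ` ?X \<subseteq> flat_union"
    proof (rule image_subsetI)
      fix a assume "a \<in> ?X"
      then obtain u p where "u \<in> finite_size" "a = cls_of (flat_seq u p)" by (rule cone_point[OF _ A B])
      then show "\<kappa> a \<in> flat_union" unfolding flat_union_def \<Phi>_def by blast
    qed
  qed
  show ?thesis
    unfolding cone_topology_def
    by (rule simply_connected_space_if_isometric[OF M \<kappa>]) (use flat_union_simply_connected in \<open>simp_all add: im\<close>)
qed

end

theorem corollary1p2:
  fixes S :: "('k::{topological_field, t2_space} ^ 4 ^ 4) set"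
    and \<omega> :: "nat filter"
  assumes "locally_compact_space (euclidean :: 'k topology)"
    and "(euclidean :: 'k topology) \<noteq> discrete_topology UNIV"
    and "S \<subseteq> carrier A4" and "compact S" and "generate A4 S = carrier A4"
    and "nonprincipal_ultrafilter \<omega>"
  shows "simply_connected_space (cone_topology (carrier A4) (word_dist A4 S) \<one>\<^bsub>A4\<^esub> \<omega>)"
proof -
  obtain C and \<beta> :: 'k where "contracting C \<beta>" using contracting_exists[OF assms(1,2)] by blast
  then interpret A4_cone C \<beta> S \<omega>
    using assms by (simp add: A4_cone_def A4_generated_def A4_generated_axioms_def A4_cone_axioms_def)
  show ?thesis by (rule cone_simply_connected)
qed

end
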